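(* Let $R$ be a Noetherian ring. Then $R$ is Cohen--Macaulay if and only if for every $k\ge 0$ and every ideal $I=(r_1,\dots,r_k)$ generated by $k$ elements $r_1,\dots,r_k\in R$ with $\operatorname{ht}(I)=k$, the ideal $I$ is unmixed.
   Context: Rings are commutative. The height $\operatorname{ht}(I)$ of a proper ideal is the infimum of the heights of the primes containing it; the unit ideal has height $\infty$. For a local ring $(A,\mathfrak{m})$, $\operatorname{depth}(A)$ is the least $i$ with $\operatorname{Ext}^i_A(A/\mathfrak{m},A)\ne0$ ($\infty$ if none); $A$ is a Cohen--Macaulay local ring if $\operatorname{depth}(A)=\dim(A)$ (Krull dimension). A ring $R$ is Cohen--Macaulay if $R_\mathfrak{p}$ is a Cohen--Macaulay local ring for every prime ideal $\mathfrak{p}$. An ideal $I$ of a Noetherian ring $R$ is unmixed if $\operatorname{ht}(\mathfrak{p})=\operatorname{ht}(I)$ for every associated prime $\mathfrak{p}\in\operatorname{Ass}_R(R/I)$. *)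

theory Defs
  imports "HOL-Algebra.Algebra" "HOL-Library.Extended_Nat"
begin

section \<open>Height and Krull dimension\<close>

definition prime_chain :: "('a, 'r) ring_scheme \<Rightarrow> nat \<Rightarrow> (nat \<Rightarrow> 'a set) \<Rightarrow> bool"
  where "prime_chain R n c \<longleftrightarrow> (\<forall>i\<le>n. primeideal (c i) R) \<and> (\<forall>i<n. c i \<subset> c (Suc i))"

definition prime_height :: "('a, 'r) ring_scheme \<Rightarrow> 'a set \<Rightarrow> enat"
  where "prime_height R P = Sup {enat n | n. \<exists>c. prime_chain R n c \<and> c n = P}"

text \<open>The infimum of the empty set is \<open>\<infinity>\<close> in \<^typ>\<open>enat\<close>, so the unit ideal has height \<open>\<infinity>\<close>.\<close>

definition ideal_height :: "('a, 'r) ring_scheme \<Rightarrow> 'a set \<Rightarrow> enat"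
  where "ideal_height R I = Inf {prime_height R P | P. primeideal P R \<and> I \<subseteq> P}"

text \<open>The zero ring gets dimension \<open>0\<close>; the dimension is only used for local rings.\<close>

definition krull_dim :: "('a, 'r) ring_scheme \<Rightarrow> enat"
  where "krull_dim R = Sup {enat n | n. \<exists>c. prime_chain R n c}"


section \<open>Modules\<close>

text \<open>The library's module records extend ring records; the multiplication and the unit of such a
  record play no role in \<^locale>\<open>module\<close> and are left unspecified below.\<close>

definition module_hom ::
    "('a, 'r) ring_scheme \<Rightarrow> ('a, 'm, 'x) module_scheme \<Rightarrow> ('a, 'n, 'y) module_scheme \<Rightarrow> ('m \<Rightarrow> 'n) set"
  where "module_hom R M N = {h \<in> carrier M \<rightarrow> carrier N.
    (\<forall>x\<in>carrier M. \<forall>y\<in>carrier M. h (x \<oplus>\<^bsub>M\<^esub> y) = h x \<oplus>\<^bsub>N\<^esub> h y) \<and>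
    (\<forall>r\<in>carrier R. \<forall>x\<in>carrier M. h (r \<odot>\<^bsub>M\<^esub> x) = r \<odot>\<^bsub>N\<^esub> h x)}"

definition self_module :: "('a, 'r) ring_scheme \<Rightarrow> ('a, 'a) module"
  where "self_module R =
    \<lparr>carrier = carrier R, monoid.mult = undefined, one = undefined,
     ring.zero = \<zero>\<^bsub>R\<^esub>, add = add R, smult = monoid.mult R\<rparr>"

definition quotient_module :: "('a, 'r) ring_scheme \<Rightarrow> 'a set \<Rightarrow> ('a, 'a set) module"
  where "quotient_module R I =
    \<lparr>carrier = carrier (R Quot I), monoid.mult = undefined, one = undefined,
     ring.zero = \<zero>\<^bsub>R Quot I\<^esub>, add = add (R Quot I),
     smult = (\<lambda>r C. (I +>\<^bsub>R\<^esub> r) \<otimes>\<^bsub>R Quot I\<^esub> C)\<rparr>"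

text \<open>The free module on a set \<open>B\<close>: finitely supported functions \<open>B \<rightarrow> R\<close>, extended by zero.\<close>

definition free_module :: "('a, 'r) ring_scheme \<Rightarrow> 'b set \<Rightarrow> ('a, 'b \<Rightarrow> 'a) module"
  where "free_module R B =
    \<lparr>carrier = {f. (\<forall>b\<in>B. f b \<in> carrier R) \<and> (\<forall>b. b \<notin> B \<longrightarrow> f b = \<zero>\<^bsub>R\<^esub>) \<and> finite {b. f b \<noteq> \<zero>\<^bsub>R\<^esub>}},
     monoid.mult = undefined, one = undefined,
     ring.zero = (\<lambda>_. \<zero>\<^bsub>R\<^esub>), add = (\<lambda>f g b. f b \<oplus>\<^bsub>R\<^esub> g b), smult = (\<lambda>r f b. r \<otimes>\<^bsub>R\<^esub> f b)\<rparr>"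

definition associated_primes :: "('a, 'r) ring_scheme \<Rightarrow> ('a, 'm, 'x) module_scheme \<Rightarrow> 'a set set"
  where "associated_primes R M =
    {P. primeideal P R \<and> (\<exists>x\<in>carrier M. P = {r \<in> carrier R. r \<odot>\<^bsub>M\<^esub> x = \<zero>\<^bsub>M\<^esub>})}"

definition unmixed :: "('a, 'r) ring_scheme \<Rightarrow> 'a set \<Rightarrow> bool"
  where "unmixed R I \<longleftrightarrow> ideal I R \<and>
    (\<forall>P\<in>associated_primes R (quotient_module R I). prime_height R P = ideal_height R I)"


section \<open>Ext\<close>

text \<open>A free resolution
  \<open>\<dots> \<rightarrow> F (B 2) \<rightarrow> F (B 1) \<rightarrow> F (B 0) \<rightarrow> M \<rightarrow> 0\<close> with differentials \<open>d n : F (B (n + 1)) \<rightarrow> F (B n)\<close> and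
  augmentation \<open>e\<close>, where \<open>F\<close> denotes the free module on a set.\<close>

definition free_resolution ::
    "('a, 'r) ring_scheme \<Rightarrow> ('a, 'm, 'x) module_scheme \<Rightarrow>
     (nat \<Rightarrow> 'b set) \<Rightarrow> (nat \<Rightarrow> ('b \<Rightarrow> 'a) \<Rightarrow> ('b \<Rightarrow> 'a)) \<Rightarrow> (('b \<Rightarrow> 'a) \<Rightarrow> 'm) \<Rightarrow> bool"
  where "free_resolution R M B d e \<longleftrightarrow>
    e \<in> module_hom R (free_module R (B 0)) M \<and>
    (\<forall>n. d n \<in> module_hom R (free_module R (B (Suc n))) (free_module R (B n))) \<and>
    e ` carrier (free_module R (B 0)) = carrier M \<and>
    d 0 ` carrier (free_module R (B 1)) = {f \<in> carrier (free_module R (B 0)). e f = \<zero>\<^bsub>M\<^esub>} \<and>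
    (\<forall>n. d (Suc n) ` carrier (free_module R (B (Suc (Suc n)))) =
       {f \<in> carrier (free_module R (B (Suc n))). d n f = (\<lambda>_. \<zero>\<^bsub>R\<^esub>)})"

text \<open>A type of basis elements that is large enough for a free resolution of every \<open>R\<close>-module with
  elements of type \<open>'m\<close>: generators for the elements of the module, and then, for every element of a
  syzygy module, a new basis element naming its (finite) list of coefficients.\<close>

datatype ('a, 'm) symbol = Gen 'm | Syz "(('a, 'm) symbol \<times> 'a) list"

lemma free_module_simps:
  "carrier (free_module R B) =
     {f. (\<forall>b\<in>B. f b \<in> carrier R) \<and> (\<forall>b. b \<notin> B \<longrightarrow> f b = \<zero>\<^bsub>R\<^esub>) \<and> finite {b. f b \<noteq> \<zero>\<^bsub>R\<^esub>}}"
  "ring.zero (free_module R B) = (\<lambda>_. \<zero>\<^bsub>R\<^esub>)"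
  "add (free_module R B) = (\<lambda>f g b. f b \<oplus>\<^bsub>R\<^esub> g b)"
  "smult (free_module R B) = (\<lambda>r f b. r \<otimes>\<^bsub>R\<^esub> f b)"
  by (simp_all add: free_module_def)

lemma free_module_in_carrier:
  assumes "cring R" "f \<in> carrier (free_module R B)"
  shows "f b \<in> carrier R"
proof -
  interpret cring R by fact
  show ?thesis using assms(2) by (cases "b \<in> B") (auto simp: free_module_simps)
qed

lemma free_module_module:
  assumes "cring R"
  shows "module R (free_module R B)"
proof -
  interpret cring R by fact
  note c = free_module_in_carrier[OF assms]
  have fin_add: "finite {b. f b \<oplus>\<^bsub>R\<^esub> g b \<noteq> \<zero>\<^bsub>R\<^esub>}"
    if "finite {b. f b \<noteq> \<zero>\<^bsub>R\<^esub>}" "finite {b. g b \<noteq> \<zero>\<^bsub>R\<^esub>}" for f g :: "_ \<Rightarrow> 'a"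
    by (rule finite_subset[OF _ finite_UnI[OF that]]) auto
  have fin_smult: "finite {b. r \<otimes>\<^bsub>R\<^esub> f b \<noteq> \<zero>\<^bsub>R\<^esub>}"
    if "finite {b. f b \<noteq> \<zero>\<^bsub>R\<^esub>}" "r \<in> carrier R" for f :: "_ \<Rightarrow> 'a" and r
    by (rule finite_subset[OF _ that(1)]) (use that in auto)
  show ?thesis
  proof (rule moduleI)
    show "abelian_group (free_module R B)"
    proof (rule abelian_groupI)
      fix f assume f: "f \<in> carrier (free_module R B)"
      have "(\<lambda>b. \<ominus>\<^bsub>R\<^esub> f b) \<in> carrier (free_module R B)"
      proof -
        have "{b. \<ominus>\<^bsub>R\<^esub> f b \<noteq> \<zero>\<^bsub>R\<^esub>} \<subseteq> {b. f b \<noteq> \<zero>\<^bsub>R\<^esub>}" by auto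
        then show ?thesis
          using f by (auto simp: free_module_simps intro: finite_subset)
      qed
      then show "\<exists>g\<in>carrier (free_module R B). g \<oplus>\<^bsub>free_module R B\<^esub> f = \<zero>\<^bsub>free_module R B\<^esub>"
        by (rule bexI[rotated]) (auto simp: free_module_simps(2-4) c[OF f] l_neg)
    next
      fix f g assume f: "f \<in> carrier (free_module R B)" and g: "g \<in> carrier (free_module R B)"
      show "f \<oplus>\<^bsub>free_module R B\<^esub> g \<in> carrier (free_module R B)"
        using f g fin_add[of f g] by (auto simp: free_module_simps)
      show "f \<oplus>\<^bsub>free_module R B\<^esub> g = g \<oplus>\<^bsub>free_module R B\<^esub> f"
        by (auto simp: free_module_simps(2-4) c[OF f] c[OF g] a_comm)
      fix h assume h: "h \<in> carrier (free_module R B)"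
      show "f \<oplus>\<^bsub>free_module R B\<^esub> g \<oplus>\<^bsub>free_module R B\<^esub> h =
        f \<oplus>\<^bsub>free_module R B\<^esub> (g \<oplus>\<^bsub>free_module R B\<^esub> h)"
        by (auto simp: free_module_simps(2-4) c[OF f] c[OF g] c[OF h] a_assoc)
    next
      fix f assume f: "f \<in> carrier (free_module R B)"
      show "\<zero>\<^bsub>free_module R B\<^esub> \<oplus>\<^bsub>free_module R B\<^esub> f = f"
        by (auto simp: free_module_simps(2-4) c[OF f])
    qed (auto simp: free_module_simps)
  next
    fix r f assume r: "r \<in> carrier R" and f: "f \<in> carrier (free_module R B)"
    show "r \<odot>\<^bsub>free_module R B\<^esub> f \<in> carrier (free_module R B)"
      using r f fin_smult[of f r] by (auto simp: free_module_simps)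
  qed (use assms in \<open>auto simp: free_module_simps(2-4) c l_distr r_distr m_assoc intro!: ext\<close>)
qed

definition linear_extension ::
    "('a, 'r) ring_scheme \<Rightarrow> ('a, 'm, 'x) module_scheme \<Rightarrow> ('b \<Rightarrow> 'm) \<Rightarrow> ('b \<Rightarrow> 'a) \<Rightarrow> 'm"
  where "linear_extension R M v f = finsum M (\<lambda>b. f b \<odot>\<^bsub>M\<^esub> v b) {b. f b \<noteq> \<zero>\<^bsub>R\<^esub>}"

lemma linear_extension_hom:
  assumes M: "module R M" and v: "v \<in> B \<rightarrow> carrier M"
  shows "linear_extension R M v \<in> module_hom R (free_module R B) M"
proof -
  interpret M: module R M by (rule M)
  note c = free_module_in_carrier[OF M.R.is_cring]
  have supp: "{b. f b \<noteq> \<zero>\<^bsub>R\<^esub>} \<subseteq> B" "finite {b. f b \<noteq> \<zero>\<^bsub>R\<^esub>}" if "f \<in> carrier (free_module R B)" for f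
    using that by (auto simp: free_module_simps)
  have vc: "v b \<in> carrier M" if "b \<in> B" for b using v that by auto
  have eq: "linear_extension R M v f = finsum M (\<lambda>b. f b \<odot>\<^bsub>M\<^esub> v b) S"
    if f: "f \<in> carrier (free_module R B)" and S: "{b. f b \<noteq> \<zero>\<^bsub>R\<^esub>} \<subseteq> S" "S \<subseteq> B" "finite S" for f S
    unfolding linear_extension_def
  proof (rule M.add.finprod_mono_neutral_cong_left[folded finsum_def])
    show "finite S" by fact
    show "{b. f b \<noteq> \<zero>\<^bsub>R\<^esub>} \<subseteq> S" by fact
    show "\<And>i. i \<in> S - {b. f b \<noteq> \<zero>\<^bsub>R\<^esub>} \<Longrightarrow> f i \<odot>\<^bsub>M\<^esub> v i = \<zero>\<^bsub>M\<^esub>"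
      using S v by (auto intro!: M.smult_l_null)
    show "(\<lambda>b. f b \<odot>\<^bsub>M\<^esub> v b) \<in> S \<rightarrow> carrier M"
      using S v c[OF f] by (intro funcsetI M.smult_closed) auto
  qed auto
  show ?thesis
    unfolding module_hom_def
  proof (intro CollectI conjI ballI)
    show "linear_extension R M v \<in> carrier (free_module R B) \<rightarrow> carrier M"
    proof
      fix f assume f: "f \<in> carrier (free_module R B)"
      show "linear_extension R M v f \<in> carrier M"
        unfolding linear_extension_def
        using subsetD[OF supp(1)[OF f]] vc c[OF f] by (intro M.finsum_closed) auto
    qed
  next
    fix f g assume f: "f \<in> carrier (free_module R B)" and g: "g \<in> carrier (free_module R B)"
    interpret F: module R "free_module R B" by (rule free_module_module[OF M.R.is_cring])
    define S where "S = {b. f b \<noteq> \<zero>\<^bsub>R\<^esub>} \<union> {b. g b \<noteq> \<zero>\<^bsub>R\<^esub>}"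
    have S: "S \<subseteq> B" "finite S" using supp f g by (auto simp: S_def)
    have fg: "f \<oplus>\<^bsub>free_module R B\<^esub> g \<in> carrier (free_module R B)" using f g by simp
    have "linear_extension R M v (f \<oplus>\<^bsub>free_module R B\<^esub> g) =
      finsum M (\<lambda>b. (f \<oplus>\<^bsub>free_module R B\<^esub> g) b \<odot>\<^bsub>M\<^esub> v b) S"
      by (rule eq[OF fg _ S]) (auto simp: S_def free_module_simps(3))
    also have "\<dots> = finsum M (\<lambda>b. f b \<odot>\<^bsub>M\<^esub> v b \<oplus>\<^bsub>M\<^esub> g b \<odot>\<^bsub>M\<^esub> v b) S"
      using subsetD[OF S(1)] vc c[OF f] c[OF g]
      by (intro M.finsum_cong') (auto simp: free_module_simps(3) intro!: M.smult_l_distr)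
    also have "\<dots> = finsum M (\<lambda>b. f b \<odot>\<^bsub>M\<^esub> v b) S \<oplus>\<^bsub>M\<^esub> finsum M (\<lambda>b. g b \<odot>\<^bsub>M\<^esub> v b) S"
      using subsetD[OF S(1)] vc c[OF f] c[OF g] by (intro M.finsum_addf) auto
    also have "\<dots> = linear_extension R M v f \<oplus>\<^bsub>M\<^esub> linear_extension R M v g"
      using eq[OF f _ S] eq[OF g _ S] by (simp add: S_def)
    finally show "linear_extension R M v (f \<oplus>\<^bsub>free_module R B\<^esub> g) =
      linear_extension R M v f \<oplus>\<^bsub>M\<^esub> linear_extension R M v g" .
  next
    fix r f assume r: "r \<in> carrier R" and f: "f \<in> carrier (free_module R B)"
    interpret F: module R "free_module R B" by (rule free_module_module[OF M.R.is_cring])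
    have rf: "r \<odot>\<^bsub>free_module R B\<^esub> f \<in> carrier (free_module R B)" using r f by simp
    have "linear_extension R M v (r \<odot>\<^bsub>free_module R B\<^esub> f) =
      finsum M (\<lambda>b. (r \<odot>\<^bsub>free_module R B\<^esub> f) b \<odot>\<^bsub>M\<^esub> v b) {b. f b \<noteq> \<zero>\<^bsub>R\<^esub>}"
      by (rule eq[OF rf _ supp[OF f]]) (use r in \<open>auto simp: free_module_simps(4)\<close>)
    also have "\<dots> = finsum M (\<lambda>b. r \<odot>\<^bsub>M\<^esub> (f b \<odot>\<^bsub>M\<^esub> v b)) {b. f b \<noteq> \<zero>\<^bsub>R\<^esub>}"
      using subsetD[OF supp(1)[OF f]] supp(2)[OF f] vc c[OF f] r
      by (intro M.finsum_cong') (auto simp: free_module_simps(4) intro!: M.smult_assoc1)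
    also have "\<dots> = r \<odot>\<^bsub>M\<^esub> linear_extension R M v f"
      unfolding linear_extension_def
      using subsetD[OF supp(1)[OF f]] supp(2)[OF f] vc c[OF f] r by (subst M.finsum_smult_ldistr) auto
    finally show "linear_extension R M v (r \<odot>\<^bsub>free_module R B\<^esub> f) = r \<odot>\<^bsub>M\<^esub> linear_extension R M v f" .
  qed
qed

lemma linear_extension_image:
  assumes M: "module R M" and v: "v \<in> B \<rightarrow> carrier M"
    and K: "\<And>x. x \<in> K \<Longrightarrow> x \<in> v ` B"
  shows "K \<subseteq> linear_extension R M v ` carrier (free_module R B)"
proof
  interpret M: module R M by (rule M)
  fix x assume "x \<in> K"
  then obtain b where b: "b \<in> B" "x = v b" using K by auto
  define f where "f = (\<lambda>c. if c = b then \<one>\<^bsub>R\<^esub> else \<zero>\<^bsub>R\<^esub>)"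
  have f: "f \<in> carrier (free_module R B)"
    using b by (auto simp: f_def free_module_simps intro: finite_subset[of _ "{b}"])
  have x: "x \<in> carrier M" using b v by auto
  show "x \<in> linear_extension R M v ` carrier (free_module R B)"
  proof (cases "\<one>\<^bsub>R\<^esub> = \<zero>\<^bsub>R\<^esub>")
    case False
    then have "{c. f c \<noteq> \<zero>\<^bsub>R\<^esub>} = {b}" by (auto simp: f_def)
    then have "linear_extension R M v f = x"
      using x b by (simp add: linear_extension_def f_def M.finsum_insert)
    then show ?thesis using f by blast
  next
    case True
    then have "x = \<zero>\<^bsub>M\<^esub>" using M.smult_one[OF x] M.smult_l_null[OF x] by simp
    moreover have "{c. f c \<noteq> \<zero>\<^bsub>R\<^esub>} = {}" using True by (auto simp: f_def)
    then have "linear_extension R M v f = \<zero>\<^bsub>M\<^esub>" by (simp add: linear_extension_def)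
    ultimately show ?thesis using f by force
  qed
qed

lemma free_resolution_exists:
  fixes R :: "('a, 'r) ring_scheme" and M :: "('a, 'm, 'x) module_scheme"
  assumes M: "module R M"
  obtains B :: "nat \<Rightarrow> ('a, 'm) symbol set" and d e where "free_resolution R M B d e"
proof -
  interpret M: module R M by (rule M)
  note F = free_module_module[OF M.R.is_cring]
  define e :: "(('a, 'm) symbol \<Rightarrow> 'a) \<Rightarrow> 'm"
    where "e = linear_extension R M (\<lambda>b. case b of Gen x \<Rightarrow> x | _ \<Rightarrow> \<zero>\<^bsub>M\<^esub>)"
  define coeffs :: "(('a, 'm) symbol \<Rightarrow> 'a) \<Rightarrow> (('a, 'm) symbol \<times> 'a) list"
    where "coeffs f = (SOME xs. set xs = (\<lambda>b. (b, f b)) ` {b. f b \<noteq> \<zero>\<^bsub>R\<^esub>})" for f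
  define enc :: "(('a, 'm) symbol \<Rightarrow> 'a) \<Rightarrow> ('a, 'm) symbol"
    where "enc f = Syz (coeffs f)" for f
  define FS where "FS = {f :: ('a, 'm) symbol \<Rightarrow> 'a. finite {b. f b \<noteq> \<zero>\<^bsub>R\<^esub>}}"
  have inj: "inj_on enc FS"
  proof (rule inj_onI)
    have *: "(b, c) \<in> set (coeffs f) \<longleftrightarrow> f b = c \<and> c \<noteq> \<zero>\<^bsub>R\<^esub>" if "f \<in> FS" for f b c
    proof -
      have "set (coeffs f) = (\<lambda>b. (b, f b)) ` {b. f b \<noteq> \<zero>\<^bsub>R\<^esub>}"
        unfolding coeffs_def
        by (rule someI_ex, rule finite_list) (use that in \<open>simp add: FS_def\<close>)
      then show ?thesis by auto
    qed
    fix f g assume fg: "f \<in> FS" "g \<in> FS" "enc f = enc g"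
    have graph: "(f b = c \<and> c \<noteq> \<zero>\<^bsub>R\<^esub>) \<longleftrightarrow> (g b = c \<and> c \<noteq> \<zero>\<^bsub>R\<^esub>)" for b c
      unfolding *[OF fg(1), symmetric] *[OF fg(2), symmetric] using fg(3) by (simp add: enc_def)
    show "f = g"
    proof
      fix b
      show "f b = g b" using graph[of b "f b"] graph[of b "g b"] by (cases "f b = \<zero>\<^bsub>R\<^esub>") auto
    qed
  qed
  define dec where "dec = inv_into FS enc"
  define dd where "dd B = linear_extension R (free_module R B) dec" for B :: "('a, 'm) symbol set"
  define BK where "BK = rec_nat
    (Gen ` carrier M, {f \<in> carrier (free_module R (Gen ` carrier M)). e f = \<zero>\<^bsub>M\<^esub>})
    (\<lambda>_ (B, K). (enc ` K, {f \<in> carrier (free_module R (enc ` K)). dd B f = (\<lambda>_. \<zero>\<^bsub>R\<^esub>)}))"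
  define B where "B n = fst (BK n)" for n
  define K where "K n = snd (BK n)" for n
  have B0: "B 0 = Gen ` carrier M"
    and K0: "K 0 = {f \<in> carrier (free_module R (B 0)). e f = \<zero>\<^bsub>M\<^esub>}"
    and BS: "B (Suc n) = enc ` K n"
    and KS: "K (Suc n) = {f \<in> carrier (free_module R (B (Suc n))). dd (B n) f = (\<lambda>_. \<zero>\<^bsub>R\<^esub>)}" for n
    by (simp_all add: B_def K_def BK_def case_prod_beta)
  have Ksub: "K n \<subseteq> carrier (free_module R (B n))" for n
    by (cases n) (auto simp: K0 KS)
  have KFS: "K n \<subseteq> FS" for n
    using Ksub[of n] by (auto simp: FS_def free_module_simps)
  have dec_enc: "dec (enc f) = f" if "f \<in> K n" for f n
    using that KFS[of n] inj by (auto simp: dec_def)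
  have dec_im: "dec ` B (Suc n) = K n" for n
    using dec_enc by (force simp: BS image_image)
  have dec_fun: "dec \<in> B (Suc n) \<rightarrow> carrier (free_module R (B n))" for n
    using dec_im[of n] Ksub[of n] by auto
  have dhom: "dd (B n) \<in> module_hom R (free_module R (B (Suc n))) (free_module R (B n))" for n
    unfolding dd_def by (rule linear_extension_hom[OF F dec_fun])
  have e_fun: "(\<lambda>b. case b of Gen x \<Rightarrow> x | _ \<Rightarrow> \<zero>\<^bsub>M\<^esub>) \<in> B 0 \<rightarrow> carrier M"
    by (auto simp: B0)
  have ehom: "e \<in> module_hom R (free_module R (B 0)) M"
    unfolding e_def by (rule linear_extension_hom[OF M e_fun])
  have e_im: "e ` carrier (free_module R (B 0)) = carrier M"
  proof
    show "e ` carrier (free_module R (B 0)) \<subseteq> carrier M"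
      using ehom by (auto simp: module_hom_def)
    show "carrier M \<subseteq> e ` carrier (free_module R (B 0))"
      unfolding e_def by (rule linear_extension_image[OF M e_fun]) (auto simp: B0 image_image)
  qed
  have im_sup: "K n \<subseteq> dd (B n) ` carrier (free_module R (B (Suc n)))" for n
    unfolding dd_def by (rule linear_extension_image[OF F dec_fun]) (simp add: dec_im)
  have ker_closed: "linear_extension R (free_module R (B n)) dec f \<in> {x \<in> carrier (free_module R (B n)). h x = \<zero>\<^bsub>N\<^esub>}"
    if h: "h \<in> module_hom R (free_module R (B n)) N" and N: "module R N"
      and Kn: "K n = {x \<in> carrier (free_module R (B n)). h x = \<zero>\<^bsub>N\<^esub>}"
      and f: "f \<in> carrier (free_module R (B (Suc n)))"
    for h :: "_ \<Rightarrow> 'k" and N :: "('a, 'k, 'y) module_scheme" and n f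
  proof -
    interpret N: module R N by (rule N)
    interpret Fn: module R "free_module R (B n)" by (rule F)
    let ?F = "free_module R (B n)"
    have h0: "h \<zero>\<^bsub>?F\<^esub> = \<zero>\<^bsub>N\<^esub>"
    proof -
      have "h (\<zero>\<^bsub>R\<^esub> \<odot>\<^bsub>?F\<^esub> \<zero>\<^bsub>?F\<^esub>) = \<zero>\<^bsub>R\<^esub> \<odot>\<^bsub>N\<^esub> h \<zero>\<^bsub>?F\<^esub>" and "h \<zero>\<^bsub>?F\<^esub> \<in> carrier N"
        using h Fn.zero_closed M.R.zero_closed unfolding module_hom_def by blast+
      then show ?thesis by simp
    qed
    have fin: "finite {b. f b \<noteq> \<zero>\<^bsub>R\<^esub>}" and sub: "{b. f b \<noteq> \<zero>\<^bsub>R\<^esub>} \<subseteq> B (Suc n)"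
      using f by (auto simp: free_module_simps)
    have fc: "f b \<in> carrier R" for b by (rule free_module_in_carrier[OF M.R.is_cring f])
    have "finsum ?F (\<lambda>b. f b \<odot>\<^bsub>?F\<^esub> dec b) S \<in> carrier ?F \<and>
          h (finsum ?F (\<lambda>b. f b \<odot>\<^bsub>?F\<^esub> dec b) S) = \<zero>\<^bsub>N\<^esub>"
      if "finite S" "S \<subseteq> B (Suc n)" for S
      using that
    proof (induction S rule: finite_induct)
      case empty
      show ?case by (simp add: h0)
    next
      case (insert b S)
      have db: "dec b \<in> K n" using insert.prems dec_im[of n] by auto
      then have db': "dec b \<in> carrier ?F" "h (dec b) = \<zero>\<^bsub>N\<^esub>" by (auto simp: Kn)
      have dS: "\<And>c. c \<in> S \<Longrightarrow> dec c \<in> carrier ?F" using insert.prems dec_fun[of n] by auto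
      have "finsum ?F (\<lambda>b. f b \<odot>\<^bsub>?F\<^esub> dec b) (insert b S) =
        f b \<odot>\<^bsub>?F\<^esub> dec b \<oplus>\<^bsub>?F\<^esub> finsum ?F (\<lambda>b. f b \<odot>\<^bsub>?F\<^esub> dec b) S"
        using insert.hyps dS db' fc by (intro Fn.finsum_insert) auto
      moreover have "h (f b \<odot>\<^bsub>?F\<^esub> dec b) = \<zero>\<^bsub>N\<^esub>"
        using h db' fc[of b] by (simp add: module_hom_def)
      ultimately show ?case
        using h db' fc[of b] insert.IH insert.prems
        unfolding module_hom_def by simp
    qed
    then show ?thesis unfolding linear_extension_def using fin sub by simp
  qed
  have im: "dd (B n) ` carrier (free_module R (B (Suc n))) = K n" for n
  proof
    show "dd (B n) ` carrier (free_module R (B (Suc n))) \<subseteq> K n"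
    proof (cases n)
      case 0
      show ?thesis using ker_closed[of e 0 M] ehom M by (auto simp: 0 K0 dd_def)
    next
      case (Suc m)
      show ?thesis
        using ker_closed[of "dd (B m)" "Suc m" "free_module R (B m)"] dhom[of m] F[of "B m"]
        by (auto simp: Suc KS dd_def free_module_simps(2))
    qed
  qed (rule im_sup)
  have "free_resolution R M B (\<lambda>n. dd (B n)) e"
    unfolding free_resolution_def
    using ehom dhom e_im im[of 0] im by (simp add: K0 KS)
  then show ?thesis by (rule that)
qed

text \<open>Homomorphisms are represented by functions that are \<^const>\<open>undefined\<close> outside the domain, so that
  every homomorphism has exactly one representative.\<close>

definition hom_group ::
    "('a, 'r) ring_scheme \<Rightarrow> ('a, 'm, 'x) module_scheme \<Rightarrow> ('a, 'n, 'y) module_scheme \<Rightarrow> ('m \<Rightarrow> 'n) monoid"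
  where "hom_group R M N =
    \<lparr>carrier = module_hom R M N \<inter> extensional (carrier M),
     monoid.mult = (\<lambda>f g. \<lambda>x\<in>carrier M. f x \<oplus>\<^bsub>N\<^esub> g x),
     one = (\<lambda>x\<in>carrier M. \<zero>\<^bsub>N\<^esub>)\<rparr>"

text \<open>The cohomology at \<open>n\<close> of the complex
  \<open>0 \<rightarrow> Hom (F (B 0), N) \<rightarrow> Hom (F (B 1), N) \<rightarrow> Hom (F (B 2), N) \<rightarrow> \<dots>\<close>.\<close>

definition cocycles ::
    "('a, 'r) ring_scheme \<Rightarrow> (nat \<Rightarrow> 'b set) \<Rightarrow> (nat \<Rightarrow> ('b \<Rightarrow> 'a) \<Rightarrow> ('b \<Rightarrow> 'a)) \<Rightarrow>
     ('a, 'n, 'y) module_scheme \<Rightarrow> nat \<Rightarrow> (('b \<Rightarrow> 'a) \<Rightarrow> 'n) set"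
  where "cocycles R B d N n = {f \<in> carrier (hom_group R (free_module R (B n)) N).
    compose (carrier (free_module R (B (Suc n)))) f (d n) =
      \<one>\<^bsub>hom_group R (free_module R (B (Suc n))) N\<^esub>}"

primrec coboundaries ::
    "('a, 'r) ring_scheme \<Rightarrow> (nat \<Rightarrow> 'b set) \<Rightarrow> (nat \<Rightarrow> ('b \<Rightarrow> 'a) \<Rightarrow> ('b \<Rightarrow> 'a)) \<Rightarrow>
     ('a, 'n, 'y) module_scheme \<Rightarrow> nat \<Rightarrow> (('b \<Rightarrow> 'a) \<Rightarrow> 'n) set"
  where
    "coboundaries R B d N 0 = {\<one>\<^bsub>hom_group R (free_module R (B 0)) N\<^esub>}"
  | "coboundaries R B d N (Suc n) =
      (\<lambda>f. compose (carrier (free_module R (B (Suc n)))) f (d n)) `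
        carrier (hom_group R (free_module R (B n)) N)"

definition hom_cohomology ::
    "('a, 'r) ring_scheme \<Rightarrow> (nat \<Rightarrow> 'b set) \<Rightarrow> (nat \<Rightarrow> ('b \<Rightarrow> 'a) \<Rightarrow> ('b \<Rightarrow> 'a)) \<Rightarrow>
     ('a, 'n, 'y) module_scheme \<Rightarrow> nat \<Rightarrow> (('b \<Rightarrow> 'a) \<Rightarrow> 'n) set monoid"
  where "hom_cohomology R B d N n =
    (hom_group R (free_module R (B n)) N)\<lparr>carrier := cocycles R B d N n\<rparr> Mod coboundaries R B d N n"

text \<open>Up to isomorphism the result does not depend on the chosen resolution.\<close>

definition Ext ::
    "('a, 'r) ring_scheme \<Rightarrow> nat \<Rightarrow> ('a, 'm, 'x) module_scheme \<Rightarrow> ('a, 'n, 'y) module_scheme \<Rightarrow>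
     ((('a, 'm) symbol \<Rightarrow> 'a) \<Rightarrow> 'n) set monoid"
  where "Ext R n M N =
    (let (B, d, e) = (SOME (B, d, e). free_resolution R M B d e) in hom_cohomology R B d N n)"


section \<open>Local rings and depth\<close>

definition local_ring :: "('a, 'r) ring_scheme \<Rightarrow> bool"
  where "local_ring A \<longleftrightarrow> cring A \<and> (\<exists>!M. maximalideal M A)"

definition max_ideal :: "('a, 'r) ring_scheme \<Rightarrow> 'a set"
  where "max_ideal A = (THE M. maximalideal M A)"

definition depth :: "('a, 'r) ring_scheme \<Rightarrow> enat"
  where "depth A = Inf {enat i | i.
    carrier (Ext A i (quotient_module A (max_ideal A)) (self_module A)) \<noteq>
      {\<one>\<^bsub>Ext A i (quotient_module A (max_ideal A)) (self_module A)\<^esub>}}"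

definition cohen_macaulay_local :: "('a, 'r) ring_scheme \<Rightarrow> bool"
  where "cohen_macaulay_local A \<longleftrightarrow> local_ring A \<and> depth A = krull_dim A"


section \<open>Localization\<close>

text \<open>The fraction \<open>a/s\<close>, as an equivalence class of pairs.\<close>

definition fraction :: "('a, 'r) ring_scheme \<Rightarrow> 'a set \<Rightarrow> 'a \<Rightarrow> 'a \<Rightarrow> ('a \<times> 'a) set"
  where "fraction R S a s = {(b, t). b \<in> carrier R \<and> t \<in> S \<and>
    (\<exists>u\<in>S. u \<otimes>\<^bsub>R\<^esub> (a \<otimes>\<^bsub>R\<^esub> t) = u \<otimes>\<^bsub>R\<^esub> (b \<otimes>\<^bsub>R\<^esub> s))}"

text \<open>As in \<^const>\<open>rcoset_mult\<close>, the operations on classes are unions over all representatives; for a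
  multiplicative set \<open>S\<close> all the united classes are equal.\<close>

definition localization :: "('a, 'r) ring_scheme \<Rightarrow> 'a set \<Rightarrow> ('a \<times> 'a) set ring"
  where "localization R S =
    \<lparr>carrier = {fraction R S a s | a s. a \<in> carrier R \<and> s \<in> S},
     monoid.mult = (\<lambda>C D. \<Union>(a, s)\<in>C. \<Union>(b, t)\<in>D. fraction R S (a \<otimes>\<^bsub>R\<^esub> b) (s \<otimes>\<^bsub>R\<^esub> t)),
     one = fraction R S \<one>\<^bsub>R\<^esub> \<one>\<^bsub>R\<^esub>,
     ring.zero = fraction R S \<zero>\<^bsub>R\<^esub> \<one>\<^bsub>R\<^esub>,
     add = (\<lambda>C D. \<Union>(a, s)\<in>C. \<Union>(b, t)\<in>D.
       fraction R S (a \<otimes>\<^bsub>R\<^esub> t \<oplus>\<^bsub>R\<^esub> b \<otimes>\<^bsub>R\<^esub> s) (s \<otimes>\<^bsub>R\<^esub> t))\<rparr>"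

definition localization_at_prime :: "('a, 'r) ring_scheme \<Rightarrow> 'a set \<Rightarrow> ('a \<times> 'a) set ring"
  where "localization_at_prime R P = localization R (carrier R - P)"

definition cohen_macaulay :: "('a, 'r) ring_scheme \<Rightarrow> bool"
  where "cohen_macaulay R \<longleftrightarrow> (\<forall>P. primeideal P R \<longrightarrow> cohen_macaulay_local (localization_at_prime R P))"

end

theory Submission
  imports Defs
begin

text \<open>
  For an ideal \<open>I\<close> of a Noetherian local ring \<open>(A, m)\<close> and an \<open>A/I\<close>-regular \<open>x \<in> m\<close>, the groups
  \<open>Ext\<^sup>j(A/m, A/I)\<close> vanish for all \<open>j \<le> t\<close> if and only if the groups \<open>Ext\<^sup>j(A/m, A/(I + xA))\<close> vanish
  for all \<open>j < t\<close>, because \<open>x\<close> acts as zero on \<open>Ext(A/m, -)\<close>. If the former vanish for all \<open>j < t\<close>,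
  then every associated prime of \<open>I\<close> is the start of a chain of primes of length \<open>t\<close> (Ischebeck).

  Let \<open>R\<close> be Cohen--Macaulay, \<open>I\<close> an ideal of height \<open>k\<close> with \<open>k\<close> generators, and \<open>P\<close> an associated
  prime of \<open>I\<close> of height \<open>d\<close>. In \<open>A = R\<^sub>P\<close>, prime avoidance changes the generators of \<open>IA\<close>
  successively into a regular sequence: by Ischebeck's theorem an associated prime of the first
  \<open>i < k\<close> elements has height at most \<open>i\<close> and so does not contain \<open>I\<close>. Hence \<open>A/IA\<close> has depth \<open>d - k\<close>, and this is
  \<open>0\<close> because the maximal ideal of \<open>A\<close> is associated to \<open>IA\<close>.

  Conversely, if \<open>P\<close> has height \<open>n\<close>, choose \<open>r\<^sub>1, \<dots>, r\<^sub>n \<in> P\<close> such that each \<open>r\<^sub>i\<^sub>+\<^sub>1\<close> avoids the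
  associated primes of \<open>(r\<^sub>1, \<dots>, r\<^sub>i)\<close>; these all have height \<open>i\<close> by unmixedness, so none of them
  contains \<open>P\<close>. The \<open>r\<^sub>i\<close> become a regular sequence in \<open>R\<^sub>P\<close>, so its depth is at least \<open>n\<close>.
\<close>

section \<open>Ideals of Noetherian rings\<close>

text \<open>Quotients stay implicit: the proof runs over ideals of one ring, R/I enters through
  membership in I, and cochains with values in R/I are linear maps into R taken modulo I. This is
  possible because all coefficient modules are cyclic and the resolution is free. The Ext statements
  thus become diagram chases on the one resolution picked inside \<open>Ext\<close>; that x in m
  acts as zero comes from a null-homotopy of multiplication by x on this resolution.

  The bookkeeping of heights rests on Krull's height theorem: it makes heights of primes finite,
  bounds the height of (r_1, ..., r_i) by i, and forces k generators of a proper ideal of height k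
  to be distinct. The Artinian local rings of the usual proof are replaced by a condition on
  descending sequences of ideals over I, with saturations in R in place of localizations. In the
  converse, the bound from Krull and the opposite bound from regularity give each partial sequence
  the exact height that the unmixedness hypothesis asks for.\<close>

lemma (in cring) ideal_intro:
  assumes "J \<subseteq> carrier R" "\<zero> \<in> J" "\<And>a b. a \<in> J \<Longrightarrow> b \<in> J \<Longrightarrow> a \<oplus> b \<in> J"
    "\<And>a r. a \<in> J \<Longrightarrow> r \<in> carrier R \<Longrightarrow> r \<otimes> a \<in> J"
  shows "ideal J R"
proof (rule idealI[OF ring_axioms])
  have "\<ominus> a \<in> J" if "a \<in> J" for a
    using assms(4)[OF that, of "\<ominus> \<one>"] subsetD[OF assms(1) that] by (simp add: l_minus)
  then show "subgroup J (add_monoid R)"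
    using assms by (intro subgroup.intro) (auto simp: a_inv_def[symmetric])
  show "a \<otimes> x \<in> J" if "a \<in> J" "x \<in> carrier R" for a x
    using assms(4)[OF that] that assms(1) by (auto simp: m_comm subset_iff)
qed (rule assms(4))

lemma
  fixes R (structure)
  assumes "ideal J R"
  shows ideal_carr: "a \<in> J \<Longrightarrow> a \<in> carrier R"
    and ideal_zero: "\<zero> \<in> J"
    and ideal_add: "a \<in> J \<Longrightarrow> b \<in> J \<Longrightarrow> a \<oplus> b \<in> J"
    and ideal_mult: "a \<in> J \<Longrightarrow> r \<in> carrier R \<Longrightarrow> r \<otimes> a \<in> J"
    and ideal_multr: "a \<in> J \<Longrightarrow> r \<in> carrier R \<Longrightarrow> a \<otimes> r \<in> J"
    and ideal_uminus: "a \<in> J \<Longrightarrow> \<ominus> a \<in> J"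
    and ideal_minus: "a \<in> J \<Longrightarrow> b \<in> J \<Longrightarrow> a \<ominus> b \<in> J"
proof -
  interpret ideal J R by fact
  show "a \<in> J \<Longrightarrow> a \<in> carrier R" by (rule a_Hcarr)
  show "\<zero> \<in> J" by simp
  show "a \<in> J \<Longrightarrow> b \<in> J \<Longrightarrow> a \<oplus> b \<in> J" by simp
  show "a \<in> J \<Longrightarrow> r \<in> carrier R \<Longrightarrow> r \<otimes> a \<in> J" by (rule I_l_closed)
  show "a \<in> J \<Longrightarrow> r \<in> carrier R \<Longrightarrow> a \<otimes> r \<in> J" by (rule I_r_closed)
  show "a \<in> J \<Longrightarrow> \<ominus> a \<in> J" by simp
  then show "a \<in> J \<Longrightarrow> b \<in> J \<Longrightarrow> a \<ominus> b \<in> J" by (simp add: a_minus_def)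
qed

lemma (in cring) ideal_add_cancel:
  assumes J: "ideal J R" and a: "a \<in> J" and b: "b \<in> carrier R" and s: "a \<oplus> b \<in> J \<or> b \<oplus> a \<in> J"
  shows "b \<in> J"
proof -
  have ac: "a \<in> carrier R" using ideal_carr[OF J a] .
  have "a \<oplus> b \<in> J" using s ac b by (auto simp: a_comm)
  from ideal_minus[OF J this a] show ?thesis
    using ac b by (simp add: minus_eq a_comm[of a b] a_assoc r_neg)
qed

lemma (in cring) one_in_ideal:
  assumes "ideal J R" "\<one> \<in> J"
  shows "J = carrier R"
  using ideal.one_imp_carrier[OF assms] .

lemma
  fixes R (structure)
  assumes P: "primeideal P R"
  shows prime_ideal: "ideal P R"
    and prime_not_one: "\<one> \<notin> P"
    and prime_mult: "a \<in> carrier R \<Longrightarrow> b \<in> carrier R \<Longrightarrow> a \<otimes> b \<in> P \<longleftrightarrow> a \<in> P \<or> b \<in> P"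
proof -
  interpret primeideal P R by fact
  show i: "ideal P R" by (rule is_ideal)
  show "\<one> \<notin> P" using one_imp_carrier I_notcarr by auto
  show "a \<in> carrier R \<Longrightarrow> b \<in> carrier R \<Longrightarrow> a \<otimes> b \<in> P \<longleftrightarrow> a \<in> P \<or> b \<in> P"
    using I_prime[of a b] I_l_closed[of b a] I_r_closed[of a b] by auto
qed

lemma (in cring) prime_pow:
  assumes P: "primeideal P R" and a: "a \<in> carrier R" "a [^] (n::nat) \<in> P"
  shows "a \<in> P"
  using a by (induction n) (auto simp: prime_mult[OF P] prime_not_one[OF P])

lemma (in cring) prime_intro:
  assumes "ideal P R" "\<one> \<notin> P"
    "\<And>a b. a \<in> carrier R \<Longrightarrow> b \<in> carrier R \<Longrightarrow> a \<otimes> b \<in> P \<Longrightarrow> a \<notin> P \<Longrightarrow> b \<in> P"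
  shows "primeideal P R"
proof (rule primeidealI[OF assms(1) is_cring])
  show "carrier R \<noteq> P" using assms(2) one_closed by metis
  show "a \<in> P \<or> b \<in> P" if "a \<in> carrier R" "b \<in> carrier R" "a \<otimes> b \<in> P" for a b
    using assms(3)[OF that] by auto
qed

text \<open>The ideal J + xR. Generators, regular elements and Noetherian inductions all extend an
  ideal by a single element at a time.\<close>

definition adjoin :: "('a, 'r) ring_scheme \<Rightarrow> 'a set \<Rightarrow> 'a \<Rightarrow> 'a set"
  where "adjoin R J x = {j \<oplus>\<^bsub>R\<^esub> x \<otimes>\<^bsub>R\<^esub> r | j r. j \<in> J \<and> r \<in> carrier R}"

text \<open>The colon ideal (J : y), that is, the annihilator of the class of y in R/J.\<close>

definition colon :: "('a, 'r) ring_scheme \<Rightarrow> 'a set \<Rightarrow> 'a \<Rightarrow> 'a set"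
  where "colon R J y = {r \<in> carrier R. r \<otimes>\<^bsub>R\<^esub> y \<in> J}"

text \<open>Ass(R/J) expressed inside R; \<open>associated_primes_quotient\<close> identifies it
  with the associated primes of the quotient module.\<close>

definition ass_primes :: "('a, 'r) ring_scheme \<Rightarrow> 'a set \<Rightarrow> 'a set set"
  where "ass_primes R J = {Q. primeideal Q R \<and> (\<exists>y\<in>carrier R. Q = colon R J y)}"

text \<open>The contraction to \<open>R\<close> of the extension of \<open>J\<close> to the localization at \<open>P\<close>.\<close>

definition saturation :: "('a, 'r) ring_scheme \<Rightarrow> 'a set \<Rightarrow> 'a set \<Rightarrow> 'a set"
  where "saturation R P J = {a \<in> carrier R. \<exists>s\<in>carrier R - P. s \<otimes>\<^bsub>R\<^esub> a \<in> J}"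

definition minimal_prime :: "('a, 'r) ring_scheme \<Rightarrow> 'a set \<Rightarrow> 'a set \<Rightarrow> bool"
  where "minimal_prime R J P \<longleftrightarrow> primeideal P R \<and> J \<subseteq> P \<and> (\<forall>Q. primeideal Q R \<and> J \<subseteq> Q \<and> Q \<subseteq> P \<longrightarrow> Q = P)"

context cring
begin

lemma adjoinI: "j \<in> J \<Longrightarrow> r \<in> carrier R \<Longrightarrow> j \<oplus> x \<otimes> r \<in> adjoin R J x"
  by (auto simp: adjoin_def)

lemma adjoin_ideal:
  assumes J: "ideal J R" and x: "x \<in> carrier R"
  shows "ideal (adjoin R J x) R"
proof (rule ideal_intro)
  note Jc = ideal_carr[OF J]
  show "adjoin R J x \<subseteq> carrier R" using x by (auto simp: adjoin_def Jc)
  have "\<zero> = \<zero> \<oplus> x \<otimes> \<zero>" using x by simp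
  then show "\<zero> \<in> adjoin R J x" unfolding adjoin_def using ideal_zero[OF J] by blast
next
  note Jc = ideal_carr[OF J]
  fix a b assume "a \<in> adjoin R J x" "b \<in> adjoin R J x"
  then obtain j r k t where *: "j \<in> J" "r \<in> carrier R" "a = j \<oplus> x \<otimes> r" "k \<in> J" "t \<in> carrier R" "b = k \<oplus> x \<otimes> t"
    by (auto simp: adjoin_def)
  have "a \<oplus> b = (j \<oplus> k) \<oplus> x \<otimes> (r \<oplus> t)"
    unfolding *(3,6) using x Jc[OF *(1)] Jc[OF *(4)] *(2,5) by algebra
  then show "a \<oplus> b \<in> adjoin R J x"
    using * by (metis adjoinI ideal_add[OF J] add.m_closed)
next
  note Jc = ideal_carr[OF J]
  fix a u assume "a \<in> adjoin R J x" and u: "u \<in> carrier R"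
  then obtain j r where *: "j \<in> J" "r \<in> carrier R" "a = j \<oplus> x \<otimes> r"
    by (auto simp: adjoin_def)
  have "u \<otimes> a = u \<otimes> j \<oplus> x \<otimes> (u \<otimes> r)"
    unfolding *(3) using x u Jc[OF *(1)] *(2) by algebra
  then show "u \<otimes> a \<in> adjoin R J x"
    using * u by (metis adjoinI ideal_mult[OF J] m_closed)
qed

lemma adjoin_subset:
  assumes J: "ideal J R" and x: "x \<in> carrier R"
  shows "J \<subseteq> adjoin R J x"
proof
  fix j assume j: "j \<in> J"
  show "j \<in> adjoin R J x" using adjoinI[OF j, of \<zero> x] x ideal_carr[OF J j] by simp
qed

lemma adjoin_mem:
  assumes J: "ideal J R" and x: "x \<in> carrier R"
  shows "x \<in> adjoin R J x"
  using adjoinI[OF ideal_zero[OF J] one_closed, of x] x by simp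

lemma adjoin_least:
  assumes "J \<subseteq> K" "x \<in> K" "ideal K R"
  shows "adjoin R J x \<subseteq> K"
  using assms by (auto simp: adjoin_def intro!: ideal_add[OF assms(3)] ideal_multr[OF assms(3)])

lemma adjoin_subset_iff:
  assumes "ideal J R" "x \<in> carrier R" "ideal K R"
  shows "adjoin R J x \<subseteq> K \<longleftrightarrow> J \<subseteq> K \<and> x \<in> K"
  using adjoin_least[OF _ _ assms(3)] adjoin_subset[OF assms(1,2)] adjoin_mem[OF assms(1,2)] by blast

lemma Idl_insert:
  assumes F: "F \<subseteq> carrier R" and x: "x \<in> carrier R"
  shows "Idl (insert x F) = adjoin R (Idl F) x"
proof
  have I: "ideal (Idl F) R" by (rule genideal_ideal[OF F])
  show "Idl (insert x F) \<subseteq> adjoin R (Idl F) x"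
    by (rule genideal_minimal[OF adjoin_ideal[OF I x]])
      (use genideal_self[OF F] adjoin_subset[OF I x] adjoin_mem[OF I x] in auto)
  have "ideal (Idl (insert x F)) R" using F x by (intro genideal_ideal) auto
  moreover have "insert x F \<subseteq> Idl (insert x F)" using F x by (intro genideal_self) auto
  moreover have "Idl F \<subseteq> Idl (insert x F)" using F x by (intro subset_Idl_subset) auto
  ultimately show "adjoin R (Idl F) x \<subseteq> Idl (insert x F)" by (intro adjoin_least) auto
qed

lemma colon_ideal:
  assumes J: "ideal J R" and y: "y \<in> carrier R"
  shows "ideal (colon R J y) R"
  using ideal_zero[OF J] ideal_add[OF J] ideal_mult[OF J] y
  by (intro ideal_intro) (auto simp: colon_def l_distr m_assoc)

lemma colon_subset:
  assumes J: "ideal J R" and y: "y \<in> carrier R"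
  shows "J \<subseteq> colon R J y"
  using ideal_carr[OF J] ideal_multr[OF J] y by (auto simp: colon_def)

lemma ass_primesD:
  assumes J: "ideal J R" and Q: "Q \<in> ass_primes R J"
  obtains y where "primeideal Q R" "y \<in> carrier R" "y \<notin> J" "Q = colon R J y" "J \<subseteq> Q"
proof -
  obtain y where y: "primeideal Q R" "y \<in> carrier R" "Q = colon R J y" using Q by (auto simp: ass_primes_def)
  have "y \<notin> J" using prime_not_one[OF y(1)] y by (auto simp: colon_def)
  with y colon_subset[OF J y(2)] show ?thesis by (intro that[of y]) auto
qed

end

section \<open>Noetherian maximality arguments and associated primes\<close>

locale noetherian_cring = cring + noetherian_ring

context noetherian_cring
begin

text \<open>Zorn applies because in a Noetherian ring the union of a nonempty chain of ideals
  belongs to the chain. Noetherian induction below mostly takes this form: a maximal counterexample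
  is chosen and then enlarged by one element.\<close>

lemma maximal_exists:
  assumes "S \<noteq> {}" "\<And>J. J \<in> S \<Longrightarrow> ideal J R"
  obtains M where "M \<in> S" "\<And>J. J \<in> S \<Longrightarrow> M \<subseteq> J \<Longrightarrow> J = M"
proof -
  have "\<exists>M\<in>S. \<forall>K\<in>S. M \<subseteq> K \<longrightarrow> K = M"
  proof (rule subset_Zorn_nonempty[OF assms(1)])
    fix C assume C: "C \<noteq> {}" "subset.chain S C"
    then have "subset.chain {I. ideal I R} C"
      using assms(2) by (auto simp: subset_chain_def)
    then have "\<Union>C \<in> C" by (rule ideal_chain_is_trivial[OF C(1)])
    then show "\<Union>C \<in> S" using C by (auto simp: subset_chain_def)
  qed
  then show ?thesis by (metis that)
qed

text \<open>An ideal M maximal among those over J that miss S is prime: for a and b outside M, both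
  M + aR and M + bR meet S, and the product of the two elements found there lies in S, but also in M
  if ab does.\<close>

lemma prime_avoiding_mult_set:
  assumes J: "ideal J R" and S: "S \<subseteq> carrier R" "\<one> \<in> S" "\<And>a b. a \<in> S \<Longrightarrow> b \<in> S \<Longrightarrow> a \<otimes> b \<in> S"
    and disj: "J \<inter> S = {}"
  obtains Q where "primeideal Q R" "J \<subseteq> Q" "Q \<inter> S = {}"
proof -
  let ?T = "{K. ideal K R \<and> J \<subseteq> K \<and> K \<inter> S = {}}"
  have "?T \<noteq> {}" using J disj by auto
  then obtain M where M: "M \<in> ?T" and max: "\<And>K. K \<in> ?T \<Longrightarrow> M \<subseteq> K \<Longrightarrow> K = M"
    by (rule maximal_exists) auto
  have Mi: "ideal M R" and JM: "J \<subseteq> M" and MS: "M \<inter> S = {}" using M by auto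
  note Mc = ideal_carr[OF Mi]
  have meets: "\<exists>m r. m \<in> M \<and> r \<in> carrier R \<and> m \<oplus> a \<otimes> r \<in> S" if a: "a \<in> carrier R" "a \<notin> M" for a
  proof -
    have "\<not> adjoin R M a \<inter> S = {}"
    proof
      assume "adjoin R M a \<inter> S = {}"
      then have "adjoin R M a \<in> ?T" using adjoin_ideal[OF Mi a(1)] adjoin_subset[OF Mi a(1)] JM by auto
      then have "adjoin R M a = M" using max adjoin_subset[OF Mi a(1)] by blast
      then show False using adjoin_mem[OF Mi a(1)] a by auto
    qed
    then show ?thesis by (auto simp: adjoin_def)
  qed
  have "primeideal M R"
  proof (rule prime_intro[OF Mi])
    show "\<one> \<notin> M" using MS S by auto
    fix a b assume a: "a \<in> carrier R" and b: "b \<in> carrier R" and ab: "a \<otimes> b \<in> M" and na: "a \<notin> M"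
    show "b \<in> M"
    proof (rule ccontr)
      assume nb: "b \<notin> M"
      obtain m r where m: "m \<in> M" "r \<in> carrier R" "m \<oplus> a \<otimes> r \<in> S" using meets[OF a na] by blast
      obtain n t where n: "n \<in> M" "t \<in> carrier R" "n \<oplus> b \<otimes> t \<in> S" using meets[OF b nb] by blast
      note [simp] = Mc[OF m(1)] Mc[OF n(1)]
      have eq: "(m \<oplus> a \<otimes> r) \<otimes> (n \<oplus> b \<otimes> t) = (m \<oplus> a \<otimes> r) \<otimes> n \<oplus> (b \<otimes> t) \<otimes> m \<oplus> (r \<otimes> t) \<otimes> (a \<otimes> b)"
        using a b m n Mc[OF m(1)] Mc[OF n(1)] by algebra
      have "(m \<oplus> a \<otimes> r) \<otimes> (n \<oplus> b \<otimes> t) \<in> M"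
        unfolding eq
        by (rule ideal_add[OF Mi ideal_add[OF Mi ideal_mult[OF Mi n(1)] ideal_mult[OF Mi m(1)]] ideal_mult[OF Mi ab]])
          (use a b m n in simp_all)
      then show False using S(3)[OF m(3) n(3)] MS by auto
    qed
  qed
  then show ?thesis using JM MS by (rule that)
qed

text \<open>The hypothesis \<open>no\<close> says that x is not nilpotent modulo J after
  localization at P. The multiplicative set of all s x^n with s outside P settles both demands:
  exponent 0 keeps Q inside P, and s = 1 keeps x out of Q.\<close>

lemma prime_avoiding_powers:
  assumes J: "ideal J R" and P: "primeideal P R" and x: "x \<in> carrier R"
    and no: "\<And>s n. s \<in> carrier R \<Longrightarrow> s \<notin> P \<Longrightarrow> s \<otimes> x [^] (n::nat) \<notin> J"
  obtains Q where "primeideal Q R" "J \<subseteq> Q" "Q \<subseteq> P" "x \<notin> Q"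
proof -
  let ?S = "{s \<otimes> x [^] n | s n. s \<in> carrier R - P \<and> n \<in> (UNIV::nat set)}"
  obtain Q where Q: "primeideal Q R" "J \<subseteq> Q" "Q \<inter> ?S = {}"
  proof (rule prime_avoiding_mult_set[OF J, of ?S])
    show "?S \<subseteq> carrier R" using x by auto
    have "\<one> = \<one> \<otimes> x [^] (0::nat)" by simp
    then show "\<one> \<in> ?S" using prime_not_one[OF P] by blast
    show "J \<inter> ?S = {}" using no by blast
    fix a b assume "a \<in> ?S" "b \<in> ?S"
    then obtain s and n :: nat and t and m :: nat where *: "s \<in> carrier R - P" "t \<in> carrier R - P" "a = s \<otimes> x [^] n" "b = t \<otimes> x [^] m"
      by blast
    have "a \<otimes> b = (s \<otimes> t) \<otimes> x [^] (n + m)"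
      using * x by (simp add: nat_pow_mult[symmetric] m_ac)
    moreover have "s \<otimes> t \<in> carrier R - P" using * by (auto simp: prime_mult[OF P])
    ultimately show "a \<otimes> b \<in> ?S" by blast
  qed
  have "x \<notin> Q"
  proof
    assume "x \<in> Q"
    moreover have "x = \<one> \<otimes> x [^] (1::nat)" using x by simp
    then have "x \<in> ?S" using prime_not_one[OF P] by blast
    ultimately show False using Q(3) by blast
  qed
  moreover have "Q \<subseteq> P"
  proof
    fix s assume s: "s \<in> Q"
    then have "s \<in> carrier R" using ideal_carr[OF prime_ideal[OF Q(1)]] by auto
    moreover then have "s = s \<otimes> x [^] (0::nat)" by simp
    ultimately show "s \<in> P" using Q(3) s by blast
  qed
  ultimately show ?thesis using Q(1,2) that by blast
qed

text \<open>Among the annihilators of nonzero classes of R/I that contain the annihilator of y, a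
  maximal one (I : z) is prime: if a is not in it, then (I : az) contains it and is again such an
  annihilator, so b with ab in (I : z) is already in (I : z).\<close>

lemma in_ass_prime:
  assumes I: "ideal I R" and y: "y \<in> carrier R" "y \<notin> I"
  obtains Q where "Q \<in> ass_primes R I" "colon R I y \<subseteq> Q"
proof -
  let ?T = "{colon R I z | z. z \<in> carrier R \<and> z \<notin> I \<and> colon R I y \<subseteq> colon R I z}"
  obtain M where M: "M \<in> ?T" and max: "\<And>K. K \<in> ?T \<Longrightarrow> M \<subseteq> K \<Longrightarrow> K = M"
    by (rule maximal_exists[of ?T]) (use y colon_ideal[OF I] in auto)
  obtain z where z: "z \<in> carrier R" "z \<notin> I" "colon R I y \<subseteq> colon R I z" "M = colon R I z" using M by auto
  have "primeideal M R"
  proof (rule prime_intro)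
    show "ideal M R" using z colon_ideal[OF I] by simp
    show "\<one> \<notin> M" using z by (auto simp: colon_def)
    fix a b assume a: "a \<in> carrier R" and b: "b \<in> carrier R" and ab: "a \<otimes> b \<in> M" and na: "a \<notin> M"
    have az: "a \<otimes> z \<notin> I" using na a z by (auto simp: colon_def)
    have sub: "M \<subseteq> colon R I (a \<otimes> z)"
      unfolding z(4) colon_def using a z ideal_mult[OF I _ a] by (auto simp: m_lcomm[of _ a z])
    then have "colon R I (a \<otimes> z) = M" using az a z by (intro max) blast+
    moreover have "b \<in> colon R I (a \<otimes> z)" using ab a b z by (auto simp: colon_def m_ac)
    ultimately show "b \<in> M" by simp
  qed
  then show ?thesis using z by (intro that[of M]) (auto simp: ass_primes_def)
qed

text \<open>A nonzero class killed by x would have its annihilator, hence x, inside an associated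
  prime.\<close>

lemma regular_mod_iff:
  assumes I: "ideal I R" and x: "x \<in> carrier R"
    and avoid: "\<And>Q. Q \<in> ass_primes R I \<Longrightarrow> x \<notin> Q"
    and z: "z \<in> carrier R" "x \<otimes> z \<in> I"
  shows "z \<in> I"
proof (rule ccontr)
  assume "z \<notin> I"
  then obtain Q where "Q \<in> ass_primes R I" "colon R I z \<subseteq> Q" using in_ass_prime[OF I z(1)] by blast
  moreover have "x \<in> colon R I z" using x z by (auto simp: colon_def)
  ultimately show False using avoid by blast
qed

text \<open>Noetherian induction along 0 -> R/Q -> R/M -> R/(M + yR) -> 0 with Q = (M : y)
  associated: every associated prime of M other than Q is one of M + yR, and M + yR is strictly
  larger than M.\<close>

lemma finite_ass_primes:
  assumes "ideal I R"
  shows "finite (ass_primes R I)"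
proof (rule ccontr)
  assume inf: "infinite (ass_primes R I)"
  let ?T = "{I. ideal I R \<and> infinite (ass_primes R I)}"
  obtain M where M: "M \<in> ?T" and max: "\<And>K. K \<in> ?T \<Longrightarrow> M \<subseteq> K \<Longrightarrow> K = M"
    by (rule maximal_exists[of ?T]) (use assms inf in auto)
  have Mi: "ideal M R" using M by simp
  have "ass_primes R M \<noteq> {}" using M by auto
  then obtain Q where "Q \<in> ass_primes R M" by auto
  then obtain y where y: "primeideal Q R" "y \<in> carrier R" "y \<notin> M" "Q = colon R M y"
    using ass_primesD[OF Mi] by metis
  let ?J = "adjoin R M y"
  have Ji: "ideal ?J R" by (rule adjoin_ideal[OF Mi y(2)])
  have "?J \<noteq> M" using adjoin_mem[OF Mi y(2)] y(3) by auto
  then have fin: "finite (ass_primes R ?J)" using max[of ?J] Ji adjoin_subset[OF Mi y(2)] by auto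
  have "ass_primes R M \<subseteq> insert Q (ass_primes R ?J)"
  proof
    fix P assume "P \<in> ass_primes R M"
    then obtain z where z: "primeideal P R" "z \<in> carrier R" "P = colon R M z" by (auto simp: ass_primes_def)
    show "P \<in> insert Q (ass_primes R ?J)"
    \<comment> \<open>Either the submodules of R/M generated by z and by y meet trivially, and z
      keeps its annihilator modulo M + yR, or they share a nonzero element, whose annihilator is P
      on the one side and Q on the other.\<close>
    proof (cases "\<exists>r\<in>carrier R. r \<otimes> z \<in> ?J \<and> r \<otimes> z \<notin> M")
      case False
      then have "P = colon R ?J z" using z(3) adjoin_subset[OF Mi y(2)] by (auto simp: colon_def)
      then show ?thesis using z by (auto simp: ass_primes_def)
    next
      case True
      then obtain r i t where r: "r \<in> carrier R" "r \<otimes> z \<notin> M" "i \<in> M" "t \<in> carrier R" "r \<otimes> z = i \<oplus> y \<otimes> t"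
        by (auto simp: adjoin_def)
      note ic = ideal_carr[OF Mi r(3)]
      have rP: "r \<notin> P" using z r by (auto simp: colon_def)
      have tQ: "t \<notin> Q"
        using r y ic ideal_add[OF Mi, of i "y \<otimes> t"] by (auto simp: colon_def m_comm)
      have "a \<in> P \<longleftrightarrow> a \<in> Q" if a: "a \<in> carrier R" for a
      proof -
        have "a \<in> P \<longleftrightarrow> a \<otimes> r \<in> P" using prime_mult[OF z(1) a r(1)] rP by simp
        also have "\<dots> \<longleftrightarrow> a \<otimes> (r \<otimes> z) \<in> M" using a r z by (auto simp: colon_def m_assoc)
        also have "a \<otimes> (r \<otimes> z) = a \<otimes> i \<oplus> (a \<otimes> t) \<otimes> y" unfolding r(5) using a ic y r by algebra
        also have "\<dots> \<in> M \<longleftrightarrow> (a \<otimes> t) \<otimes> y \<in> M"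
          using ideal_add_cancel[OF Mi ideal_mult[OF Mi r(3) a], of "(a \<otimes> t) \<otimes> y"]
            ideal_add[OF Mi ideal_mult[OF Mi r(3) a], of "(a \<otimes> t) \<otimes> y"] a y r by auto
        also have "\<dots> \<longleftrightarrow> a \<otimes> t \<in> Q" using a y r by (auto simp: colon_def)
        also have "\<dots> \<longleftrightarrow> a \<in> Q" using prime_mult[OF y(1) a r(4)] tQ by simp
        finally show ?thesis .
      qed
      then have "P = Q" using z(3) y(4) by (auto simp: colon_def)
      then show ?thesis by simp
    qed
  qed
  then show False using M fin finite_subset by auto
qed

end

section \<open>Prime avoidance\<close>

context cring
begin

lemma element_avoiding_prime:
  assumes Q: "primeideal Q R" and J: "ideal J R" "\<not> J \<subseteq> Q"
    and F: "finite F" "\<And>K. K \<in> F \<Longrightarrow> ideal K R \<and> \<not> K \<subseteq> Q"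
  obtains j where "j \<in> J" "j \<notin> Q" "\<And>K. K \<in> F \<Longrightarrow> j \<in> K"
proof -
  have "\<exists>j\<in>J. j \<notin> Q \<and> (\<forall>K\<in>F. j \<in> K)"
    using F
  proof (induction F rule: finite_induct)
    case empty then show ?case using J by auto
  next
    case (insert K F)
    then obtain j where j: "j \<in> J" "j \<notin> Q" "\<forall>K\<in>F. j \<in> K" by auto
    obtain k where k: "k \<in> K" "k \<notin> Q" using insert.prems by auto
    have K: "ideal K R" using insert.prems by auto
    have c: "j \<in> carrier R" "k \<in> carrier R" using ideal_carr[OF J(1) j(1)] ideal_carr[OF K k(1)] .
    have "j \<otimes> k \<in> J" "j \<otimes> k \<notin> Q" "j \<otimes> k \<in> K"
      using c j k prime_mult[OF Q] ideal_multr[OF J(1)] ideal_mult[OF K] by auto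
    moreover have "\<forall>K\<in>F. j \<otimes> k \<in> K" using j c insert.prems by (auto intro: ideal_multr)
    ultimately show ?case by auto
  qed
  then show ?thesis using that by blast
qed

text \<open>The version for a coset a + J allows a generator to be changed by a combination of the
  remaining ones without changing the ideal they generate together. The prime removed in the
  induction is minimal under inclusion: as no other member of F lies inside it, some element of J
  lies in all the others but not in it and repairs a bad j.\<close>

lemma coset_prime_avoidance:
  assumes F: "finite F" "\<And>Q. Q \<in> F \<Longrightarrow> primeideal Q R" and J: "ideal J R" and a: "a \<in> carrier R"
    and "\<And>Q. Q \<in> F \<Longrightarrow> \<not> (a \<in> Q \<and> J \<subseteq> Q)"
  obtains j where "j \<in> J" "\<And>Q. Q \<in> F \<Longrightarrow> a \<oplus> j \<notin> Q"
proof -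
  have "\<exists>j\<in>J. \<forall>Q\<in>F. a \<oplus> j \<notin> Q"
    using assms(1,2,5)
  proof (induction F rule: finite_psubset_induct)
    case (psubset F)
    show ?case
    proof (cases "F = {}")
      case True then show ?thesis using ideal_zero[OF J] by auto
    next
      case False
      obtain Q where Q: "Q \<in> F" and min: "\<And>K. K \<in> F \<Longrightarrow> K \<subseteq> Q \<Longrightarrow> Q = K"
        using finite_has_minimal[OF psubset.hyps(1) False] by blast
      have Qp: "primeideal Q R" using psubset.prems Q by auto
      note Qi = prime_ideal[OF Qp]
      have "\<exists>j\<in>J. \<forall>K\<in>F - {Q}. a \<oplus> j \<notin> K"
        using Q psubset.prems by (intro psubset.IH) auto
      then obtain j where j: "j \<in> J" "\<And>K. K \<in> F - {Q} \<Longrightarrow> a \<oplus> j \<notin> K" by blast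
      note jc = ideal_carr[OF J j(1)]
      show ?thesis
      proof (cases "a \<oplus> j \<in> Q")
        case False then show ?thesis using j by auto
      next
        case True
        have JQ: "\<not> J \<subseteq> Q"
        proof
          assume JQ: "J \<subseteq> Q"
          then have "a \<in> Q" using ideal_add_cancel[OF Qi _ a, of j] True j(1) by auto
          with JQ show False using psubset.prems(2)[OF Q] by auto
        qed
        have "ideal K R \<and> \<not> K \<subseteq> Q" if "K \<in> F - {Q}" for K
          using that min[of K] psubset.prems(1)[of K] prime_ideal by auto
        then obtain k where k: "k \<in> J" "k \<notin> Q" "\<And>K. K \<in> F - {Q} \<Longrightarrow> k \<in> K"
          using element_avoiding_prime[OF Qp J JQ, of "F - {Q}"] psubset.hyps(1) by (metis finite_Diff)
        note kc = ideal_carr[OF J k(1)]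
        have eq: "a \<oplus> (j \<oplus> k) = (a \<oplus> j) \<oplus> k" using a jc kc by (simp add: a_assoc)
        have "a \<oplus> (j \<oplus> k) \<notin> K" if K: "K \<in> F" for K
        proof
          assume m: "a \<oplus> (j \<oplus> k) \<in> K"
          have Ki: "ideal K R" using psubset.prems(1)[OF K] by (rule prime_ideal)
          show False
          proof (cases "K = Q")
            case True
            then show False using m k(2) kc ideal_add_cancel[OF Qi \<open>a \<oplus> j \<in> Q\<close> kc] unfolding eq by auto
          next
            case False
            then show False using m k(3)[of K] j(2)[of K] K a jc ideal_add_cancel[OF Ki, of k "a \<oplus> j"] unfolding eq by auto
          qed
        qed
        then show ?thesis using ideal_add[OF J j(1) k(1)] by blast
      qed
    qed
  qed
  then show ?thesis using that by blast
qed

lemma prime_avoidance: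
  assumes "finite F" "\<And>Q. Q \<in> F \<Longrightarrow> primeideal Q R" "ideal J R" "\<And>Q. Q \<in> F \<Longrightarrow> \<not> J \<subseteq> Q"
  obtains j where "j \<in> J" "\<And>Q. Q \<in> F \<Longrightarrow> j \<notin> Q"
proof -
  obtain j where j: "j \<in> J" "\<And>Q. Q \<in> F \<Longrightarrow> \<zero> \<oplus> j \<notin> Q"
    by (rule coset_prime_avoidance[OF assms(1,2,3) zero_closed]) (use assms(4) in auto)
  with ideal_carr[OF assms(3) j(1)] show ?thesis by (intro that[of j]) auto
qed

end

section \<open>Height of prime ideals\<close>

context cring
begin

lemma adjoin_mono: "I \<subseteq> J \<Longrightarrow> adjoin R I x \<subseteq> adjoin R J x"
  by (auto simp: adjoin_def)

lemma colon_mono: "I \<subseteq> J \<Longrightarrow> colon R I x \<subseteq> colon R J x"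
  by (auto simp: colon_def)

lemma saturation_iff: "a \<in> saturation R P J \<longleftrightarrow> a \<in> carrier R \<and> (\<exists>s. s \<in> carrier R \<and> s \<notin> P \<and> s \<otimes> a \<in> J)"
  by (auto simp: saturation_def)

lemma subset_saturation:
  assumes P: "primeideal P R" and J: "ideal J R"
  shows "J \<subseteq> saturation R P J"
proof
  fix a assume a: "a \<in> J"
  have "\<one> \<otimes> a \<in> J" using a ideal_carr[OF J a] by simp
  then show "a \<in> saturation R P J"
    using prime_not_one[OF P] ideal_carr[OF J a] by (auto simp: saturation_iff intro!: exI[of _ \<one>])
qed

text \<open>Descending sequences of ideals over \<open>I\<close> become stationary after localization at \<open>P\<close>.\<close>

definition stationary_at :: "'a set \<Rightarrow> 'a set \<Rightarrow> bool"
  where "stationary_at P I \<longleftrightarrow> (\<forall>J :: nat \<Rightarrow> 'a set. (\<forall>n. ideal (J n) R \<and> I \<subseteq> J n \<and> J (Suc n) \<subseteq> J n) \<longrightarrow>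
    (\<exists>N. \<forall>n\<ge>N. J n \<subseteq> saturation R P (J (Suc n))))"

lemma stationary_atD:
  assumes "stationary_at P I" "\<And>n. ideal (J n) R" "\<And>n. I \<subseteq> J n" "\<And>n. J (Suc n) \<subseteq> J n"
  obtains N where "\<And>n. n \<ge> N \<Longrightarrow> J n \<subseteq> saturation R P (J (Suc n))"
  using assms unfolding stationary_at_def by meson

text \<open>After localization at P only P and the whole ring lie over P. If some member of the
  sequence lies in P, all later ones equal P; otherwise each contains an element outside P and
  localizes to the unit ideal.\<close>

lemma stationary_at_self:
  assumes P: "primeideal P R"
  shows "stationary_at P P"
  unfolding stationary_at_def
proof (intro allI impI)
  fix J :: "nat \<Rightarrow> 'a set" assume J: "\<forall>n. ideal (J n) R \<and> P \<subseteq> J n \<and> J (Suc n) \<subseteq> J n"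
  have dec: "J n \<subseteq> J m" if "m \<le> n" for m n
    using lift_Suc_antimono_le[of J m n] J that by auto
  show "\<exists>N. \<forall>n\<ge>N. J n \<subseteq> saturation R P (J (Suc n))"
  proof (cases "\<exists>m. J m \<subseteq> P")
    case True
    then obtain m where m: "J m \<subseteq> P" by blast
    have "J n \<subseteq> saturation R P (J (Suc n))" if "n \<ge> m" for n
      using dec[OF that] m J subset_saturation[OF P, of "J (Suc n)"] by blast
    then show ?thesis by blast
  next
    case False
    have "J n \<subseteq> saturation R P (J (Suc n))" for n
    proof
      fix a assume "a \<in> J n"
      then have a: "a \<in> carrier R" using J ideal_carr by metis
      obtain s where s: "s \<in> J (Suc n)" "s \<notin> P" using False by blast
      have Ji: "ideal (J (Suc n)) R" using J by auto
      have "s \<otimes> a \<in> J (Suc n)" using ideal_multr[OF Ji s(1) a] .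
      then show "a \<in> saturation R P (J (Suc n))"
        using a s ideal_carr[OF Ji s(1)] by (auto simp: saturation_iff)
    qed
    then show ?thesis by blast
  qed
qed

text \<open>An element of I outside P becomes a unit at P, so all ideals over I have the same
  localization and N = 0 works.\<close>

lemma stationary_at_not_subset:
  assumes s: "s \<in> I" "s \<notin> P" and I: "ideal I R"
  shows "stationary_at P I"
  unfolding stationary_at_def
proof (intro allI impI exI[of _ 0] subsetI)
  fix J :: "nat \<Rightarrow> 'a set" and n a
  assume J: "\<forall>n. ideal (J n) R \<and> I \<subseteq> J n \<and> J (Suc n) \<subseteq> J n" and "a \<in> J n"
  then have a: "a \<in> carrier R" using ideal_carr by metis
  have "s \<otimes> a \<in> J (Suc n)" using J s a ideal_multr[of "J (Suc n)" R s a] by blast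
  then show "a \<in> saturation R P (J (Suc n))"
    using a s ideal_carr[OF I s(1)] by (auto simp: saturation_iff)
qed

text \<open>The descending chain condition passes along 0 -> R/(I : a) -> R/I -> R/(I + aR) -> 0: an
  ideal J over I is controlled by J + aR and (J : a).\<close>

lemma stationary_at_split:
  assumes P: "primeideal P R" and I: "ideal I R" and a: "a \<in> carrier R"
    and sum: "stationary_at P (adjoin R I a)" and quot: "stationary_at P (colon R I a)"
  shows "stationary_at P I"
  unfolding stationary_at_def
proof (intro allI impI)
  fix J :: "nat \<Rightarrow> 'a set" assume J: "\<forall>n. ideal (J n) R \<and> I \<subseteq> J n \<and> J (Suc n) \<subseteq> J n"
  then have Ji: "ideal (J n) R" and IJ: "I \<subseteq> J n" and dec: "J (Suc n) \<subseteq> J n" for n by auto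
  obtain N1 where N1: "\<And>n. n \<ge> N1 \<Longrightarrow> adjoin R (J n) a \<subseteq> saturation R P (adjoin R (J (Suc n)) a)"
    by (rule stationary_atD[OF sum, of "\<lambda>n. adjoin R (J n) a"])
      (use adjoin_ideal[OF Ji a] adjoin_mono[OF IJ] adjoin_mono[OF dec] in auto)
  obtain N2 where N2: "\<And>n. n \<ge> N2 \<Longrightarrow> colon R (J n) a \<subseteq> saturation R P (colon R (J (Suc n)) a)"
    by (rule stationary_atD[OF quot, of "\<lambda>n. colon R (J n) a"])
      (use colon_ideal[OF Ji a] colon_mono[OF IJ] colon_mono[OF dec] in auto)
  have "J n \<subseteq> saturation R P (J (Suc n))" if n: "n \<ge> max N1 N2" for n
  proof
    fix y assume y: "y \<in> J n"
    note yc = ideal_carr[OF Ji y]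
    have "y \<in> saturation R P (adjoin R (J (Suc n)) a)"
      using N1[of n] n y adjoin_subset[OF Ji a, of n] by auto
    then obtain s j r where s: "s \<in> carrier R" "s \<notin> P" "j \<in> J (Suc n)" "r \<in> carrier R" "s \<otimes> y = j \<oplus> a \<otimes> r"
      by (auto simp: saturation_iff adjoin_def)
    note jc = ideal_carr[OF Ji s(3)]
    \<comment> \<open>Modulo \<open>J (Suc n)\<close> the element s y is a r with r in
      \<open>colon R (J n) a\<close>, and a further factor t outside P moves a r into
      \<open>J (Suc n)\<close>.\<close>
    have "a \<otimes> r \<in> J n"
      using ideal_add_cancel[OF Ji, of j n "a \<otimes> r"] ideal_mult[OF Ji y s(1)] s dec[of n] a by auto
    then have "r \<in> colon R (J n) a" using a s by (simp add: colon_def m_comm)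
    then have "r \<in> saturation R P (colon R (J (Suc n)) a)" using N2[of n] n by auto
    then obtain t where t: "t \<in> carrier R" "t \<notin> P" "t \<otimes> r \<otimes> a \<in> J (Suc n)"
      by (auto simp: saturation_iff colon_def)
    have "(t \<otimes> s) \<otimes> y = t \<otimes> (s \<otimes> y)" using t s yc by (simp add: m_assoc)
    also have "\<dots> = t \<otimes> j \<oplus> t \<otimes> r \<otimes> a" unfolding s(5) using t(1) s(1,4) jc a by algebra
    also have "\<dots> \<in> J (Suc n)" using ideal_add[OF Ji ideal_mult[OF Ji s(3) t(1)] t(3)] .
    finally have "(t \<otimes> s) \<otimes> y \<in> J (Suc n)" .
    moreover have "t \<otimes> s \<notin> P" using prime_mult[OF P] s t by auto
    ultimately show "y \<in> saturation R P (J (Suc n))"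
      using yc s t by (auto simp: saturation_iff intro!: exI[of _ "t \<otimes> s"])
  qed
  then show "\<exists>N. \<forall>n\<ge>N. J n \<subseteq> saturation R P (J (Suc n))" by blast
qed

lemma minimal_primeD:
  assumes "minimal_prime R J P"
  shows "primeideal P R" "J \<subseteq> P" "primeideal Q R \<Longrightarrow> J \<subseteq> Q \<Longrightarrow> Q \<subseteq> P \<Longrightarrow> Q = P"
  using assms by (auto simp: minimal_prime_def)

end

context noetherian_cring
begin

text \<open>Stands in for the fact that R_P/IR_P is Artinian when P is minimal over I. A maximal
  counterexample M lies in P, and \<open>stationary_at_split\<close> makes it prime, so M = P by
  minimality; but P itself is no counterexample.\<close>

lemma stationary_at_minimal_prime:
  assumes min: "minimal_prime R I P" and I: "ideal I R"
  shows "stationary_at P I"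
proof (rule ccontr)
  note P = minimal_primeD(1)[OF min]
  assume bad: "\<not> stationary_at P I"
  let ?T = "{K. ideal K R \<and> I \<subseteq> K \<and> \<not> stationary_at P K}"
  obtain M where M: "M \<in> ?T" and max: "\<And>K. K \<in> ?T \<Longrightarrow> M \<subseteq> K \<Longrightarrow> K = M"
    by (rule maximal_exists[of ?T]) (use I bad in auto)
  have Mi: "ideal M R" and IM: "I \<subseteq> M" and Mbad: "\<not> stationary_at P M" using M by auto
  have MP: "M \<subseteq> P" using stationary_at_not_subset[OF _ _ Mi, of _ P] Mbad by blast
  have good: "stationary_at P K" if "ideal K R" "M \<subseteq> K" "x \<in> K" "x \<notin> M" for K x
    using max[of K] that IM by auto
  have "primeideal M R"
  proof (rule prime_intro[OF Mi])
    show "\<one> \<notin> M" using MP prime_not_one[OF P] by auto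
    fix a b assume a: "a \<in> carrier R" and b: "b \<in> carrier R" and ab: "a \<otimes> b \<in> M" and na: "a \<notin> M"
    show "b \<in> M"
    proof (rule ccontr)
      assume nb: "b \<notin> M"
      have "stationary_at P (adjoin R M a)"
        using good[OF adjoin_ideal[OF Mi a] adjoin_subset[OF Mi a] adjoin_mem[OF Mi a] na] .
      moreover have "b \<in> colon R M a" using a b ab by (simp add: colon_def m_comm)
      then have "stationary_at P (colon R M a)"
        using good[OF colon_ideal[OF Mi a] colon_subset[OF Mi a] _ nb] by blast
      ultimately show False using stationary_at_split[OF P Mi a] Mbad by blast
    qed
  qed
  then have "M = P" using minimal_primeD(3)[OF min] IM MP by blast
  then show False using stationary_at_self[OF P] Mbad by simp
qed

text \<open>Nakayama's lemma for the localization at \<open>P\<close>.\<close>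

lemma nakayama:
  assumes P: "primeideal P R" and M: "M \<subseteq> carrier R" and N: "ideal N R" and x: "x \<in> P"
    and step: "\<And>y. y \<in> M \<Longrightarrow> \<exists>s n z. s \<in> carrier R \<and> s \<notin> P \<and> n \<in> N \<and> z \<in> M \<and> s \<otimes> y = n \<oplus> x \<otimes> z"
  shows "M \<subseteq> saturation R P N"
proof (rule ccontr)
  assume bad: "\<not> M \<subseteq> saturation R P N"
  have xc: "x \<in> carrier R" using ideal_carr[OF prime_ideal[OF P] x] .
  \<comment> \<open>Noetherian induction on the ideals over N replaces the choice of a minimal
    generating set of M: if L is maximal among the failing ideals, adding a single missing y to L
    absorbs all of M at P.\<close>
  let ?T = "{K. ideal K R \<and> N \<subseteq> K \<and> \<not> M \<subseteq> saturation R P K}"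
  obtain L where L: "L \<in> ?T" and max: "\<And>K. K \<in> ?T \<Longrightarrow> L \<subseteq> K \<Longrightarrow> K = L"
    by (rule maximal_exists[of ?T]) (use N bad in auto)
  have Li: "ideal L R" and NL: "N \<subseteq> L" using L by auto
  obtain y where y: "y \<in> M" "y \<notin> saturation R P L" using L by auto
  have yc: "y \<in> carrier R" using y M by auto
  have "y \<notin> L" using y subset_saturation[OF P Li] by auto
  then have "adjoin R L y \<noteq> L" using adjoin_mem[OF Li yc] by auto
  then have sub: "M \<subseteq> saturation R P (adjoin R L y)"
    using max[of "adjoin R L y"] adjoin_ideal[OF Li yc] adjoin_subset[OF Li yc] NL by auto
  obtain s n z where s: "s \<in> carrier R" "s \<notin> P" "n \<in> N" "z \<in> M" "s \<otimes> y = n \<oplus> x \<otimes> z"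
    using step[OF y(1)] by blast
  obtain t l r where t: "t \<in> carrier R" "t \<notin> P" "l \<in> L" "r \<in> carrier R" "t \<otimes> z = l \<oplus> y \<otimes> r"
    using subsetD[OF sub s(4)] by (auto simp: saturation_iff adjoin_def)
  have zc: "z \<in> carrier R" using s M by auto
  have nL: "n \<in> L" using s NL by auto
  note nc = ideal_carr[OF Li nL] and lc = ideal_carr[OF Li t(3)]
  \<comment> \<open>The factor ts - xr plays the part of the unit 1 - xr: it multiplies y into L,
    and it lies outside P because ts does and x is in P.\<close>
  have "(t \<otimes> s \<ominus> x \<otimes> r) \<otimes> y = t \<otimes> (s \<otimes> y) \<ominus> x \<otimes> r \<otimes> y"
    using t(1,4) s(1) xc yc by algebra
  also have "\<dots> = t \<otimes> n \<oplus> x \<otimes> (t \<otimes> z) \<ominus> x \<otimes> r \<otimes> y" unfolding s(5) using t(1,4) s(1) xc yc nc zc by algebra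
  also have "\<dots> = t \<otimes> n \<oplus> x \<otimes> l" unfolding t(5) using t(1,4) s(1) xc yc nc zc lc by algebra
  also have "\<dots> \<in> L" using ideal_add[OF Li ideal_mult[OF Li nL t(1)] ideal_mult[OF Li t(3) xc]] .
  finally have "(t \<otimes> s \<ominus> x \<otimes> r) \<otimes> y \<in> L" .
  moreover have "t \<otimes> s \<ominus> x \<otimes> r \<notin> P"
  proof
    assume "t \<otimes> s \<ominus> x \<otimes> r \<in> P"
    from ideal_add[OF prime_ideal[OF P] this ideal_multr[OF prime_ideal[OF P] x t(4)]]
    have "t \<otimes> s \<in> P" using t s xc by (simp add: minus_eq a_assoc l_neg)
    then show False using prime_mult[OF P] t s by auto
  qed
  ultimately have "y \<in> saturation R P L"
    using yc t s xc by (auto simp: saturation_iff intro!: exI[of _ "t \<otimes> s \<ominus> x \<otimes> r"])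
  then show False using y by simp
qed

text \<open>Krull's principal ideal theorem. The ideals \<open>S n\<close> below play the role of the symbolic powers of
  \<open>Q\<close> modulo \<open>Q1\<close>, but only one element of \<open>Q\<close> is raised to powers.\<close>

theorem principal_ideal_theorem:
  assumes min: "minimal_prime R (adjoin R Q1 x) P" and Q1: "primeideal Q1 R" and Q: "primeideal Q R"
    and x: "x \<in> carrier R" and sub: "Q1 \<subset> Q" "Q \<subset> P"
  shows False
proof -
  note P = minimal_primeD(1)[OF min]
  note Q1i = prime_ideal[OF Q1] and Qi = prime_ideal[OF Q]
  have adP: "adjoin R Q1 x \<subseteq> P" using minimal_primeD(2)[OF min] .
  have xP: "x \<in> P" using adP adjoin_mem[OF Q1i x] by auto
  have xQ: "x \<notin> Q"
  proof
    assume "x \<in> Q"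
    then have "adjoin R Q1 x \<subseteq> Q" using sub by (intro adjoin_least[OF _ _ Qi]) auto
    then show False using minimal_primeD(3)[OF min Q] sub by auto
  qed
  obtain q where q: "q \<in> Q" "q \<notin> Q1" using sub by auto
  have qc: "q \<in> carrier R" using ideal_carr[OF Qi q(1)] .
  define S where "S n = saturation R Q (adjoin R Q1 (q [^] n))" for n :: nat
  have Sin: "a \<in> S n \<longleftrightarrow> a \<in> carrier R \<and> (\<exists>s j r. s \<in> carrier R \<and> s \<notin> Q \<and> j \<in> Q1 \<and> r \<in> carrier R \<and> s \<otimes> a = j \<oplus> q [^] n \<otimes> r)" for a n
    by (auto simp: S_def saturation_iff adjoin_def)
  have Si: "ideal (S n) R" for n
  proof (rule ideal_intro)
    let ?A = "adjoin R Q1 (q [^] n)"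
    have Ai: "ideal ?A R" by (rule adjoin_ideal[OF Q1i nat_pow_closed[OF qc]])
    show "S n \<subseteq> carrier R" by (auto simp: Sin)
    show "\<zero> \<in> S n" using subset_saturation[OF Q Ai] ideal_zero[OF Ai] by (auto simp: S_def)
    show "r \<otimes> a \<in> S n" if aS: "a \<in> S n" and rc: "r \<in> carrier R" for a r
    proof -
      obtain s where s: "s \<in> carrier R" "s \<notin> Q" "s \<otimes> a \<in> ?A" "a \<in> carrier R" using aS by (auto simp: S_def saturation_iff)
      have "s \<otimes> (r \<otimes> a) = r \<otimes> (s \<otimes> a)" using s(1,4) rc by algebra
      then have "s \<otimes> (r \<otimes> a) \<in> ?A" using ideal_mult[OF Ai s(3) rc] by simp
      then show ?thesis using s rc by (auto simp: S_def saturation_iff)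
    qed
    show "a \<oplus> b \<in> S n" if aS: "a \<in> S n" and bS: "b \<in> S n" for a b
    proof -
      obtain s where s: "s \<in> carrier R" "s \<notin> Q" "s \<otimes> a \<in> ?A" "a \<in> carrier R" using aS by (auto simp: S_def saturation_iff)
      obtain t where t: "t \<in> carrier R" "t \<notin> Q" "t \<otimes> b \<in> ?A" "b \<in> carrier R" using bS by (auto simp: S_def saturation_iff)
      have "(s \<otimes> t) \<otimes> (a \<oplus> b) = t \<otimes> (s \<otimes> a) \<oplus> s \<otimes> (t \<otimes> b)" using s(1,4) t(1,4) by algebra
      then have "(s \<otimes> t) \<otimes> (a \<oplus> b) \<in> ?A"
        using ideal_add[OF Ai ideal_mult[OF Ai s(3) t(1)] ideal_mult[OF Ai t(3) s(1)]] by simp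
      moreover have "s \<otimes> t \<notin> Q" using prime_mult[OF Q] s t by auto
      ultimately show ?thesis using s t unfolding S_def saturation_iff by (auto intro!: exI[of _ "s \<otimes> t"])
    qed
  qed
  have Sdec: "S (Suc n) \<subseteq> S n" for n
  proof
    fix a assume "a \<in> S (Suc n)"
    then obtain s j r where s: "a \<in> carrier R" "s \<in> carrier R" "s \<notin> Q" "j \<in> Q1" "r \<in> carrier R" "s \<otimes> a = j \<oplus> q [^] Suc n \<otimes> r"
      unfolding Sin by blast
    have "q [^] Suc n \<otimes> r = q [^] n \<otimes> (q \<otimes> r)" using qc s by (simp add: m_assoc)
    then show "a \<in> S n" using s qc unfolding Sin by (metis m_closed)
  qed
  have Q1S: "Q1 \<subseteq> S n" for n
    unfolding S_def using subset_saturation[OF Q adjoin_ideal[OF Q1i nat_pow_closed[OF qc]]]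
      adjoin_subset[OF Q1i nat_pow_closed[OF qc]] by blast
  \<comment> \<open>S n is contracted from the localization at Q, so factors outside Q can be
    cancelled.\<close>
  have Qsat: "c \<in> S n" if uc: "c \<in> carrier R" "u \<in> carrier R" "u \<notin> Q" "u \<otimes> c \<in> S n" for c u n
  proof -
    obtain s where s: "s \<in> carrier R" "s \<notin> Q" "s \<otimes> (u \<otimes> c) \<in> adjoin R Q1 (q [^] n)"
      using uc(4) by (auto simp: S_def saturation_iff)
    have "s \<otimes> (u \<otimes> c) = (s \<otimes> u) \<otimes> c" using s(1) uc by (simp add: m_assoc)
    moreover have "s \<otimes> u \<notin> Q" using prime_mult[OF Q] s uc by auto
    ultimately show ?thesis using s uc unfolding S_def saturation_iff by (auto intro!: exI[of _ "s \<otimes> u"])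
  qed
  have stat: "stationary_at P (adjoin R Q1 x)"
    by (rule stationary_at_minimal_prime[OF min adjoin_ideal[OF Q1i x]])
  obtain n where "\<And>k. k \<ge> n \<Longrightarrow> adjoin R (S k) x \<subseteq> saturation R P (adjoin R (S (Suc k)) x)"
    by (rule stationary_atD[OF stat, of "\<lambda>n. adjoin R (S n) x"])
      (use adjoin_ideal[OF Si x] adjoin_mono[OF Q1S] adjoin_mono[OF Sdec] in auto)
  then have n: "adjoin R (S n) x \<subseteq> saturation R P (adjoin R (S (Suc n)) x)" by simp
  have Sc: "S n \<subseteq> carrier R" for n by (auto simp: Sin)
  \<comment> \<open>Since x is outside Q, an equation s y = b + x c with y in S n and b in S (n+1)
    puts c back into S n. Hence S n lies in S (n+1) + x S n at P, and Nakayama removes the second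
    summand.\<close>
  have "S n \<subseteq> saturation R P (S (Suc n))"
  proof (rule nakayama[OF P Sc Si xP])
    fix y assume y: "y \<in> S n"
    then have "y \<in> saturation R P (adjoin R (S (Suc n)) x)"
      using n adjoin_subset[OF Si x, of n] by auto
    then obtain s b c where s: "s \<in> carrier R" "s \<notin> P" "b \<in> S (Suc n)" "c \<in> carrier R" "s \<otimes> y = b \<oplus> x \<otimes> c"
      by (auto simp: saturation_iff adjoin_def)
    have "x \<otimes> c \<in> S n"
      using ideal_add_cancel[OF Si, of b n "x \<otimes> c"] ideal_mult[OF Si y s(1)] s x Sdec[of n] by auto
    then have "c \<in> S n" using Qsat s x xQ by blast
    then show "\<exists>s b c. s \<in> carrier R \<and> s \<notin> P \<and> b \<in> S (Suc n) \<and> c \<in> S n \<and> s \<otimes> y = b \<oplus> x \<otimes> c" using s by blast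
  qed
  moreover have "q [^] n \<in> S n"
  proof -
    have "q [^] n \<in> adjoin R Q1 (q [^] n)" using adjoin_mem[OF Q1i nat_pow_closed[OF qc]] .
    then show ?thesis unfolding S_def
      using subset_saturation[OF Q adjoin_ideal[OF Q1i nat_pow_closed[OF qc]]] by blast
  qed
  ultimately have "q [^] n \<in> saturation R P (S (Suc n))" by blast
  then obtain u where u: "u \<in> carrier R" "u \<notin> P" "u \<otimes> q [^] n \<in> S (Suc n)" by (auto simp: saturation_iff)
  have "u \<notin> Q" using u sub by auto
  then have "q [^] n \<in> S (Suc n)" using Qsat[OF nat_pow_closed[OF qc] u(1)] u by blast
  \<comment> \<open>Up to a factor s outside Q, q^n is now a multiple of q^(n+1) modulo Q1.
    Cancelling q^n in the domain R/Q1 puts s into Q1 + qR, hence into Q.\<close>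
  then obtain s j r where s: "s \<in> carrier R" "s \<notin> Q" "j \<in> Q1" "r \<in> carrier R" "s \<otimes> q [^] n = j \<oplus> q [^] Suc n \<otimes> r"
    unfolding Sin by blast
  have jc: "j \<in> carrier R" and qnc: "q [^] n \<in> carrier R" using ideal_carr[OF Q1i s(3)] qc by auto
  have "q [^] n \<otimes> (s \<ominus> q \<otimes> r) = s \<otimes> q [^] n \<ominus> q [^] Suc n \<otimes> r"
    unfolding nat_pow_Suc using s(1,4) qnc qc by algebra
  also have "\<dots> = j" unfolding s(5) nat_pow_Suc using s(1,4) qnc qc jc by algebra
  finally have "q [^] n \<otimes> (s \<ominus> q \<otimes> r) \<in> Q1" using s by simp
  then have "s \<ominus> q \<otimes> r \<in> Q1" using prime_mult[OF Q1 qnc, of "s \<ominus> q \<otimes> r"] prime_pow[OF Q1 qc] q s qc by auto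
  then have "s \<ominus> q \<otimes> r \<in> Q" using sub by auto
  from ideal_add[OF Qi this ideal_multr[OF Qi q(1) s(4)]] have "s \<in> Q"
    using s qc by (simp add: minus_eq a_assoc l_neg)
  then show False using s by simp
qed

end

text \<open>The inequality ht P >= n as a predicate on natural numbers. By
  \<open>has_chain_Suc\<close> it peels off one prime at the top, so heights are handled by
  induction instead of by suprema in \<open>enat\<close>.\<close>

definition has_chain :: "('a, 'r) ring_scheme \<Rightarrow> nat \<Rightarrow> 'a set \<Rightarrow> bool"
  where "has_chain R n P \<longleftrightarrow> (\<exists>c. prime_chain R n c \<and> c n = P)"

lemma has_chain_prime: "has_chain R n P \<Longrightarrow> primeideal P R"
  by (auto simp: has_chain_def prime_chain_def)

lemma has_chain_0: "has_chain R 0 P \<longleftrightarrow> primeideal P R"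
  by (auto simp: has_chain_def prime_chain_def intro: exI[of _ "\<lambda>_. P"])

lemma has_chain_Suc: "has_chain R (Suc n) P \<longleftrightarrow> primeideal P R \<and> (\<exists>Q. has_chain R n Q \<and> Q \<subset> P)"
proof
  assume "has_chain R (Suc n) P"
  then obtain c where "prime_chain R (Suc n) c" "c (Suc n) = P" by (auto simp: has_chain_def)
  then have "prime_chain R n c" "c n \<subset> P" "primeideal P R" by (auto simp: prime_chain_def)
  then show "primeideal P R \<and> (\<exists>Q. has_chain R n Q \<and> Q \<subset> P)" by (auto simp: has_chain_def)
next
  assume "primeideal P R \<and> (\<exists>Q. has_chain R n Q \<and> Q \<subset> P)"
  then obtain c where c: "primeideal P R" "prime_chain R n c" "c n \<subset> P" by (auto simp: has_chain_def)
  have "prime_chain R (Suc n) (c(Suc n := P))"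
    using c by (auto simp: prime_chain_def le_Suc_eq less_Suc_eq)
  then show "has_chain R (Suc n) P" by (auto simp: has_chain_def)
qed

lemma has_chain_mono:
  assumes "has_chain R n Q" "Q \<subseteq> P" "primeideal P R"
  shows "has_chain R n P"
proof (cases n)
  case (Suc m)
  then obtain K where "has_chain R m K" "K \<subset> Q" using assms(1) has_chain_Suc[of R m Q] by auto
  then show ?thesis using Suc assms has_chain_Suc[of R m P] by blast
qed (use assms in \<open>simp add: has_chain_0\<close>)

lemma has_chain_less:
  assumes "has_chain R n P" "m \<le> n"
  shows "has_chain R m P"
  using assms(2,1)
proof (induction arbitrary: P rule: inc_induct)
  case (step k)
  then obtain Q where Q: "has_chain R k Q" "Q \<subset> P" "primeideal P R"
    using has_chain_Suc[of R k P] by blast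
  then show ?case using has_chain_mono[of R k Q P] by blast
qed

lemma prime_height_ge:
  assumes "primeideal P R"
  shows "enat n \<le> prime_height R P \<longleftrightarrow> has_chain R n P"
proof
  assume "has_chain R n P"
  then show "enat n \<le> prime_height R P"
    unfolding prime_height_def has_chain_def[symmetric] by (intro Sup_upper) auto
next
  assume n: "enat n \<le> prime_height R P"
  show "has_chain R n P"
  proof (rule ccontr)
    assume no: "\<not> has_chain R n P"
    then obtain m where m: "n = Suc m" using assms by (cases n) (auto simp: has_chain_0)
    \<comment> \<open>Chains can be shortened, so without one of length n = m + 1 every chain has
      length at most m.\<close>
    have "prime_height R P \<le> enat m"
      unfolding prime_height_def has_chain_def[symmetric]
    proof (rule Sup_least)
      fix z assume "z \<in> {enat n |n. has_chain R n P}"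
      then obtain k where k: "z = enat k" "has_chain R k P" by auto
      then have "\<not> n \<le> k" using no has_chain_less by blast
      then show "z \<le> enat m" using k m by auto
    qed
    then have "enat (Suc m) \<le> enat m" using n m order_trans by blast
    then show False by simp
  qed
qed

text \<open>For the unit ideal both sides hold for every n, in accordance with its height
  \<infinity>.\<close>

lemma ideal_height_ge:
  "enat n \<le> ideal_height R I \<longleftrightarrow> (\<forall>P. primeideal P R \<and> I \<subseteq> P \<longrightarrow> has_chain R n P)"
  by (auto simp: ideal_height_def le_Inf_iff prime_height_ge)

lemma ideal_height_le:
  "primeideal P R \<Longrightarrow> I \<subseteq> P \<Longrightarrow> ideal_height R I \<le> prime_height R P"
  by (auto simp: ideal_height_def intro: Inf_lower)

context noetherian_cring
begin

text \<open>Let M be a prime directly below P and a a generator outside M. The other generators b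
  are traded for elements q_b of M. If M were not minimal over the q_b, there would be a prime K
  strictly below M with P minimal over K + aR, against the principal ideal theorem; so the induction
  hypothesis bounds the chains that end in M.\<close>

theorem krull_height:
  assumes "finite F" "F \<subseteq> carrier R" "minimal_prime R (Idl F) P" "has_chain R n P"
  shows "n \<le> card F"
proof -
  \<comment> \<open>The induction is on a bound k for the cardinality, because b -> q_b need not be
    injective and the new set may shrink by more than one.\<close>
  have "n \<le> k" if "finite F" "F \<subseteq> carrier R" "minimal_prime R (Idl F) P" "has_chain R n P" "card F \<le> k" for k
    using that
  proof (induction k arbitrary: F P n)
    case 0
    have FI: "ideal (Idl F) R" using 0 genideal_ideal by auto
    show ?case
    proof (cases n)
      case (Suc m)
      then obtain Q where Q: "has_chain R m Q" "Q \<subset> P" using 0 has_chain_Suc[of R m P] by auto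
      have Qp: "primeideal Q R" using has_chain_prime[OF Q(1)] .
      have "Idl F \<subseteq> Q" using 0 by (intro genideal_minimal prime_ideal[OF Qp]) auto
      then show ?thesis using minimal_primeD(3)[OF 0(3) Qp] Q(2) by auto
    qed simp
  next
    case (Suc k)
    note P = minimal_primeD(1)[OF Suc.prems(3)]
    have Fi: "ideal (Idl F) R" using Suc.prems genideal_ideal by auto
    have FI: "F \<subseteq> Idl F" using genideal_self Suc.prems by auto
    have FP: "F \<subseteq> P" using FI minimal_primeD(2)[OF Suc.prems(3)] by auto
    show ?case
    proof (cases n)
      case (Suc m)
      then obtain Q where Q: "has_chain R m Q" "Q \<subset> P" using Suc.prems has_chain_Suc[of R m P] by auto
      let ?T = "{K. primeideal K R \<and> Q \<subseteq> K \<and> K \<subset> P}"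
      obtain M where M: "M \<in> ?T" and max: "\<And>K. K \<in> ?T \<Longrightarrow> M \<subseteq> K \<Longrightarrow> K = M"
        by (rule maximal_exists[of ?T]) (use Q(2) has_chain_prime[OF Q(1)] prime_ideal in auto)
      have Mp: "primeideal M R" and QM: "Q \<subseteq> M" and MP: "M \<subset> P" using M by auto
      note Mi = prime_ideal[OF Mp]
      have Mm: "has_chain R m M" using has_chain_mono[OF Q(1) QM Mp] .
      have "\<not> F \<subseteq> M"
      proof
        assume "F \<subseteq> M"
        then have "Idl F \<subseteq> M" by (rule genideal_minimal[OF Mi])
        then show False using minimal_primeD(3)[OF Suc.prems(3) Mp] MP by auto
      qed
      then obtain a where a: "a \<in> F" "a \<notin> M" by auto
      have ac: "a \<in> carrier R" using a Suc.prems by auto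
      have adP: "adjoin R M a \<subseteq> P" using adjoin_least[of M P a] prime_ideal[OF P] MP a FP by auto
      have minM: "K = P" if "primeideal K R" "adjoin R M a \<subseteq> K" "K \<subseteq> P" for K
      proof (rule ccontr)
        assume "K \<noteq> P"
        then have "K \<in> ?T" using that QM adjoin_subset[OF Mi ac] by auto
        then have "K = M" using max that adjoin_subset[OF Mi ac] by blast
        then show False using that adjoin_mem[OF Mi ac] a by auto
      qed
      \<comment> \<open>P is the only prime between M + aR and P, so b is nilpotent modulo M + aR at
        P: s b^i = q + a r with s outside P. A prime inside P that contains q and a therefore
        contains b.\<close>
      have "\<exists>q. q \<in> M \<and> (\<forall>K. primeideal K R \<and> q \<in> K \<and> a \<in> K \<and> K \<subseteq> P \<longrightarrow> b \<in> K)" if b: "b \<in> F" for b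
      proof -
        have bc: "b \<in> carrier R" using b Suc.prems by auto
        have "\<exists>s i. s \<in> carrier R \<and> s \<notin> P \<and> s \<otimes> b [^] (i::nat) \<in> adjoin R M a"
        proof (rule ccontr)
          assume "\<not> ?thesis"
          then obtain K where K: "primeideal K R" "adjoin R M a \<subseteq> K" "K \<subseteq> P" "b \<notin> K"
            using prime_avoiding_powers[OF adjoin_ideal[OF Mi ac] P bc] by metis
          then show False using minM[of K] b FP by auto
        qed
        then obtain s q r and i :: nat where s: "s \<in> carrier R" "s \<notin> P" "q \<in> M" "r \<in> carrier R" "s \<otimes> b [^] i = q \<oplus> a \<otimes> r"
          by (auto simp: adjoin_def)
        have "b \<in> K" if K: "primeideal K R" "q \<in> K" "a \<in> K" "K \<subseteq> P" for K
        proof -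
          have "s \<otimes> b [^] i \<in> K"
            unfolding s(5) using K s by (intro ideal_add ideal_multr prime_ideal) auto
          moreover have "s \<notin> K" using s(2) K(4) by auto
          ultimately have "b [^] i \<in> K" using prime_mult[OF K(1) s(1) nat_pow_closed[OF bc]] by blast
          then show ?thesis using prime_pow[OF K(1) bc] by auto
        qed
        then show ?thesis using s by blast
      qed
      then obtain q where q: "\<And>b. b \<in> F \<Longrightarrow> q b \<in> M"
        "\<And>b K. b \<in> F \<Longrightarrow> primeideal K R \<Longrightarrow> q b \<in> K \<Longrightarrow> a \<in> K \<Longrightarrow> K \<subseteq> P \<Longrightarrow> b \<in> K" by metis
      define G where "G = q ` (F - {a})"
      have G: "finite G" "G \<subseteq> M" "G \<subseteq> carrier R" "card G \<le> k"
      proof -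
        show "finite G" "G \<subseteq> M" using Suc.prems q(1) by (auto simp: G_def)
        then show "G \<subseteq> carrier R" using ideal_carr[OF Mi] by auto
        have "card G \<le> card (F - {a})" unfolding G_def by (rule card_image_le) (use Suc.prems in auto)
        also have "\<dots> \<le> k" using a Suc.prems by simp
        finally show "card G \<le> k" .
      qed
      have minG: "minimal_prime R (Idl G) M"
        unfolding minimal_prime_def
      proof (intro conjI allI impI Mp)
        show "Idl G \<subseteq> M" using G Mi by (intro genideal_minimal)
        fix K assume K: "primeideal K R \<and> Idl G \<subseteq> K \<and> K \<subseteq> M"
        then have Kp: "primeideal K R" and GK: "G \<subseteq> K" and KM: "K \<subseteq> M" using genideal_self[OF G(3)] by auto
        note Ki = prime_ideal[OF Kp]
        show "K = M"
        proof (rule ccontr)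
          assume "K \<noteq> M"
          then have KM': "K \<subset> M" using KM by auto
          have "minimal_prime R (adjoin R K a) P"
            unfolding minimal_prime_def
          proof (intro conjI allI impI P)
            show "adjoin R K a \<subseteq> P" using adjoin_least[of K P a] KM MP a FP prime_ideal[OF P] by auto
            fix L assume L: "primeideal L R \<and> adjoin R K a \<subseteq> L \<and> L \<subseteq> P"
            then have Lp: "primeideal L R" and KL: "K \<subseteq> L" "a \<in> L" and LP: "L \<subseteq> P"
              using adjoin_subset[OF Ki ac] adjoin_mem[OF Ki ac] by auto
            have "b \<in> L" if "b \<in> F" for b
            proof (cases "b = a")
              case False
              then have "q b \<in> L" using that GK KL by (auto simp: G_def)
              then show ?thesis using q(2)[OF that Lp] KL LP by auto
            qed (use KL in simp)
            then have "Idl F \<subseteq> L" by (intro genideal_minimal prime_ideal[OF Lp]) auto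
            then show "L = P" using minimal_primeD(3)[OF Suc.prems(3) Lp] LP by auto
          qed
          then show False using principal_ideal_theorem[OF _ Kp Mp ac KM' MP] by blast
        qed
      qed
      then show ?thesis using Suc.IH[OF G(1,3) minG Mm G(4)] \<open>n = Suc m\<close> by simp
    qed simp
  qed
  then show ?thesis using assms by blast
qed

end

section \<open>Localization at a prime ideal\<close>

text \<open>Characterizes R -> R_P up to isomorphism, so that the ideal theory of R_P is derived
  without touching equivalence classes of pairs; \<open>loc_prime_localization\<close> supplies the
  instance.\<close>

locale prime_localization = R: cring R + A: cring A + ring_hom_cring R A \<phi>
  for R (structure) and A (structure) and \<phi> and P +
  assumes P: "primeideal P R"
    and inverts: "s \<in> carrier R \<Longrightarrow> s \<notin> P \<Longrightarrow> \<phi> s \<in> Units A"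
    and fractions: "z \<in> carrier A \<Longrightarrow> \<exists>a s. a \<in> carrier R \<and> s \<in> carrier R \<and> s \<notin> P \<and> z \<otimes>\<^bsub>A\<^esub> \<phi> s = \<phi> a"
    and kernel: "a \<in> carrier R \<Longrightarrow> \<phi> a = \<zero>\<^bsub>A\<^esub> \<Longrightarrow> \<exists>s. s \<in> carrier R \<and> s \<notin> P \<and> s \<otimes>\<^bsub>R\<^esub> a = \<zero>\<^bsub>R\<^esub>"
begin

definition ext :: "'a set \<Rightarrow> 'c set"
  where "ext J = {z \<in> carrier A. \<exists>a s. a \<in> J \<and> s \<in> carrier R \<and> s \<notin> P \<and> z \<otimes>\<^bsub>A\<^esub> \<phi> s = \<phi> a}"

definition con :: "'c set \<Rightarrow> 'a set"
  where "con J = {a \<in> carrier R. \<phi> a \<in> J}"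

lemma mult_notin_P: "s \<in> carrier R \<Longrightarrow> s \<notin> P \<Longrightarrow> t \<in> carrier R \<Longrightarrow> t \<notin> P \<Longrightarrow> s \<otimes>\<^bsub>R\<^esub> t \<notin> P"
  using prime_mult[OF P] by auto

lemma one_notin_P: "\<one>\<^bsub>R\<^esub> \<notin> P"
  by (rule prime_not_one[OF P])

lemma extI: "z \<in> carrier A \<Longrightarrow> a \<in> J \<Longrightarrow> s \<in> carrier R \<Longrightarrow> s \<notin> P \<Longrightarrow> z \<otimes>\<^bsub>A\<^esub> \<phi> s = \<phi> a \<Longrightarrow> z \<in> ext J"
  by (auto simp: ext_def)

lemma extE:
  assumes "z \<in> ext J"
  obtains a s where "z \<in> carrier A" "a \<in> J" "s \<in> carrier R" "s \<notin> P" "z \<otimes>\<^bsub>A\<^esub> \<phi> s = \<phi> a"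
  using assms by (auto simp: ext_def)

lemma ext_mono: "I \<subseteq> J \<Longrightarrow> ext I \<subseteq> ext J"
  by (auto simp: ext_def)

lemma in_ideal_cancel:
  assumes J: "ideal J A" and z: "z \<in> carrier A" and s: "s \<in> carrier R" "s \<notin> P" and zs: "z \<otimes>\<^bsub>A\<^esub> \<phi> s \<in> J"
  shows "z \<in> J"
proof -
  have u: "\<phi> s \<in> Units A" by (rule inverts[OF s])
  have "z = (z \<otimes>\<^bsub>A\<^esub> \<phi> s) \<otimes>\<^bsub>A\<^esub> inv\<^bsub>A\<^esub> \<phi> s" using u z s by (simp add: A.m_assoc)
  then show ?thesis using ideal_multr[OF J zs A.Units_inv_closed[OF u]] by simp
qed

lemma image_in_ext:
  assumes "ideal J R" "a \<in> J"
  shows "\<phi> a \<in> ext J"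
  using assms ideal_carr[OF assms] one_notin_P by (auto intro!: extI[of _ a _ "\<one>\<^bsub>R\<^esub>"])

lemma ext_ideal:
  assumes J: "ideal J R"
  shows "ideal (ext J) A"
proof (rule A.ideal_intro)
  show "ext J \<subseteq> carrier A" by (auto simp: ext_def)
  show "\<zero>\<^bsub>A\<^esub> \<in> ext J" using image_in_ext[OF J ideal_zero[OF J]] by simp
next
  fix x y assume "x \<in> ext J" "y \<in> ext J"
  then obtain a s b t where a: "x \<in> carrier A" "a \<in> J" "s \<in> carrier R" "s \<notin> P" "x \<otimes>\<^bsub>A\<^esub> \<phi> s = \<phi> a"
    and b: "y \<in> carrier A" "b \<in> J" "t \<in> carrier R" "t \<notin> P" "y \<otimes>\<^bsub>A\<^esub> \<phi> t = \<phi> b"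
    by (metis extE)
  note ac = ideal_carr[OF J a(2)] and bc = ideal_carr[OF J b(2)]
  have "\<phi> s \<in> carrier A" "\<phi> t \<in> carrier A" using a b by auto
  then have "(x \<oplus>\<^bsub>A\<^esub> y) \<otimes>\<^bsub>A\<^esub> (\<phi> s \<otimes>\<^bsub>A\<^esub> \<phi> t) = (x \<otimes>\<^bsub>A\<^esub> \<phi> s) \<otimes>\<^bsub>A\<^esub> \<phi> t \<oplus>\<^bsub>A\<^esub> (y \<otimes>\<^bsub>A\<^esub> \<phi> t) \<otimes>\<^bsub>A\<^esub> \<phi> s"
    using a(1) b(1) by algebra
  then have "(x \<oplus>\<^bsub>A\<^esub> y) \<otimes>\<^bsub>A\<^esub> \<phi> (s \<otimes>\<^bsub>R\<^esub> t) = \<phi> (a \<otimes>\<^bsub>R\<^esub> t \<oplus>\<^bsub>R\<^esub> b \<otimes>\<^bsub>R\<^esub> s)"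
    using a b ac bc by simp
  then show "x \<oplus>\<^bsub>A\<^esub> y \<in> ext J"
    using a b ideal_add[OF J ideal_multr[OF J a(2) b(3)] ideal_multr[OF J b(2) a(3)]] mult_notin_P
    by (intro extI[of _ _ _ "s \<otimes>\<^bsub>R\<^esub> t"]) auto
next
  fix x w assume "x \<in> ext J" and w: "w \<in> carrier A"
  then obtain a s where a: "x \<in> carrier A" "a \<in> J" "s \<in> carrier R" "s \<notin> P" "x \<otimes>\<^bsub>A\<^esub> \<phi> s = \<phi> a" by (metis extE)
  obtain b t where b: "b \<in> carrier R" "t \<in> carrier R" "t \<notin> P" "w \<otimes>\<^bsub>A\<^esub> \<phi> t = \<phi> b" using fractions[OF w] by blast
  note ac = ideal_carr[OF J a(2)]
  have "\<phi> s \<in> carrier A" "\<phi> t \<in> carrier A" using a b by auto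
  then have "(w \<otimes>\<^bsub>A\<^esub> x) \<otimes>\<^bsub>A\<^esub> (\<phi> s \<otimes>\<^bsub>A\<^esub> \<phi> t) = (w \<otimes>\<^bsub>A\<^esub> \<phi> t) \<otimes>\<^bsub>A\<^esub> (x \<otimes>\<^bsub>A\<^esub> \<phi> s)"
    using a(1) w by algebra
  then have "(w \<otimes>\<^bsub>A\<^esub> x) \<otimes>\<^bsub>A\<^esub> \<phi> (s \<otimes>\<^bsub>R\<^esub> t) = \<phi> (b \<otimes>\<^bsub>R\<^esub> a)"
    using a b ac by simp
  then show "w \<otimes>\<^bsub>A\<^esub> x \<in> ext J"
    using a b w ideal_mult[OF J a(2) b(1)] mult_notin_P
    by (intro extI[of _ _ _ "s \<otimes>\<^bsub>R\<^esub> t"]) auto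
qed

lemma con_ideal:
  assumes J: "ideal J A"
  shows "ideal (con J) R"
  using ideal_zero[OF J] ideal_add[OF J] ideal_mult[OF J]
  by (intro R.ideal_intro) (auto simp: con_def)

text \<open>The kernel condition turns the equation \<phi> a \<phi> s = \<phi> b in A into one in R:
  t (a s - b) = 0 for some t outside P. Through this lemma saturations represent localized ideals
  inside R.\<close>

lemma con_ext: 
  assumes J: "ideal J R"
  shows "con (ext J) = saturation R P J"
proof (intro equalityI subsetI)
  fix a assume "a \<in> con (ext J)"
  then obtain b s where b: "a \<in> carrier R" "b \<in> J" "s \<in> carrier R" "s \<notin> P" "\<phi> a \<otimes>\<^bsub>A\<^esub> \<phi> s = \<phi> b"
    by (auto simp: con_def elim: extE)
  note bc = ideal_carr[OF J b(2)]
  have "\<phi> (a \<otimes>\<^bsub>R\<^esub> s \<ominus>\<^bsub>R\<^esub> b) = \<phi> (a \<otimes>\<^bsub>R\<^esub> s) \<ominus>\<^bsub>A\<^esub> \<phi> b"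
    using b bc by (simp add: R.minus_eq A.minus_eq)
  also have "\<dots> = \<zero>\<^bsub>A\<^esub>" using b bc by (simp add: A.minus_eq A.r_neg)
  finally obtain t where t: "t \<in> carrier R" "t \<notin> P" "t \<otimes>\<^bsub>R\<^esub> (a \<otimes>\<^bsub>R\<^esub> s \<ominus>\<^bsub>R\<^esub> b) = \<zero>\<^bsub>R\<^esub>"
    using kernel[of "a \<otimes>\<^bsub>R\<^esub> s \<ominus>\<^bsub>R\<^esub> b"] b bc by auto
  have "(t \<otimes>\<^bsub>R\<^esub> s) \<otimes>\<^bsub>R\<^esub> a = t \<otimes>\<^bsub>R\<^esub> (a \<otimes>\<^bsub>R\<^esub> s \<ominus>\<^bsub>R\<^esub> b) \<oplus>\<^bsub>R\<^esub> t \<otimes>\<^bsub>R\<^esub> b"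
    using t(1) b(1,3) bc by algebra
  then have "(t \<otimes>\<^bsub>R\<^esub> s) \<otimes>\<^bsub>R\<^esub> a \<in> J" using t bc ideal_mult[OF J b(2) t(1)] by simp
  then show "a \<in> saturation R P J" using b t mult_notin_P by (auto simp: R.saturation_iff intro!: exI[of _ "t \<otimes>\<^bsub>R\<^esub> s"])
next
  fix a assume "a \<in> saturation R P J"
  then obtain s where s: "a \<in> carrier R" "s \<in> carrier R" "s \<notin> P" "s \<otimes>\<^bsub>R\<^esub> a \<in> J" by (auto simp: R.saturation_iff)
  then have "\<phi> a \<otimes>\<^bsub>A\<^esub> \<phi> s = \<phi> (s \<otimes>\<^bsub>R\<^esub> a)" by (simp add: A.m_comm)
  then show "a \<in> con (ext J)" using s by (auto simp: con_def intro: extI)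
qed

lemma ext_con:
  assumes J: "ideal J A"
  shows "ext (con J) = J"
proof (intro equalityI subsetI)
  fix z assume "z \<in> ext (con J)"
  then obtain a s where a: "z \<in> carrier A" "a \<in> con J" "s \<in> carrier R" "s \<notin> P" "z \<otimes>\<^bsub>A\<^esub> \<phi> s = \<phi> a" by (metis extE)
  then show "z \<in> J" using in_ideal_cancel[OF J a(1,3,4)] by (simp add: con_def)
next
  fix z assume z: "z \<in> J"
  note zc = ideal_carr[OF J z]
  obtain a s where a: "a \<in> carrier R" "s \<in> carrier R" "s \<notin> P" "z \<otimes>\<^bsub>A\<^esub> \<phi> s = \<phi> a" using fractions[OF zc] by blast
  then have "\<phi> a \<in> J" using ideal_multr[OF J z, of "\<phi> s"] by simp
  then show "z \<in> ext (con J)" using a zc by (auto simp: con_def intro: extI)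
qed

lemma con_prime:
  assumes J: "primeideal J A"
  shows "primeideal (con J) R" "con J \<subseteq> P"
proof -
  show "primeideal (con J) R"
  proof (rule R.prime_intro[OF con_ideal[OF prime_ideal[OF J]]])
    show "\<one>\<^bsub>R\<^esub> \<notin> con J" using prime_not_one[OF J] by (simp add: con_def)
    fix a b assume "a \<in> carrier R" "b \<in> carrier R" "a \<otimes>\<^bsub>R\<^esub> b \<in> con J" "a \<notin> con J"
    then show "b \<in> con J" using prime_mult[OF J, of "\<phi> a" "\<phi> b"] by (simp add: con_def)
  qed
  show "con J \<subseteq> P"
  proof
    fix s assume s: "s \<in> con J"
    show "s \<in> P"
    proof (rule ccontr)
      assume n: "s \<notin> P"
      have sc: "s \<in> carrier R" "\<phi> s \<in> J" using s by (auto simp: con_def)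
      have "\<one>\<^bsub>A\<^esub> \<in> J"
        by (rule in_ideal_cancel[OF prime_ideal[OF J] A.one_closed sc(1) n]) (use sc in simp)
      then show False using prime_not_one[OF J] by simp
    qed
  qed
qed

lemma saturation_prime:
  assumes Q: "primeideal Q R" "Q \<subseteq> P"
  shows "saturation R P Q = Q"
proof
  show "saturation R P Q \<subseteq> Q"
  proof
    fix a assume "a \<in> saturation R P Q"
    then obtain s where "a \<in> carrier R" "s \<in> carrier R" "s \<notin> P" "s \<otimes>\<^bsub>R\<^esub> a \<in> Q" unfolding R.saturation_iff by blast
    then show "a \<in> Q" using prime_mult[OF Q(1), of s a] Q(2) by auto
  qed
  show "Q \<subseteq> saturation R P Q" by (rule R.subset_saturation[OF P prime_ideal[OF Q(1)]])
qed

lemma ext_prime: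
  assumes Q: "primeideal Q R" "Q \<subseteq> P"
  shows "primeideal (ext Q) A"
proof (rule A.prime_intro[OF ext_ideal[OF prime_ideal[OF Q(1)]]])
  have con: "con (ext Q) = Q" using con_ext[OF prime_ideal[OF Q(1)]] saturation_prime[OF Q] by simp
  note Ei = ext_ideal[OF prime_ideal[OF Q(1)]]
  show "\<one>\<^bsub>A\<^esub> \<notin> ext Q"
  proof
    assume "\<one>\<^bsub>A\<^esub> \<in> ext Q"
    then have "\<one>\<^bsub>R\<^esub> \<in> con (ext Q)" by (simp add: con_def)
    then show False using con prime_not_one[OF Q(1)] by simp
  qed
  fix x y assume x: "x \<in> carrier A" and y: "y \<in> carrier A" and xy: "x \<otimes>\<^bsub>A\<^esub> y \<in> ext Q" and nx: "x \<notin> ext Q"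
  obtain a s where a: "a \<in> carrier R" "s \<in> carrier R" "s \<notin> P" "x \<otimes>\<^bsub>A\<^esub> \<phi> s = \<phi> a" using fractions[OF x] by blast
  obtain b t where b: "b \<in> carrier R" "t \<in> carrier R" "t \<notin> P" "y \<otimes>\<^bsub>A\<^esub> \<phi> t = \<phi> b" using fractions[OF y] by blast
  have c: "\<phi> s \<in> carrier A" "\<phi> t \<in> carrier A" using a b by auto
  have "(x \<otimes>\<^bsub>A\<^esub> y) \<otimes>\<^bsub>A\<^esub> (\<phi> s \<otimes>\<^bsub>A\<^esub> \<phi> t) = (x \<otimes>\<^bsub>A\<^esub> \<phi> s) \<otimes>\<^bsub>A\<^esub> (y \<otimes>\<^bsub>A\<^esub> \<phi> t)"
    using x y c by algebra
  also have "\<dots> = \<phi> (a \<otimes>\<^bsub>R\<^esub> b)" using a b by simp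
  finally have "\<phi> (a \<otimes>\<^bsub>R\<^esub> b) \<in> ext Q"
    using ideal_multr[OF Ei xy, of "\<phi> s \<otimes>\<^bsub>A\<^esub> \<phi> t"] c by simp
  then have "a \<otimes>\<^bsub>R\<^esub> b \<in> con (ext Q)" using a b by (simp add: con_def)
  then have "a \<in> Q \<or> b \<in> Q" using prime_mult[OF Q(1) a(1) b(1)] con by simp
  moreover have "a \<notin> Q" using nx extI[OF x _ a(2,3,4)] by auto
  ultimately show "y \<in> ext Q" using extI[OF y _ b(2,3,4)] by auto
qed

text \<open>Strict inclusions survive because \<open>con (ext Q) = Q\<close> for primes inside P; in
  the opposite direction, \<open>has_chain_con\<close>, they survive because
  \<open>ext (con J) = J\<close>.\<close>

lemma has_chain_ext:
  assumes "has_chain R n Q" "Q \<subseteq> P"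
  shows "has_chain A n (ext Q)"
  using assms
proof (induction n arbitrary: Q)
  case 0
  then show ?case using ext_prime by (simp add: has_chain_0)
next
  case (Suc n)
  then obtain K where K: "has_chain R n K" "K \<subset> Q" and Q: "primeideal Q R" using has_chain_Suc[of R n Q] by auto
  have Kp: "primeideal K R" using has_chain_prime[OF K(1)] .
  have "has_chain A n (ext K)" using Suc.IH[OF K(1)] K Suc.prems by auto
  moreover have "con (ext K) = K" "con (ext Q) = Q"
    using con_ext[OF prime_ideal[OF Kp]] con_ext[OF prime_ideal[OF Q]] saturation_prime[OF Kp] saturation_prime[OF Q]
      K(2) Suc.prems(2) by auto
  then have "ext K \<noteq> ext Q" using K(2) by (metis order_less_irrefl)
  then have "ext K \<subset> ext Q" using ext_mono[of K Q] K(2) by auto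
  ultimately show ?case using ext_prime[OF Q Suc.prems(2)] has_chain_Suc[of A n "ext Q"] by blast
qed

lemma has_chain_con:
  assumes "has_chain A n J"
  shows "has_chain R n (con J)"
  using assms
proof (induction n arbitrary: J)
  case 0
  then show ?case using con_prime by (simp add: has_chain_0)
next
  case (Suc n)
  then obtain K where K: "has_chain A n K" "K \<subset> J" and J: "primeideal J A" using has_chain_Suc[of A n J] by auto
  have Kp: "primeideal K A" using has_chain_prime[OF K(1)] .
  have "con K \<subseteq> con J" using K by (auto simp: con_def)
  moreover have "con K \<noteq> con J" using ext_con[OF prime_ideal[OF Kp]] ext_con[OF prime_ideal[OF J]] K(2) by (metis order_less_irrefl)
  ultimately have "con K \<subset> con J" by auto
  then show ?case using con_prime(1)[OF J] Suc.IH[OF K(1)] has_chain_Suc[of R n "con J"] by blast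
qed

lemma notin_ext_P:
  assumes "z \<in> carrier A" "z \<notin> ext P"
  shows "z \<in> Units A"
proof -
  obtain a s where a: "a \<in> carrier R" "s \<in> carrier R" "s \<notin> P" "z \<otimes>\<^bsub>A\<^esub> \<phi> s = \<phi> a" using fractions[OF assms(1)] by blast
  have "a \<notin> P" using extI[OF assms(1) _ a(2,3,4)] assms(2) by auto
  then have "z \<otimes>\<^bsub>A\<^esub> \<phi> s \<in> Units A" using inverts[OF a(1)] a by simp
  then show ?thesis using A.unit_factor[OF _ assms(1)] a(2) by simp
qed

lemma proper_subset_ext_P:
  assumes J: "ideal J A" and n: "J \<noteq> carrier A"
  shows "J \<subseteq> ext P"
proof
  fix z assume z: "z \<in> J"
  show "z \<in> ext P"
  proof (rule ccontr)
    assume "z \<notin> ext P"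
    then have u: "z \<in> Units A" using notin_ext_P ideal_carr[OF J z] by auto
    from u have "inv\<^bsub>A\<^esub> z \<otimes>\<^bsub>A\<^esub> z \<in> J" by (intro ideal_mult[OF J z] A.Units_inv_closed)
    then have "\<one>\<^bsub>A\<^esub> \<in> J" using A.Units_l_inv[OF u] by simp
    then show False using A.one_in_ideal[OF J] n by simp
  qed
qed

lemma ext_P_maximal: "maximalideal (ext P) A"
proof (rule maximalidealI)
  have e: "primeideal (ext P) A" using ext_prime[OF P] by simp
  show "ideal (ext P) A" using prime_ideal[OF e] .
  show "carrier A \<noteq> ext P" using prime_not_one[OF e] A.one_closed by metis
  fix J assume "ideal J A" "ext P \<subseteq> J" "J \<subseteq> carrier A"
  then show "J = ext P \<or> J = carrier A" using proper_subset_ext_P[of J] by blast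
qed

lemma maximal_eq_ext_P:
  assumes "maximalideal M A"
  shows "M = ext P"
proof -
  interpret maximalideal M A by fact
  have "M \<subseteq> ext P" using proper_subset_ext_P[OF is_ideal] I_notcarr by auto
  moreover have "ideal (ext P) A" "ext P \<noteq> carrier A"
    using ext_P_maximal by (auto simp: maximalideal_def maximalideal_axioms_def)
  ultimately show ?thesis using I_maximal[of "ext P"] ideal_carr[OF \<open>ideal (ext P) A\<close>] by blast
qed

lemma local_ring: "local_ring A"
  unfolding local_ring_def by (intro conjI ex1I[of _ "ext P"] ext_P_maximal maximal_eq_ext_P A.is_cring)

lemma max_ideal_eq: "max_ideal A = ext P"
  unfolding max_ideal_def by (rule the_equality, rule ext_P_maximal, erule maximal_eq_ext_P)

text \<open>Expresses that the images of F generate the extended ideal, by testing against all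
  ideals K. This is the form of the assumption \<open>gen\<close> in
  \<open>vanishing_le_card_generators\<close>.\<close>

lemma ext_Idl:
  assumes F: "F \<subseteq> carrier R" and K: "ideal K A"
  shows "ext (Idl\<^bsub>R\<^esub> F) \<subseteq> K \<longleftrightarrow> \<phi> ` F \<subseteq> K"
proof
  assume "ext (Idl\<^bsub>R\<^esub> F) \<subseteq> K"
  then show "\<phi> ` F \<subseteq> K" using image_in_ext[OF R.genideal_ideal[OF F]] R.genideal_self[OF F] by auto
next
  assume a: "\<phi> ` F \<subseteq> K"
  have "Idl\<^bsub>R\<^esub> F \<subseteq> con K" using a F by (intro R.genideal_minimal con_ideal[OF K]) (auto simp: con_def)
  then show "ext (Idl\<^bsub>R\<^esub> F) \<subseteq> K" using ext_mono[of "Idl\<^bsub>R\<^esub> F" "con K"] ext_con[OF K] by auto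
qed

lemma ext_zero: "ext {\<zero>\<^bsub>R\<^esub>} = {\<zero>\<^bsub>A\<^esub>}"
proof
  have "{\<zero>\<^bsub>R\<^esub>} \<subseteq> con {\<zero>\<^bsub>A\<^esub>}" by (auto simp: con_def)
  then show "ext {\<zero>\<^bsub>R\<^esub>} \<subseteq> {\<zero>\<^bsub>A\<^esub>}" using ext_mono ext_con[OF A.zeroideal] by blast
  show "{\<zero>\<^bsub>A\<^esub>} \<subseteq> ext {\<zero>\<^bsub>R\<^esub>}" using ideal_zero[OF ext_ideal[OF R.zeroideal]] by simp
qed

lemma ext_adjoin:
  assumes J: "ideal J R" and x: "x \<in> carrier R"
  shows "ext (adjoin R J x) = adjoin A (ext J) (\<phi> x)"
proof
  have Ei: "ideal (adjoin A (ext J) (\<phi> x)) A" using x by (intro A.adjoin_ideal ext_ideal J) auto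
  have "adjoin R J x \<subseteq> con (adjoin A (ext J) (\<phi> x))"
  proof (rule R.adjoin_least[OF _ _ con_ideal[OF Ei]])
    show "J \<subseteq> con (adjoin A (ext J) (\<phi> x))"
      using A.adjoin_subset[OF ext_ideal[OF J], of "\<phi> x"] x image_in_ext[OF J] ideal_carr[OF J] by (auto simp: con_def)
    show "x \<in> con (adjoin A (ext J) (\<phi> x))"
      using A.adjoin_mem[OF ext_ideal[OF J], of "\<phi> x"] x by (auto simp: con_def)
  qed
  then show "ext (adjoin R J x) \<subseteq> adjoin A (ext J) (\<phi> x)" using ext_mono ext_con[OF Ei] by blast
  show "adjoin A (ext J) (\<phi> x) \<subseteq> ext (adjoin R J x)"
    by (rule A.adjoin_least[OF ext_mono[OF R.adjoin_subset[OF J x]]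
        image_in_ext[OF R.adjoin_ideal[OF J x] R.adjoin_mem[OF J x]] ext_ideal[OF R.adjoin_ideal[OF J x]]])
qed

text \<open>Clearing denominators turns the relation in A into
  \<open>t \<otimes> (x \<otimes> a) \<in> J\<close> with t outside P; there x is cancelled, and t
  becomes a unit again in A.\<close>

lemma ext_regular:
  assumes J: "ideal J R" and x: "x \<in> carrier R"
    and reg: "\<And>a. a \<in> carrier R \<Longrightarrow> x \<otimes>\<^bsub>R\<^esub> a \<in> J \<Longrightarrow> a \<in> J"
    and z: "z \<in> carrier A" "\<phi> x \<otimes>\<^bsub>A\<^esub> z \<in> ext J"
  shows "z \<in> ext J"
proof -
  obtain a s where a: "a \<in> carrier R" "s \<in> carrier R" "s \<notin> P" "z \<otimes>\<^bsub>A\<^esub> \<phi> s = \<phi> a" using fractions[OF z(1)] by blast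
  have c: "\<phi> x \<in> carrier A" "\<phi> s \<in> carrier A" using x a by auto
  have "\<phi> (x \<otimes>\<^bsub>R\<^esub> a) = (\<phi> x \<otimes>\<^bsub>A\<^esub> z) \<otimes>\<^bsub>A\<^esub> \<phi> s" using a x z c by (simp add: A.m_assoc)
  then have "\<phi> (x \<otimes>\<^bsub>R\<^esub> a) \<in> ext J" using ideal_multr[OF ext_ideal[OF J] z(2) c(2)] by simp
  then have "x \<otimes>\<^bsub>R\<^esub> a \<in> con (ext J)" using x a by (simp add: con_def)
  then have "x \<otimes>\<^bsub>R\<^esub> a \<in> saturation R P J" using con_ext[OF J] by simp
  then obtain t where t: "t \<in> carrier R" "t \<notin> P" "t \<otimes>\<^bsub>R\<^esub> (x \<otimes>\<^bsub>R\<^esub> a) \<in> J" by (auto simp: R.saturation_iff)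
  then have "t \<otimes>\<^bsub>R\<^esub> a \<in> J" using reg[of "t \<otimes>\<^bsub>R\<^esub> a"] x a by (simp add: R.m_lcomm)
  then have "a \<in> saturation R P J" using t a by (auto simp: R.saturation_iff)
  then have "\<phi> a \<in> ext J" using con_ext[OF J] by (auto simp: con_def)
  then show ?thesis using in_ideal_cancel[OF ext_ideal[OF J] z(1) a(2,3)] a(4) by simp
qed

text \<open>Every chain of primes of A contracts to a chain of primes inside P, whose top can be
  replaced by P.\<close>

lemma krull_dim_ge: "enat n \<le> krull_dim A \<longleftrightarrow> has_chain R n P"
proof
  assume "has_chain R n P"
  then have "has_chain A n (ext P)" by (rule has_chain_ext) simp
  then show "enat n \<le> krull_dim A" unfolding krull_dim_def has_chain_def by (intro Sup_upper) auto
next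
  assume n: "enat n \<le> krull_dim A"
  show "has_chain R n P"
  proof (rule ccontr)
    assume no: "\<not> has_chain R n P"
    then obtain m where m: "n = Suc m" using P by (cases n) (auto simp: has_chain_0)
    have "krull_dim A \<le> enat m"
      unfolding krull_dim_def
    proof (rule Sup_least)
      fix v assume "v \<in> {enat n |n. \<exists>c. prime_chain A n c}"
      then obtain k c where k: "v = enat k" "prime_chain A k c" by auto
      then have "has_chain A k (c k)" by (auto simp: has_chain_def)
      then have "has_chain R k (con (c k))" "primeideal (c k) A" using has_chain_con has_chain_prime by auto
      then have "has_chain R k P" using has_chain_mono con_prime P by blast
      then have "\<not> n \<le> k" using no has_chain_less by blast
      then show "v \<le> enat m" using k m by auto
    qed
    then have "enat (Suc m) \<le> enat m" using n m order_trans by blast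
    then show False by simp
  qed
qed

text \<open>An element of \<open>enat\<close> is determined by the natural numbers below it.\<close>

lemma krull_dim_eq: "krull_dim A = prime_height R P"
proof (rule antisym)
  have *: "x \<le> y" if "\<And>n. enat n \<le> x \<Longrightarrow> enat n \<le> y" for x y :: enat
    using that by (metis enat_ord_code(3) linorder_linear Suc_ile_eq less_le_not_le enat.exhaust)
  show "krull_dim A \<le> prime_height R P" "prime_height R P \<le> krull_dim A"
    using krull_dim_ge prime_height_ge[OF P] by (auto intro: *)
qed

text \<open>Every ideal of A is extended from its contraction, so the images of finitely many
  generators of the contraction generate it.\<close>

lemma noetherian:
  assumes "noetherian_ring R"
  shows "noetherian_cring A"
proof -
  have "\<exists>F\<subseteq>carrier A. finite F \<and> J = Idl\<^bsub>A\<^esub> F" if J: "ideal J A" for J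
  proof -
    obtain F where F: "F \<subseteq> carrier R" "finite F" "con J = Idl\<^bsub>R\<^esub> F"
      using noetherian_ring.finetely_gen[OF assms con_ideal[OF J]] by blast
    have Fc: "\<phi> ` F \<subseteq> carrier A" using F by auto
    have "ext (Idl\<^bsub>R\<^esub> F) \<subseteq> Idl\<^bsub>A\<^esub> (\<phi> ` F)"
      using ext_Idl[OF F(1) A.genideal_ideal[OF Fc]] A.genideal_self[OF Fc] by simp
    then have "J \<subseteq> Idl\<^bsub>A\<^esub> (\<phi> ` F)" using ext_con[OF J] F by simp
    moreover have "\<phi> ` F \<subseteq> J" using ext_Idl[OF F(1) J] ext_con[OF J] F(3) by simp
    then have "Idl\<^bsub>A\<^esub> (\<phi> ` F) \<subseteq> J" by (rule A.genideal_minimal[OF J])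
    ultimately show ?thesis using Fc F(2) by (intro exI[of _ "\<phi> ` F"]) auto
  qed
  then have "noetherian_ring A" by (rule A.noetherian_ringI)
  then show ?thesis by (simp add: noetherian_cring_def A.is_cring)
qed

end

section \<open>The ring of fractions as an instance of the localization\<close>

context cring
begin

context
  fixes P assumes P: "primeideal P R"
begin

abbreviation frac where "frac \<equiv> fraction R (carrier R - P)"
abbreviation loc where "loc \<equiv> localization_at_prime R P"

lemma denom: "\<one> \<in> carrier R - P" "s \<in> carrier R - P \<Longrightarrow> t \<in> carrier R - P \<Longrightarrow> s \<otimes> t \<in> carrier R - P"
  using prime_not_one[OF P] prime_mult[OF P] by auto

text \<open>Transitivity of equality of fractions. The witness for the composite relation is u w s:
  besides the two given witnesses it contains the middle denominator s.\<close>

lemma frac_subset: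
  assumes a: "a \<in> carrier R" and b: "b \<in> carrier R" and s: "s \<in> carrier R - P" and t: "t \<in> carrier R - P"
    and u: "u \<in> carrier R - P" and eq: "u \<otimes> (a \<otimes> t) = u \<otimes> (b \<otimes> s)"
  shows "frac a s \<subseteq> frac b t"
proof -
  have "\<exists>w\<in>carrier R - P. w \<otimes> (b \<otimes> v) = w \<otimes> (c \<otimes> t)"
    if c: "c \<in> carrier R" and v: "v \<in> carrier R - P" and w: "w \<in> carrier R - P" and e: "w \<otimes> (a \<otimes> v) = w \<otimes> (c \<otimes> s)" for c v w
  proof
    have m: "s \<in> carrier R" "t \<in> carrier R" "u \<in> carrier R" "v \<in> carrier R" "w \<in> carrier R" using s t u v w by auto
    have "(u \<otimes> w \<otimes> s) \<otimes> (b \<otimes> v) = (w \<otimes> v) \<otimes> (u \<otimes> (b \<otimes> s))" using m a b c by algebra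
    also have "\<dots> = (u \<otimes> t) \<otimes> (w \<otimes> (a \<otimes> v))" unfolding eq[symmetric] using m a b c by algebra
    also have "\<dots> = (u \<otimes> w \<otimes> s) \<otimes> (c \<otimes> t)" unfolding e using m a b c by algebra
    finally show "(u \<otimes> w \<otimes> s) \<otimes> (b \<otimes> v) = (u \<otimes> w \<otimes> s) \<otimes> (c \<otimes> t)" .
    show "u \<otimes> w \<otimes> s \<in> carrier R - P" by (intro denom u w s)
  qed
  then show ?thesis unfolding fraction_def by blast
qed

lemma frac_eqI:
  assumes "a \<in> carrier R" "b \<in> carrier R" "s \<in> carrier R - P" "t \<in> carrier R - P"
    "u \<in> carrier R - P" "u \<otimes> (a \<otimes> t) = u \<otimes> (b \<otimes> s)"
  shows "frac a s = frac b t"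
  using frac_subset[OF assms] frac_subset[OF assms(2,1,4,3,5) assms(6)[symmetric]] by simp

lemma frac_eqI1:
  assumes "a \<in> carrier R" "b \<in> carrier R" "s \<in> carrier R - P" "t \<in> carrier R - P" "a \<otimes> t = b \<otimes> s"
  shows "frac a s = frac b t"
  by (rule frac_eqI[OF assms(1-4) denom(1)]) (simp add: assms(5))

lemma frac_self: "a \<in> carrier R \<Longrightarrow> s \<in> carrier R - P \<Longrightarrow> (a, s) \<in> frac a s"
  using denom(1) by (auto simp: fraction_def)

text \<open>The product is a union over all representatives; the computation shows that all classes
  in the union coincide, and \<open>frac_self\<close> shows that the union is not empty.\<close>

lemma loc_mult:
  assumes a: "a \<in> carrier R" and b: "b \<in> carrier R" and s: "s \<in> carrier R - P" and t: "t \<in> carrier R - P"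
  shows "frac a s \<otimes>\<^bsub>loc\<^esub> frac b t = frac (a \<otimes> b) (s \<otimes> t)"
proof -
  have "frac (c \<otimes> e) (v \<otimes> w) = frac (a \<otimes> b) (s \<otimes> t)"
    if cv: "(c, v) \<in> frac a s" and ew: "(e, w) \<in> frac b t" for c v e w
  proof -
    obtain p where p: "c \<in> carrier R" "v \<in> carrier R - P" "p \<in> carrier R - P" "p \<otimes> (a \<otimes> v) = p \<otimes> (c \<otimes> s)"
      using cv by (auto simp: fraction_def)
    obtain q where q: "e \<in> carrier R" "w \<in> carrier R - P" "q \<in> carrier R - P" "q \<otimes> (b \<otimes> w) = q \<otimes> (e \<otimes> t)"
      using ew by (auto simp: fraction_def)
    have m: "s \<in> carrier R" "t \<in> carrier R" "v \<in> carrier R" "w \<in> carrier R" "p \<in> carrier R" "q \<in> carrier R"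
      using s t p q by auto
    have "(p \<otimes> q) \<otimes> ((c \<otimes> e) \<otimes> (s \<otimes> t)) = (p \<otimes> (c \<otimes> s)) \<otimes> (q \<otimes> (e \<otimes> t))" using m p(1) q(1) by algebra
    also have "\<dots> = (p \<otimes> q) \<otimes> ((a \<otimes> b) \<otimes> (v \<otimes> w))" unfolding p(4)[symmetric] q(4)[symmetric] using m a b by algebra
    finally show ?thesis using a b p q s t by (intro frac_eqI[of _ _ _ _ "p \<otimes> q"] denom) auto
  qed
  moreover have "frac a s \<otimes>\<^bsub>loc\<^esub> frac b t = (\<Union>(c, v)\<in>frac a s. \<Union>(e, w)\<in>frac b t. frac (c \<otimes> e) (v \<otimes> w))"
    by (simp add: localization_at_prime_def localization_def)
  ultimately show ?thesis using frac_self[OF a s] frac_self[OF b t] by fast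
qed

lemma loc_add:
  assumes a: "a \<in> carrier R" and b: "b \<in> carrier R" and s: "s \<in> carrier R - P" and t: "t \<in> carrier R - P"
  shows "frac a s \<oplus>\<^bsub>loc\<^esub> frac b t = frac (a \<otimes> t \<oplus> b \<otimes> s) (s \<otimes> t)"
proof -
  have "frac (c \<otimes> w \<oplus> e \<otimes> v) (v \<otimes> w) = frac (a \<otimes> t \<oplus> b \<otimes> s) (s \<otimes> t)"
    if cv: "(c, v) \<in> frac a s" and ew: "(e, w) \<in> frac b t" for c v e w
  proof -
    obtain p where p: "c \<in> carrier R" "v \<in> carrier R - P" "p \<in> carrier R - P" "p \<otimes> (a \<otimes> v) = p \<otimes> (c \<otimes> s)"
      using cv by (auto simp: fraction_def)
    obtain q where q: "e \<in> carrier R" "w \<in> carrier R - P" "q \<in> carrier R - P" "q \<otimes> (b \<otimes> w) = q \<otimes> (e \<otimes> t)"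
      using ew by (auto simp: fraction_def)
    have m: "s \<in> carrier R" "t \<in> carrier R" "v \<in> carrier R" "w \<in> carrier R" "p \<in> carrier R" "q \<in> carrier R"
      using s t p q by auto
    have "(p \<otimes> q) \<otimes> ((c \<otimes> w \<oplus> e \<otimes> v) \<otimes> (s \<otimes> t)) = (p \<otimes> (c \<otimes> s)) \<otimes> (q \<otimes> w \<otimes> t) \<oplus> (q \<otimes> (e \<otimes> t)) \<otimes> (p \<otimes> v \<otimes> s)"
      using m p(1) q(1) by algebra
    also have "\<dots> = (p \<otimes> q) \<otimes> ((a \<otimes> t \<oplus> b \<otimes> s) \<otimes> (v \<otimes> w))"
      unfolding p(4)[symmetric] q(4)[symmetric] using m a b by algebra
    finally show ?thesis using a b p q s t by (intro frac_eqI[of _ _ _ _ "p \<otimes> q"] denom) auto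
  qed
  moreover have "frac a s \<oplus>\<^bsub>loc\<^esub> frac b t = (\<Union>(c, v)\<in>frac a s. \<Union>(e, w)\<in>frac b t. frac (c \<otimes> w \<oplus> e \<otimes> v) (v \<otimes> w))"
    by (simp add: localization_at_prime_def localization_def)
  ultimately show ?thesis using frac_self[OF a s] frac_self[OF b t] by fast
qed

lemma loc_carrier: "x \<in> carrier loc \<longleftrightarrow> (\<exists>a s. a \<in> carrier R \<and> s \<in> carrier R - P \<and> x = frac a s)"
  by (auto simp: localization_at_prime_def localization_def)

lemma loc_carrierI: "a \<in> carrier R \<Longrightarrow> s \<in> carrier R - P \<Longrightarrow> frac a s \<in> carrier loc"
  unfolding loc_carrier by blast

lemma loc_one: "\<one>\<^bsub>loc\<^esub> = frac \<one> \<one>" and loc_zero: "\<zero>\<^bsub>loc\<^esub> = frac \<zero> \<one>"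
  by (simp_all add: localization_at_prime_def localization_def)

lemma loc_cring: "cring loc"
proof (rule cringI)
  have d: "s \<in> carrier R" if "s \<in> carrier R - P" for s using that by auto
  show "abelian_group loc"
  proof (rule abelian_groupI)
    fix x y assume "x \<in> carrier loc" "y \<in> carrier loc"
    then obtain a s b t where x: "a \<in> carrier R" "s \<in> carrier R - P" "x = frac a s"
      and y: "b \<in> carrier R" "t \<in> carrier R - P" "y = frac b t" unfolding loc_carrier by blast
    note ds = d[OF x(2)] d[OF y(2)]
    show "x \<oplus>\<^bsub>loc\<^esub> y \<in> carrier loc"
      unfolding x(3) y(3) loc_add[OF x(1) y(1) x(2) y(2)]
      by (rule loc_carrierI[OF _ denom(2)[OF x(2) y(2)]]) (use x(1) y(1) ds in simp)
    show "x \<oplus>\<^bsub>loc\<^esub> y = y \<oplus>\<^bsub>loc\<^esub> x"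
      unfolding x(3) y(3) loc_add[OF x(1) y(1) x(2) y(2)] loc_add[OF y(1) x(1) y(2) x(2)]
      using x(1) y(1) ds by (simp add: m_comm a_comm)
    fix z assume "z \<in> carrier loc"
    then obtain c u where z: "c \<in> carrier R" "u \<in> carrier R - P" "z = frac c u" unfolding loc_carrier by blast
    note ds' = ds d[OF z(2)]
    show "x \<oplus>\<^bsub>loc\<^esub> y \<oplus>\<^bsub>loc\<^esub> z = x \<oplus>\<^bsub>loc\<^esub> (y \<oplus>\<^bsub>loc\<^esub> z)"
    proof -
      have "x \<oplus>\<^bsub>loc\<^esub> y \<oplus>\<^bsub>loc\<^esub> z = frac ((a \<otimes> t \<oplus> b \<otimes> s) \<otimes> u \<oplus> c \<otimes> (s \<otimes> t)) (s \<otimes> t \<otimes> u)"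
        unfolding x(3) y(3) z(3) loc_add[OF x(1) y(1) x(2) y(2)]
        using x(1) y(1) z(1,2) ds' denom(2)[OF x(2) y(2)] by (intro loc_add) auto
      also have "\<dots> = frac (a \<otimes> (t \<otimes> u) \<oplus> (b \<otimes> u \<oplus> c \<otimes> t) \<otimes> s) (s \<otimes> (t \<otimes> u))"
      proof -
        have "(a \<otimes> t \<oplus> b \<otimes> s) \<otimes> u \<oplus> c \<otimes> (s \<otimes> t) = a \<otimes> (t \<otimes> u) \<oplus> (b \<otimes> u \<oplus> c \<otimes> t) \<otimes> s"
          using x(1) y(1) z(1) ds' by algebra
        then show ?thesis using ds' by (simp add: m_assoc)
      qed
      also have "\<dots> = x \<oplus>\<^bsub>loc\<^esub> (y \<oplus>\<^bsub>loc\<^esub> z)"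
        unfolding x(3) y(3) z(3) loc_add[OF y(1) z(1) y(2) z(2)]
        using x(1,2) y(1) z(1) ds' denom(2)[OF y(2) z(2)] by (intro loc_add[symmetric]) auto
      finally show ?thesis .
    qed
  next
    show "\<zero>\<^bsub>loc\<^esub> \<in> carrier loc" unfolding loc_zero by (rule loc_carrierI[OF zero_closed denom(1)])
  next
    fix x assume "x \<in> carrier loc"
    then obtain a s where x: "a \<in> carrier R" "s \<in> carrier R - P" "x = frac a s" unfolding loc_carrier by blast
    note ds = d[OF x(2)]
    show "\<zero>\<^bsub>loc\<^esub> \<oplus>\<^bsub>loc\<^esub> x = x"
      unfolding x(3) loc_zero loc_add[OF zero_closed x(1) denom(1) x(2)] using x(1) ds by simp
    have "frac (\<ominus> a) s \<oplus>\<^bsub>loc\<^esub> x = frac (\<ominus> a \<otimes> s \<oplus> a \<otimes> s) (s \<otimes> s)"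
      unfolding x(3) using x by (intro loc_add) auto
    also have "\<dots> = \<zero>\<^bsub>loc\<^esub>"
      unfolding loc_zero using x(1) ds denom(2)[OF x(2) x(2)] denom(1)
      by (intro frac_eqI1) (auto simp: l_minus l_neg)
    finally show "\<exists>y\<in>carrier loc. y \<oplus>\<^bsub>loc\<^esub> x = \<zero>\<^bsub>loc\<^esub>"
      using x by (intro bexI[of _ "frac (\<ominus> a) s"]) (auto intro: loc_carrierI)
  qed
  show "comm_monoid loc"
  proof (rule comm_monoidI)
    fix x y assume "x \<in> carrier loc" "y \<in> carrier loc"
    then obtain a s b t where x: "a \<in> carrier R" "s \<in> carrier R - P" "x = frac a s"
      and y: "b \<in> carrier R" "t \<in> carrier R - P" "y = frac b t" unfolding loc_carrier by blast
    note ds = d[OF x(2)] d[OF y(2)]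
    show "x \<otimes>\<^bsub>loc\<^esub> y \<in> carrier loc"
      unfolding x(3) y(3) loc_mult[OF x(1) y(1) x(2) y(2)]
      by (rule loc_carrierI[OF _ denom(2)[OF x(2) y(2)]]) (use x(1) y(1) ds in simp)
    show "x \<otimes>\<^bsub>loc\<^esub> y = y \<otimes>\<^bsub>loc\<^esub> x"
      unfolding x(3) y(3) loc_mult[OF x(1) y(1) x(2) y(2)] loc_mult[OF y(1) x(1) y(2) x(2)]
      using x(1) y(1) ds by (simp add: m_comm)
    fix z assume "z \<in> carrier loc"
    then obtain c u where z: "c \<in> carrier R" "u \<in> carrier R - P" "z = frac c u" unfolding loc_carrier by blast
    note ds' = ds d[OF z(2)]
    have "x \<otimes>\<^bsub>loc\<^esub> y \<otimes>\<^bsub>loc\<^esub> z = frac (a \<otimes> b \<otimes> c) (s \<otimes> t \<otimes> u)"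
      unfolding x(3) y(3) z(3) loc_mult[OF x(1) y(1) x(2) y(2)]
      using x(1) y(1) z(1,2) denom(2)[OF x(2) y(2)] by (intro loc_mult) auto
    also have "\<dots> = frac (a \<otimes> (b \<otimes> c)) (s \<otimes> (t \<otimes> u))" using x(1) y(1) z(1) ds' by (simp add: m_assoc)
    also have "\<dots> = x \<otimes>\<^bsub>loc\<^esub> (y \<otimes>\<^bsub>loc\<^esub> z)"
      unfolding x(3) y(3) z(3) loc_mult[OF y(1) z(1) y(2) z(2)]
      using x(1,2) y(1) z(1) denom(2)[OF y(2) z(2)] by (intro loc_mult[symmetric]) auto
    finally show "x \<otimes>\<^bsub>loc\<^esub> y \<otimes>\<^bsub>loc\<^esub> z = x \<otimes>\<^bsub>loc\<^esub> (y \<otimes>\<^bsub>loc\<^esub> z)" .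
  next
    show "\<one>\<^bsub>loc\<^esub> \<in> carrier loc" unfolding loc_one by (rule loc_carrierI[OF one_closed denom(1)])
  next
    fix x assume "x \<in> carrier loc"
    then obtain a s where x: "a \<in> carrier R" "s \<in> carrier R - P" "x = frac a s" unfolding loc_carrier by blast
    show "\<one>\<^bsub>loc\<^esub> \<otimes>\<^bsub>loc\<^esub> x = x"
      unfolding x(3) loc_one loc_mult[OF one_closed x(1) denom(1) x(2)] using x(1) d[OF x(2)] by simp
  qed
  fix x y z assume "x \<in> carrier loc" "y \<in> carrier loc" "z \<in> carrier loc"
  then obtain a s b t c u where x: "a \<in> carrier R" "s \<in> carrier R - P" "x = frac a s"
    and y: "b \<in> carrier R" "t \<in> carrier R - P" "y = frac b t"
    and z: "c \<in> carrier R" "u \<in> carrier R - P" "z = frac c u" unfolding loc_carrier by blast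
  note ds = d[OF x(2)] d[OF y(2)] d[OF z(2)]
  have "(x \<oplus>\<^bsub>loc\<^esub> y) \<otimes>\<^bsub>loc\<^esub> z = frac ((a \<otimes> t \<oplus> b \<otimes> s) \<otimes> c) (s \<otimes> t \<otimes> u)"
    unfolding x(3) y(3) z(3) loc_add[OF x(1) y(1) x(2) y(2)]
    using x(1) y(1) z(1,2) ds denom(2)[OF x(2) y(2)] by (intro loc_mult) auto
  \<comment> \<open>Adding the two products brings a second factor u into the denominator, so
    numerators and denominators differ and only the fractions agree.\<close>
  also have "\<dots> = frac ((a \<otimes> c) \<otimes> (t \<otimes> u) \<oplus> (b \<otimes> c) \<otimes> (s \<otimes> u)) ((s \<otimes> u) \<otimes> (t \<otimes> u))"
  proof (rule frac_eqI1)
    show "(a \<otimes> t \<oplus> b \<otimes> s) \<otimes> c \<otimes> ((s \<otimes> u) \<otimes> (t \<otimes> u)) =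
        ((a \<otimes> c) \<otimes> (t \<otimes> u) \<oplus> (b \<otimes> c) \<otimes> (s \<otimes> u)) \<otimes> (s \<otimes> t \<otimes> u)"
      using x(1) y(1) z(1) ds by algebra
    show "s \<otimes> t \<otimes> u \<in> carrier R - P" by (rule denom(2)[OF denom(2)[OF x(2) y(2)] z(2)])
    show "s \<otimes> u \<otimes> (t \<otimes> u) \<in> carrier R - P" by (rule denom(2)[OF denom(2)[OF x(2) z(2)] denom(2)[OF y(2) z(2)]])
    show "(a \<otimes> t \<oplus> b \<otimes> s) \<otimes> c \<in> carrier R" "a \<otimes> c \<otimes> (t \<otimes> u) \<oplus> b \<otimes> c \<otimes> (s \<otimes> u) \<in> carrier R"
      using x(1) y(1) z(1) ds by simp_all
  qed
  also have "\<dots> = x \<otimes>\<^bsub>loc\<^esub> z \<oplus>\<^bsub>loc\<^esub> y \<otimes>\<^bsub>loc\<^esub> z"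
    unfolding x(3) y(3) z(3) loc_mult[OF x(1) z(1) x(2) z(2)] loc_mult[OF y(1) z(1) y(2) z(2)]
    using x(1) y(1) z(1) denom(2)[OF x(2) z(2)] denom(2)[OF y(2) z(2)] by (intro loc_add[symmetric]) auto
  finally show "(x \<oplus>\<^bsub>loc\<^esub> y) \<otimes>\<^bsub>loc\<^esub> z = x \<otimes>\<^bsub>loc\<^esub> z \<oplus>\<^bsub>loc\<^esub> y \<otimes>\<^bsub>loc\<^esub> z" .
qed

lemma loc_prime_localization: "prime_localization R loc (\<lambda>a. frac a \<one>) P"
proof -
  interpret A: cring loc by (rule loc_cring)
  note o = denom(1)
  have "(\<lambda>a. frac a \<one>) \<in> ring_hom R loc"
    using o by (intro ring_hom_memI) (simp_all add: loc_carrierI loc_mult loc_add loc_one)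
  then interpret ring_hom_cring R loc "\<lambda>a. frac a \<one>"
    by (rule RingHom.ring_hom_cringI[OF RingHom.ring_hom_ringI2[OF ring_axioms A.ring_axioms] is_cring loc_cring])
  show ?thesis
  proof (intro prime_localization.intro prime_localization_axioms.intro is_cring loc_cring P)
    show "ring_hom_cring R loc (\<lambda>a. frac a \<one>)" by (rule ring_hom_cring_axioms)
  next
    fix s assume s: "s \<in> carrier R" "s \<notin> P"
    then have s': "s \<in> carrier R - P" by simp
    have "frac s \<one> \<otimes>\<^bsub>loc\<^esub> frac \<one> s = frac (s \<otimes> \<one>) (\<one> \<otimes> s)" by (rule loc_mult[OF s(1) one_closed o s'])
    also have "\<dots> = \<one>\<^bsub>loc\<^esub>" unfolding loc_one using s s' o by (intro frac_eqI1) auto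
    finally have e: "frac s \<one> \<otimes>\<^bsub>loc\<^esub> frac \<one> s = \<one>\<^bsub>loc\<^esub>" .
    have c: "frac s \<one> \<in> carrier loc" "frac \<one> s \<in> carrier loc" using s s' o by (simp_all add: loc_carrierI)
    show "frac s \<one> \<in> Units loc" using e c A.m_comm[OF c] unfolding Units_def by auto
  next
    fix z assume "z \<in> carrier loc"
    then obtain a s where z: "a \<in> carrier R" "s \<in> carrier R - P" "z = frac a s" unfolding loc_carrier by blast
    have "z \<otimes>\<^bsub>loc\<^esub> frac s \<one> = frac (a \<otimes> s) (s \<otimes> \<one>)" unfolding z(3) using z o by (intro loc_mult) auto
    also have "\<dots> = frac a \<one>" using z o by (intro frac_eqI1) auto
    finally show "\<exists>a s. a \<in> carrier R \<and> s \<in> carrier R \<and> s \<notin> P \<and> z \<otimes>\<^bsub>loc\<^esub> frac s \<one> = frac a \<one>" using z by blast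
  next
    fix a assume a: "a \<in> carrier R" and "frac a \<one> = \<zero>\<^bsub>loc\<^esub>"
    then have "(a, \<one>) \<in> frac \<zero> \<one>" using frac_self[OF a o] by (metis loc_zero)
    then obtain u where "u \<in> carrier R - P" "u \<otimes> (\<zero> \<otimes> \<one>) = u \<otimes> (a \<otimes> \<one>)" by (auto simp: fraction_def)
    then show "\<exists>s. s \<in> carrier R \<and> s \<notin> P \<and> s \<otimes> a = \<zero>" using a by (intro exI[of _ u]) auto
  qed
qed

end

end

section \<open>Homomorphisms from free modules\<close>

lemma module_homD:
  assumes "h \<in> module_hom R M N"
  shows "x \<in> carrier M \<Longrightarrow> h x \<in> carrier N"
    and "x \<in> carrier M \<Longrightarrow> y \<in> carrier M \<Longrightarrow> h (x \<oplus>\<^bsub>M\<^esub> y) = h x \<oplus>\<^bsub>N\<^esub> h y"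
    and "r \<in> carrier R \<Longrightarrow> x \<in> carrier M \<Longrightarrow> h (r \<odot>\<^bsub>M\<^esub> x) = r \<odot>\<^bsub>N\<^esub> h x"
  using assms by (auto simp: module_hom_def)

lemma module_homI:
  assumes "\<And>x. x \<in> carrier M \<Longrightarrow> h x \<in> carrier N"
    and "\<And>x y. x \<in> carrier M \<Longrightarrow> y \<in> carrier M \<Longrightarrow> h (x \<oplus>\<^bsub>M\<^esub> y) = h x \<oplus>\<^bsub>N\<^esub> h y"
    and "\<And>r x. r \<in> carrier R \<Longrightarrow> x \<in> carrier M \<Longrightarrow> h (r \<odot>\<^bsub>M\<^esub> x) = r \<odot>\<^bsub>N\<^esub> h x"
  shows "h \<in> module_hom R M N"
  using assms by (auto simp: module_hom_def)

lemma module_hom_zero: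
  assumes h: "h \<in> module_hom R M N" and M: "module R M" and N: "module R N"
  shows "h \<zero>\<^bsub>M\<^esub> = \<zero>\<^bsub>N\<^esub>"
proof -
  interpret M: module R M by fact
  interpret N: module R N by fact
  have "h (\<zero>\<^bsub>R\<^esub> \<odot>\<^bsub>M\<^esub> \<zero>\<^bsub>M\<^esub>) = \<zero>\<^bsub>R\<^esub> \<odot>\<^bsub>N\<^esub> h \<zero>\<^bsub>M\<^esub>" by (rule module_homD(3)[OF h]) auto
  moreover have "h \<zero>\<^bsub>M\<^esub> \<in> carrier N" by (rule module_homD(1)[OF h]) auto
  ultimately show ?thesis by simp
qed

lemma module_hom_comp:
  assumes "g \<in> module_hom R M N" "h \<in> module_hom R N K"
  shows "(\<lambda>x. h (g x)) \<in> module_hom R M K"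
  using module_homD[OF assms(1)] module_homD[OF assms(2)] by (intro module_homI) auto

lemma module_hom_sum:
  assumes g: "g \<in> module_hom R M N" and h: "h \<in> module_hom R M N" and M: "module R M" and N: "module R N"
  shows "(\<lambda>x. g x \<oplus>\<^bsub>N\<^esub> h x) \<in> module_hom R M N"
proof -
  interpret M: module R M by fact
  interpret N: module R N by fact
  note G = module_homD[OF g] and H = module_homD[OF h]
  show ?thesis
  proof (rule module_homI)
    fix x y assume x: "x \<in> carrier M" and y: "y \<in> carrier M"
    show "g (x \<oplus>\<^bsub>M\<^esub> y) \<oplus>\<^bsub>N\<^esub> h (x \<oplus>\<^bsub>M\<^esub> y) = g x \<oplus>\<^bsub>N\<^esub> h x \<oplus>\<^bsub>N\<^esub> (g y \<oplus>\<^bsub>N\<^esub> h y)"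
      using G(1,2) H(1,2) x y by (simp add: N.a_ac)
  qed (use G H in \<open>auto simp: N.smult_r_distr\<close>)
qed

lemma module_hom_scale:
  assumes h: "h \<in> module_hom R M N" and M: "module R M" and N: "module R N" and r: "r \<in> carrier R"
  shows "(\<lambda>x. r \<odot>\<^bsub>N\<^esub> h x) \<in> module_hom R M N"
proof -
  interpret M: module R M by fact
  interpret N: module R N by fact
  note H = module_homD[OF h]
  show ?thesis
  proof (rule module_homI)
    fix s x assume s: "s \<in> carrier R" and x: "x \<in> carrier M"
    have "r \<odot>\<^bsub>N\<^esub> (s \<odot>\<^bsub>N\<^esub> h x) = s \<odot>\<^bsub>N\<^esub> (r \<odot>\<^bsub>N\<^esub> h x)"
      using r s H(1)[OF x] by (simp add: N.smult_assoc1[symmetric] M.m_comm)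
    then show "r \<odot>\<^bsub>N\<^esub> h (s \<odot>\<^bsub>M\<^esub> x) = s \<odot>\<^bsub>N\<^esub> (r \<odot>\<^bsub>N\<^esub> h x)" using H(3)[OF s x] by simp
  qed (use H r in \<open>auto simp: N.smult_r_distr\<close>)
qed

lemma self_module_simps [simp]:
  "carrier (self_module R) = carrier R" "\<zero>\<^bsub>self_module R\<^esub> = \<zero>\<^bsub>R\<^esub>"
  "x \<oplus>\<^bsub>self_module R\<^esub> y = x \<oplus>\<^bsub>R\<^esub> y" "r \<odot>\<^bsub>self_module R\<^esub> x = r \<otimes>\<^bsub>R\<^esub> x"
  by (simp_all add: self_module_def)

definition single :: "('a, 'r) ring_scheme \<Rightarrow> 'b \<Rightarrow> 'b \<Rightarrow> 'a"
  where "single R b = (\<lambda>c. if c = b then \<one>\<^bsub>R\<^esub> else \<zero>\<^bsub>R\<^esub>)"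

context cring
begin

lemma self_module: "module R (self_module R)"
proof (rule moduleI[OF is_cring])
  show "abelian_group (self_module R)"
    by (rule abelian_groupI) (auto simp: a_ac intro: bexI[of _ "\<ominus> _"] l_neg)
qed (auto simp: l_distr r_distr m_assoc)

lemma free_module: "module R (free_module R B)"
  by (rule free_module_module[OF is_cring])

lemma single_closed: "b \<in> B \<Longrightarrow> single R b \<in> carrier (free_module R B)"
  by (auto simp: single_def free_module_simps intro: finite_subset[of _ "{b}"])

lemma free_module_induct [consumes 1, case_names zero add scale]:
  assumes f: "f \<in> carrier (free_module R B)"
    and zero: "Pr \<zero>\<^bsub>free_module R B\<^esub>"
    and add: "\<And>f g. f \<in> carrier (free_module R B) \<Longrightarrow> g \<in> carrier (free_module R B) \<Longrightarrow> Pr f \<Longrightarrow> Pr g \<Longrightarrow>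
      Pr (f \<oplus>\<^bsub>free_module R B\<^esub> g)"
    and scale: "\<And>r b. r \<in> carrier R \<Longrightarrow> b \<in> B \<Longrightarrow> Pr (r \<odot>\<^bsub>free_module R B\<^esub> single R b)"
  shows "Pr f"
proof -
  interpret F: module R "free_module R B" by (rule free_module)
  have "finite {b. f b \<noteq> \<zero>}" using f by (auto simp: free_module_simps)
  then show ?thesis using f
  proof (induction "{b. f b \<noteq> \<zero>}" arbitrary: f rule: finite_induct)
    case empty
    then have "f = \<zero>\<^bsub>free_module R B\<^esub>" by (auto simp: free_module_simps(2))
    then show ?case using zero by simp
  next
    case (insert b S)
    let ?g = "f(b := \<zero>)"
    have fb: "f b \<in> carrier R" by (rule free_module_in_carrier[OF is_cring insert.prems])
    have "f b \<noteq> \<zero>" using insert.hyps(4) by auto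
    then have b: "b \<in> B" using insert.prems by (auto simp: free_module_simps)
    have S: "S = {c. ?g c \<noteq> \<zero>}" using insert.hyps(2,4) by auto
    have g: "?g \<in> carrier (free_module R B)"
      using insert.prems S insert.hyps(1) by (simp add: free_module_simps)
    have "f = ?g \<oplus>\<^bsub>free_module R B\<^esub> (f b \<odot>\<^bsub>free_module R B\<^esub> single R b)"
      using free_module_in_carrier[OF is_cring insert.prems] fb
      by (auto simp: free_module_simps(3,4) single_def)
    moreover have "Pr (?g \<oplus>\<^bsub>free_module R B\<^esub> (f b \<odot>\<^bsub>free_module R B\<^esub> single R b))"
      using insert.hyps(3)[OF S g] scale[OF fb b] single_closed[OF b] fb g by (intro add) auto
    ultimately show ?case by (rule ssubst[of f _ Pr])
  qed
qed

lemma module_hom_eq: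
  assumes g: "g \<in> module_hom R (free_module R B) M" and h: "h \<in> module_hom R (free_module R B) M"
    and M: "module R M" and eq: "\<And>b. b \<in> B \<Longrightarrow> g (single R b) = h (single R b)"
    and f: "f \<in> carrier (free_module R B)"
  shows "g f = h f"
  using f
proof (induction f rule: free_module_induct)
  case zero
  then show ?case using module_hom_zero[OF g free_module M] module_hom_zero[OF h free_module M] by simp
next
  case (add f f')
  then show ?case using module_homD(2)[OF g] module_homD(2)[OF h] by simp
next
  case (scale r b)
  show ?case
    using module_homD(3)[OF g scale(1) single_closed[OF scale(2)]] module_homD(3)[OF h scale(1) single_closed[OF scale(2)]]
      eq[OF scale(2)] by simp
qed

lemma linear_extension_single:
  assumes M: "module R M" and v: "v \<in> B \<rightarrow> carrier M" and b: "b \<in> B"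
  shows "linear_extension R M v (single R b) = v b"
proof -
  interpret M: module R M by (rule M)
  have x: "v b \<in> carrier M" using b v by auto
  show ?thesis
  proof (cases "\<one> = \<zero>")
    case False
    then have "{c. single R b c \<noteq> \<zero>} = {b}" by (auto simp: single_def)
    then show ?thesis using x by (simp add: linear_extension_def single_def M.finsum_insert)
  next
    case True
    then have "v b = \<zero>\<^bsub>M\<^esub>" using M.smult_one[OF x] M.smult_l_null[OF x] by simp
    moreover have "{c. single R b c \<noteq> \<zero>} = {}" using True by (auto simp: single_def)
    ultimately show ?thesis by (simp add: linear_extension_def)
  qed
qed

text \<open>The universal property of free modules combined with choice: a condition solvable at
  every basis vector is solved there by one homomorphism. The projectivity of the resolution enters
  through this lemma.\<close>

lemma free_module_hom_exists:
  assumes M: "module R M" and "\<And>b. b \<in> B \<Longrightarrow> \<exists>y\<in>carrier M. Pr b y"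
  obtains h where "h \<in> module_hom R (free_module R B) M" "\<And>b. b \<in> B \<Longrightarrow> Pr b (h (single R b))"
proof -
  obtain v where v: "\<And>b. b \<in> B \<Longrightarrow> v b \<in> carrier M \<and> Pr b (v b)" using assms(2) by metis
  then have v': "v \<in> B \<rightarrow> carrier M" by auto
  show ?thesis
    by (rule that[OF linear_extension_hom[OF M v']]) (use linear_extension_single[OF M v'] v in auto)
qed

abbreviation lin where "lin B \<equiv> module_hom R (free_module R B) (self_module R)"

lemma linD:
  assumes "\<phi> \<in> lin B"
  shows "f \<in> carrier (free_module R B) \<Longrightarrow> \<phi> f \<in> carrier R"
    and "f \<in> carrier (free_module R B) \<Longrightarrow> g \<in> carrier (free_module R B) \<Longrightarrow>
      \<phi> (f \<oplus>\<^bsub>free_module R B\<^esub> g) = \<phi> f \<oplus> \<phi> g"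
    and "r \<in> carrier R \<Longrightarrow> f \<in> carrier (free_module R B) \<Longrightarrow> \<phi> (r \<odot>\<^bsub>free_module R B\<^esub> f) = r \<otimes> \<phi> f"
    and "\<phi> \<zero>\<^bsub>free_module R B\<^esub> = \<zero>"
  using module_homD[OF assms] module_hom_zero[OF assms free_module self_module] by simp_all

lemma lin_add: "\<phi> \<in> lin B \<Longrightarrow> \<psi> \<in> lin B \<Longrightarrow> (\<lambda>f. \<phi> f \<oplus> \<psi> f) \<in> lin B"
  using module_hom_sum[OF _ _ free_module self_module, of \<phi> B \<psi>] by simp

lemma lin_scale: "\<phi> \<in> lin B \<Longrightarrow> r \<in> carrier R \<Longrightarrow> (\<lambda>f. r \<otimes> \<phi> f) \<in> lin B"
  using module_hom_scale[OF _ free_module self_module, of \<phi> B r] by simp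

lemma lin_diff:
  assumes "\<phi> \<in> lin B" "\<psi> \<in> lin B"
  shows "(\<lambda>f. \<phi> f \<ominus> \<psi> f) \<in> lin B"
proof (rule module_homI)
  note a = linD[OF assms(1)] and b = linD[OF assms(2)]
  fix f assume f: "f \<in> carrier (free_module R B)"
  show "\<phi> f \<ominus> \<psi> f \<in> carrier (self_module R)" using a(1)[OF f] b(1)[OF f] by simp
  note c = a(1)[OF f] b(1)[OF f]
  show "\<phi> (f \<oplus>\<^bsub>free_module R B\<^esub> g) \<ominus> \<psi> (f \<oplus>\<^bsub>free_module R B\<^esub> g) =
      (\<phi> f \<ominus> \<psi> f) \<oplus>\<^bsub>self_module R\<^esub> (\<phi> g \<ominus> \<psi> g)" if g: "g \<in> carrier (free_module R B)" for g
    unfolding a(2)[OF f g] b(2)[OF f g] self_module_simps using c a(1)[OF g] b(1)[OF g] by algebra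
  show "\<phi> (r \<odot>\<^bsub>free_module R B\<^esub> f) \<ominus> \<psi> (r \<odot>\<^bsub>free_module R B\<^esub> f) = r \<odot>\<^bsub>self_module R\<^esub> (\<phi> f \<ominus> \<psi> f)"
    if r: "r \<in> carrier R" for r
    unfolding a(3)[OF r f] b(3)[OF r f] self_module_simps using c r by algebra
qed

text \<open>Multiplication by x maps R onto (I + xR)/I, so a map from a free module into I + xR
  lifts along it modulo I; the lift \<theta> is chosen on basis vectors.\<close>

lemma lin_adjoin:
  assumes \<phi>: "\<phi> \<in> lin B" and I: "ideal I R" and x: "x \<in> carrier R"
    and J: "\<And>f. f \<in> carrier (free_module R B) \<Longrightarrow> \<phi> f \<in> adjoin R I x"
  obtains \<theta> where "\<theta> \<in> lin B" "\<And>f. f \<in> carrier (free_module R B) \<Longrightarrow> \<phi> f \<ominus> x \<otimes> \<theta> f \<in> I"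
proof -
  have "\<exists>r\<in>carrier (self_module R). \<phi> (single R b) \<ominus> x \<otimes> r \<in> I" if b: "b \<in> B" for b
  proof -
    obtain i r where ir: "i \<in> I" "r \<in> carrier R" "\<phi> (single R b) = i \<oplus> x \<otimes> r"
      using J[OF single_closed[OF b]] by (auto simp: adjoin_def)
    then have "\<phi> (single R b) \<ominus> x \<otimes> r = i"
      using ideal_carr[OF I ir(1)] x by (simp add: minus_eq a_assoc r_neg)
    then show ?thesis using ir(1,2) by (intro bexI[of _ r]) auto
  qed
  then obtain \<theta> where \<theta>: "\<theta> \<in> lin B" "\<And>b. b \<in> B \<Longrightarrow> \<phi> (single R b) \<ominus> x \<otimes> \<theta> (single R b) \<in> I"
    using free_module_hom_exists[OF self_module, of B "\<lambda>b r. \<phi> (single R b) \<ominus> x \<otimes> r \<in> I"] by blast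
  have D: "(\<lambda>f. \<phi> f \<ominus> x \<otimes> \<theta> f) \<in> lin B" using \<phi> \<theta>(1) x by (intro lin_diff lin_scale)
  have "\<phi> f \<ominus> x \<otimes> \<theta> f \<in> I" if "f \<in> carrier (free_module R B)" for f
    using that
  proof (induction f rule: free_module_induct)
    case zero
    show ?case using linD(4)[OF D] ideal_zero[OF I] by simp
  next
    case (add f g)
    then show ?case using linD(2)[OF D add(1,2)] ideal_add[OF I] by simp
  next
    case (scale r b)
    then show ?case using linD(3)[OF D scale(1) single_closed[OF scale(2)]] ideal_mult[OF I \<theta>(2)[OF scale(2)] scale(1)] by simp
  qed
  then show ?thesis using \<theta>(1) that by blast
qed

section \<open>Quotient modules and their associated primes\<close>

lemma
  assumes I: "ideal I R"
  shows quotient_module_carrier: "c \<in> carrier (quotient_module R I) \<longleftrightarrow> (\<exists>a\<in>carrier R. c = I +> a)"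
    and quotient_module_zero: "\<zero>\<^bsub>quotient_module R I\<^esub> = I"
    and quotient_module_add: "a \<in> carrier R \<Longrightarrow> b \<in> carrier R \<Longrightarrow>
      (I +> a) \<oplus>\<^bsub>quotient_module R I\<^esub> (I +> b) = I +> (a \<oplus> b)"
    and quotient_module_smult: "a \<in> carrier R \<Longrightarrow> b \<in> carrier R \<Longrightarrow>
      a \<odot>\<^bsub>quotient_module R I\<^esub> (I +> b) = I +> (a \<otimes> b)"
    and quotient_module_eq_zero: "a \<in> carrier R \<Longrightarrow> I +> a = I \<longleftrightarrow> a \<in> I"
proof -
  interpret ideal I R by fact
  show "c \<in> carrier (quotient_module R I) \<longleftrightarrow> (\<exists>a\<in>carrier R. c = I +> a)"
    by (auto simp: quotient_module_def FactRing_simps)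
  show "\<zero>\<^bsub>quotient_module R I\<^esub> = I" by (simp add: quotient_module_def FactRing_def)
  show "a \<in> carrier R \<Longrightarrow> b \<in> carrier R \<Longrightarrow> (I +> a) \<oplus>\<^bsub>quotient_module R I\<^esub> (I +> b) = I +> (a \<oplus> b)"
    by (simp add: quotient_module_def FactRing_def a_rcos_sum)
  show "a \<in> carrier R \<Longrightarrow> b \<in> carrier R \<Longrightarrow> a \<odot>\<^bsub>quotient_module R I\<^esub> (I +> b) = I +> (a \<otimes> b)"
    by (simp add: quotient_module_def FactRing_def rcoset_mult_add)
  show "a \<in> carrier R \<Longrightarrow> I +> a = I \<longleftrightarrow> a \<in> I"
    using a_rcos_zero[OF I] rcos_const_imp_mem by blast
qed

lemma quotient_module:
  assumes I: "ideal I R"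
  shows "module R (quotient_module R I)"
proof -
  let ?Q = "quotient_module R I"
  note qc = quotient_module_carrier[OF I] and qa = quotient_module_add[OF I] and qs = quotient_module_smult[OF I]
  have qz: "\<zero>\<^bsub>?Q\<^esub> = I +> \<zero>"
    using quotient_module_zero[OF I] quotient_module_eq_zero[OF I zero_closed] ideal_zero[OF I] by metis
  have ex: "\<exists>a. a \<in> carrier R \<and> c = I +> a" if "c \<in> carrier ?Q" for c using that qc by auto
  have ci: "I +> a \<in> carrier ?Q" if "a \<in> carrier R" for a using that qc by auto
  show ?thesis
  proof (rule moduleI[OF is_cring])
    show "abelian_group ?Q"
    proof (rule abelian_groupI)
      show "\<zero>\<^bsub>?Q\<^esub> \<in> carrier ?Q" unfolding qz by (rule ci) simp
    next
      fix x y assume "x \<in> carrier ?Q" "y \<in> carrier ?Q"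
      then obtain a b where ab: "a \<in> carrier R" "b \<in> carrier R" and e: "x = I +> a" "y = I +> b" using ex by metis
      show "x \<oplus>\<^bsub>?Q\<^esub> y \<in> carrier ?Q" unfolding e qa[OF ab] by (rule ci) (use ab in simp)
      show "x \<oplus>\<^bsub>?Q\<^esub> y = y \<oplus>\<^bsub>?Q\<^esub> x" unfolding e qa[OF ab] qa[OF ab(2,1)] using ab by (simp add: a_comm)
      fix z assume "z \<in> carrier ?Q"
      then obtain c where c: "c \<in> carrier R" and ez: "z = I +> c" using ex by metis
      show "x \<oplus>\<^bsub>?Q\<^esub> y \<oplus>\<^bsub>?Q\<^esub> z = x \<oplus>\<^bsub>?Q\<^esub> (y \<oplus>\<^bsub>?Q\<^esub> z)"
        unfolding e ez using ab c by (simp add: qa a_assoc)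
    next
      fix x assume "x \<in> carrier ?Q"
      then obtain a where a: "a \<in> carrier R" and e: "x = I +> a" using ex by metis
      show "\<zero>\<^bsub>?Q\<^esub> \<oplus>\<^bsub>?Q\<^esub> x = x" unfolding e qz using a by (simp add: qa)
      show "\<exists>y\<in>carrier ?Q. y \<oplus>\<^bsub>?Q\<^esub> x = \<zero>\<^bsub>?Q\<^esub>"
        unfolding e qz using a by (intro bexI[of _ "I +> (\<ominus> a)"]) (auto simp: qa l_neg ci)
    qed
  next
    fix r x assume r: "r \<in> carrier R" and "x \<in> carrier ?Q"
    then obtain a where a: "a \<in> carrier R" and e: "x = I +> a" using ex by metis
    show "r \<odot>\<^bsub>?Q\<^esub> x \<in> carrier ?Q" unfolding e qs[OF r a] by (rule ci) (use r a in simp)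
  next
    fix r x y assume r: "r \<in> carrier R" and "x \<in> carrier ?Q" "y \<in> carrier ?Q"
    then obtain a b where ab: "a \<in> carrier R" "b \<in> carrier R" and e: "x = I +> a" "y = I +> b" using ex by metis
    show "r \<odot>\<^bsub>?Q\<^esub> (x \<oplus>\<^bsub>?Q\<^esub> y) = r \<odot>\<^bsub>?Q\<^esub> x \<oplus>\<^bsub>?Q\<^esub> r \<odot>\<^bsub>?Q\<^esub> y"
      unfolding e using ab r by (simp add: qa qs r_distr)
  next
    fix r s x assume r: "r \<in> carrier R" "s \<in> carrier R" and "x \<in> carrier ?Q"
    then obtain a where a: "a \<in> carrier R" and e: "x = I +> a" using ex by metis
    show "(r \<oplus> s) \<odot>\<^bsub>?Q\<^esub> x = r \<odot>\<^bsub>?Q\<^esub> x \<oplus>\<^bsub>?Q\<^esub> s \<odot>\<^bsub>?Q\<^esub> x"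
      unfolding e using a r by (simp add: qa qs l_distr)
    show "r \<otimes> s \<odot>\<^bsub>?Q\<^esub> x = r \<odot>\<^bsub>?Q\<^esub> (s \<odot>\<^bsub>?Q\<^esub> x)"
      unfolding e using a r by (simp add: qs m_assoc)
  next
    fix x assume "x \<in> carrier ?Q"
    then obtain a where a: "a \<in> carrier R" and e: "x = I +> a" using ex by metis
    show "\<one> \<odot>\<^bsub>?Q\<^esub> x = x" unfolding e using a by (simp add: qs)
  qed
qed

lemma associated_primes_quotient:
  assumes I: "ideal I R"
  shows "associated_primes R (quotient_module R I) = ass_primes R I"
proof -
  have "{r \<in> carrier R. r \<odot>\<^bsub>quotient_module R I\<^esub> (I +> y) = \<zero>\<^bsub>quotient_module R I\<^esub>} = colon R I y"
    if "y \<in> carrier R" for y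
  proof -
    have "r \<odot>\<^bsub>quotient_module R I\<^esub> (I +> y) = \<zero>\<^bsub>quotient_module R I\<^esub> \<longleftrightarrow> r \<otimes> y \<in> I" if r: "r \<in> carrier R" for r
      unfolding quotient_module_smult[OF I r \<open>y \<in> carrier R\<close>] quotient_module_zero[OF I]
      by (rule quotient_module_eq_zero[OF I]) (use r \<open>y \<in> carrier R\<close> in simp)
    then show ?thesis by (auto simp: colon_def)
  qed
  then show ?thesis
    unfolding associated_primes_def ass_primes_def Bex_def quotient_module_carrier[OF I] by auto
qed

end

section \<open>Vanishing of Ext\<close>

text \<open>The resolution of R/m is left arbitrary, since the one inside \<open>Ext\<close> is
  picked by choice and nothing more is known about it.\<close>

locale residue_resolution = cring +
  fixes m and B :: "nat \<Rightarrow> 'c set" and d e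
  assumes m: "ideal m R"
    and res: "free_resolution R (quotient_module R m) B d e"
begin

abbreviation Fr where "Fr n \<equiv> free_module R (B n)"

lemma
  shows e: "e \<in> module_hom R (Fr 0) (quotient_module R m)"
    and e_surj: "e ` carrier (Fr 0) = carrier (quotient_module R m)"
    and d: "d n \<in> module_hom R (Fr (Suc n)) (Fr n)"
    and exact_0: "d 0 ` carrier (Fr 1) = {f \<in> carrier (Fr 0). e f = \<zero>\<^bsub>quotient_module R m\<^esub>}"
    and exact_Suc: "d (Suc n) ` carrier (Fr (Suc (Suc n))) = {f \<in> carrier (Fr (Suc n)). d n f = \<zero>\<^bsub>Fr n\<^esub>}"
  using res by (auto simp: free_resolution_def free_module_simps(2))

lemma d_closed: "f \<in> carrier (Fr (Suc n)) \<Longrightarrow> d n f \<in> carrier (Fr n)"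
  by (rule module_homD(1)[OF d])

lemma d_d: "f \<in> carrier (Fr (Suc (Suc n))) \<Longrightarrow> d n (d (Suc n) f) = \<zero>\<^bsub>Fr n\<^esub>"
  using exact_Suc[of n] by blast

text \<open>\<open>coboundary n \<phi> I\<close> says that \<open>\<phi>\<close> is a coboundary modulo \<open>I\<close>, and \<open>vanishes n I\<close> that
  \<open>Ext\<^sup>n(R/m, R/I) = 0\<close>; since the modules of the resolution are free, every homomorphism into \<open>R/I\<close>
  is represented by a homomorphism into \<open>R\<close>.\<close>

definition coboundary :: "nat \<Rightarrow> (('c \<Rightarrow> 'a) \<Rightarrow> 'a) \<Rightarrow> 'a set \<Rightarrow> bool"
  where "coboundary n \<phi> I \<longleftrightarrow> (case n of 0 \<Rightarrow> \<forall>f\<in>carrier (Fr 0). \<phi> f \<in> I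
    | Suc k \<Rightarrow> \<exists>\<psi>\<in>lin (B k). \<forall>f\<in>carrier (Fr n). \<phi> f \<ominus> \<psi> (d k f) \<in> I)"

definition vanishes :: "nat \<Rightarrow> 'a set \<Rightarrow> bool"
  where "vanishes n I \<longleftrightarrow> (\<forall>\<phi>\<in>lin (B n). (\<forall>f\<in>carrier (Fr (Suc n)). \<phi> (d n f) \<in> I) \<longrightarrow> coboundary n \<phi> I)"

lemma vanishesD:
  "vanishes n I \<Longrightarrow> \<phi> \<in> lin (B n) \<Longrightarrow> (\<And>f. f \<in> carrier (Fr (Suc n)) \<Longrightarrow> \<phi> (d n f) \<in> I) \<Longrightarrow> coboundary n \<phi> I"
  by (auto simp: vanishes_def)

lemma coboundary_Suc:
  "coboundary (Suc k) \<phi> I \<longleftrightarrow> (\<exists>\<psi>\<in>lin (B k). \<forall>f\<in>carrier (Fr (Suc k)). \<phi> f \<ominus> \<psi> (d k f) \<in> I)"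
  by (simp add: coboundary_def)

lemma coboundary_0: "coboundary 0 \<phi> I \<longleftrightarrow> (\<forall>f\<in>carrier (Fr 0). \<phi> f \<in> I)"
  by (simp add: coboundary_def)

lemma lin_d: "\<phi> \<in> lin (B n) \<Longrightarrow> (\<lambda>f. \<phi> (d n f)) \<in> lin (B (Suc n))"
  by (rule module_hom_comp[OF d])

text \<open>Subtracting \<psi> d makes all values lie in I and, since d d = 0, does not change
  \<phi> d. In degree 0 there is nothing to subtract.\<close>

lemma coboundary_representative:
  assumes "coboundary n \<phi> I" "\<phi> \<in> lin (B n)"
  obtains \<phi>' where "\<phi>' \<in> lin (B n)" "\<And>f. f \<in> carrier (Fr n) \<Longrightarrow> \<phi>' f \<in> I"
    "\<And>f. f \<in> carrier (Fr (Suc n)) \<Longrightarrow> \<phi>' (d n f) = \<phi> (d n f)"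
proof (cases n)
  case 0
  then show ?thesis using assms by (intro that[of \<phi>]) (auto simp: coboundary_0)
next
  case (Suc k)
  then obtain \<psi> where \<psi>: "\<psi> \<in> lin (B k)" "\<forall>f\<in>carrier (Fr n). \<phi> f \<ominus> \<psi> (d k f) \<in> I"
    using assms by (auto simp: coboundary_Suc)
  show ?thesis
  proof (rule that[of "\<lambda>f. \<phi> f \<ominus> \<psi> (d k f)"])
    show "(\<lambda>f. \<phi> f \<ominus> \<psi> (d k f)) \<in> lin (B n)" using assms(2) lin_d[OF \<psi>(1)] unfolding Suc by (intro lin_diff)
    fix f assume f: "f \<in> carrier (Fr (Suc n))"
    have "\<psi> (d k (d n f)) = \<zero>" using d_d[of f k] f linD(4)[OF \<psi>(1)] unfolding Suc by simp
    then show "\<phi> (d n f) \<ominus> \<psi> (d k (d n f)) = \<phi> (d n f)"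
      using linD(1)[OF assms(2) d_closed[OF f]] by (simp add: minus_eq)
  qed (use \<psi> in auto)
qed

text \<open>The term x \<psi> has values in I + xR, so it may be dropped modulo this ideal.\<close>

lemma coboundary_adjoin:
  assumes cob: "coboundary n (\<lambda>f. \<phi> f \<ominus> x \<otimes> \<psi> f) I" and lin: "\<phi> \<in> lin (B n)" "\<psi> \<in> lin (B n)"
    and I: "ideal I R" and x: "x \<in> carrier R"
  shows "coboundary n \<phi> (adjoin R I x)"
proof -
  have *: "\<phi> f \<ominus> c \<in> adjoin R I x"
    if "\<phi> f \<ominus> x \<otimes> \<psi> f \<ominus> c \<in> I" "f \<in> carrier (Fr n)" "c \<in> carrier R" for f c
  proof -
    have "\<phi> f \<ominus> c = (\<phi> f \<ominus> x \<otimes> \<psi> f \<ominus> c) \<oplus> x \<otimes> \<psi> f"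
      using linD(1)[OF lin(1) that(2)] linD(1)[OF lin(2) that(2)] x that(3) by algebra
    then show ?thesis using adjoinI[OF that(1) linD(1)[OF lin(2) that(2)], of x] by simp
  qed
  show ?thesis
  proof (cases n)
    case 0
    have "\<phi> f \<in> adjoin R I x" if f: "f \<in> carrier (Fr 0)" for f
    proof -
      have c: "\<phi> f \<in> carrier R" "\<psi> f \<in> carrier R" using linD(1)[OF lin(1)] linD(1)[OF lin(2)] f 0 by auto
      then have "\<phi> f \<ominus> x \<otimes> \<psi> f \<ominus> \<zero> \<in> I" using cob f x unfolding 0 by (auto simp: coboundary_0 minus_eq)
      then show ?thesis using *[of f \<zero>] f c 0 by (simp add: minus_eq)
    qed
    then show ?thesis unfolding 0 by (simp add: coboundary_0)
  next
    case (Suc k)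
    then obtain \<rho> where \<rho>: "\<rho> \<in> lin (B k)" "\<forall>f\<in>carrier (Fr n). \<phi> f \<ominus> x \<otimes> \<psi> f \<ominus> \<rho> (d k f) \<in> I"
      using cob by (auto simp: coboundary_Suc)
    have "\<phi> f \<ominus> \<rho> (d k f) \<in> adjoin R I x" if f: "f \<in> carrier (Fr n)" for f
      using *[of f "\<rho> (d k f)"] \<rho>(2) f linD(1)[OF lin_d[OF \<rho>(1)]] unfolding Suc by auto
    then show ?thesis using \<rho>(1) unfolding Suc by (auto simp: coboundary_Suc)
  qed
qed

text \<open>Multiplication by an element of \<open>m\<close> is null-homotopic on the resolution.\<close>

lemma homotopy_step:
  assumes x: "x \<in> carrier R" and h: "h \<in> module_hom R (Fr n) (Fr (Suc n))"
    and dh: "\<And>g. g \<in> carrier (Fr (Suc n)) \<Longrightarrow> d n (h (d n g)) = x \<odot>\<^bsub>Fr n\<^esub> d n g"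
  obtains h' where "h' \<in> module_hom R (Fr (Suc n)) (Fr (Suc (Suc n)))"
    "\<And>f. f \<in> carrier (Fr (Suc n)) \<Longrightarrow> d (Suc n) (h' f) \<oplus>\<^bsub>Fr (Suc n)\<^esub> h (d n f) = x \<odot>\<^bsub>Fr (Suc n)\<^esub> f"
proof -
  interpret F0: module R "Fr n" by (rule free_module)
  interpret F1: module R "Fr (Suc n)" by (rule free_module)
  have hd: "(\<lambda>f. h (d n f)) \<in> module_hom R (Fr (Suc n)) (Fr (Suc n))" by (rule module_hom_comp[OF d h])
  have "\<exists>y\<in>carrier (Fr (Suc (Suc n))). d (Suc n) y \<oplus>\<^bsub>Fr (Suc n)\<^esub> h (d n (single R b)) = x \<odot>\<^bsub>Fr (Suc n)\<^esub> single R b"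
    if b: "b \<in> B (Suc n)" for b
  proof -
    let ?s = "single R b"
    \<comment> \<open>For the basis vector e_b, the element x e_b - h (d e_b) is a cycle because d h
      d = x d, so exactness provides the value of h' at e_b.\<close>
    let ?w = "x \<odot>\<^bsub>Fr (Suc n)\<^esub> ?s \<ominus>\<^bsub>Fr (Suc n)\<^esub> h (d n ?s)"
    have s: "?s \<in> carrier (Fr (Suc n))" by (rule single_closed[OF b])
    have hs: "h (d n ?s) \<in> carrier (Fr (Suc n))" by (rule module_homD(1)[OF hd s])
    have xs: "x \<odot>\<^bsub>Fr (Suc n)\<^esub> ?s \<in> carrier (Fr (Suc n))" using x s by simp
    have w: "?w \<in> carrier (Fr (Suc n))" using hs xs by simp
    have sum: "?w \<oplus>\<^bsub>Fr (Suc n)\<^esub> h (d n ?s) = x \<odot>\<^bsub>Fr (Suc n)\<^esub> ?s"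
      using hs xs by (simp add: F1.minus_eq F1.a_assoc F1.l_neg)
    have "d n ?w \<oplus>\<^bsub>Fr n\<^esub> d n (h (d n ?s)) = x \<odot>\<^bsub>Fr n\<^esub> d n ?s"
      using module_homD(2)[OF d w hs] module_homD(3)[OF d x s] sum by simp
    then have "d n ?w \<oplus>\<^bsub>Fr n\<^esub> x \<odot>\<^bsub>Fr n\<^esub> d n ?s = x \<odot>\<^bsub>Fr n\<^esub> d n ?s" using dh[OF s] by simp
    moreover define v where "v = x \<odot>\<^bsub>Fr n\<^esub> d n ?s"
    moreover have vc: "v \<in> carrier (Fr n)" unfolding v_def using d_closed[OF s] x by simp
    ultimately have "d n ?w \<oplus>\<^bsub>Fr n\<^esub> v = v" by simp
    moreover have "d n ?w = (d n ?w \<oplus>\<^bsub>Fr n\<^esub> v) \<oplus>\<^bsub>Fr n\<^esub> \<ominus>\<^bsub>Fr n\<^esub> v"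
      using d_closed[OF w] vc F0.a_assoc[OF d_closed[OF w] vc, of "\<ominus>\<^bsub>Fr n\<^esub> v"] F0.r_neg[OF vc] F0.r_zero[OF d_closed[OF w]]
      by (metis F0.a_inv_closed)
    ultimately have "d n ?w = \<zero>\<^bsub>Fr n\<^esub>" using F0.r_neg[OF vc] by metis
    then have "?w \<in> d (Suc n) ` carrier (Fr (Suc (Suc n)))" using exact_Suc[of n] w by blast
    then show ?thesis using sum by force
  qed
  then obtain h' where h': "h' \<in> module_hom R (Fr (Suc n)) (Fr (Suc (Suc n)))"
    and eq: "\<And>b. b \<in> B (Suc n) \<Longrightarrow> d (Suc n) (h' (single R b)) \<oplus>\<^bsub>Fr (Suc n)\<^esub> h (d n (single R b)) = x \<odot>\<^bsub>Fr (Suc n)\<^esub> single R b"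
    using free_module_hom_exists[OF free_module, of "B (Suc n)" "B (Suc (Suc n))"
        "\<lambda>b y. d (Suc n) y \<oplus>\<^bsub>Fr (Suc n)\<^esub> h (d n (single R b)) = x \<odot>\<^bsub>Fr (Suc n)\<^esub> single R b"] by blast
  show ?thesis
  proof (rule that[OF h'])
    have id: "(\<lambda>f. f) \<in> module_hom R (Fr (Suc n)) (Fr (Suc n))" by (rule module_homI) auto
    fix f assume f: "f \<in> carrier (Fr (Suc n))"
    show "d (Suc n) (h' f) \<oplus>\<^bsub>Fr (Suc n)\<^esub> h (d n f) = x \<odot>\<^bsub>Fr (Suc n)\<^esub> f"
      by (rule module_hom_eq[OF module_hom_sum[OF module_hom_comp[OF h' d] hd free_module free_module]
            module_hom_scale[OF id free_module free_module x] free_module eq f])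
  qed
qed

text \<open>The identity d h d = x d is weaker than the homotopy relation but has the same shape in
  degree 0, where there is no earlier map; \<open>homotopy_step\<close> recovers the full relation
  one degree higher. The induction starts because x kills R/m, so that x e_b is a boundary.\<close>

lemma homotopy:
  assumes x: "x \<in> m"
  obtains h where "h \<in> module_hom R (Fr n) (Fr (Suc n))"
    "\<And>g. g \<in> carrier (Fr (Suc n)) \<Longrightarrow> d n (h (d n g)) = x \<odot>\<^bsub>Fr n\<^esub> d n g"
proof -
  have xc: "x \<in> carrier R" using ideal_carr[OF m x] .
  have "\<exists>h\<in>module_hom R (Fr n) (Fr (Suc n)). \<forall>g\<in>carrier (Fr (Suc n)). d n (h (d n g)) = x \<odot>\<^bsub>Fr n\<^esub> d n g"
  proof (induction n)
    case 0
    have "\<exists>y\<in>carrier (Fr 1). d 0 y = x \<odot>\<^bsub>Fr 0\<^esub> single R b" if b: "b \<in> B 0" for b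
    proof -
      interpret F0: module R "Fr 0" by (rule free_module)
      have s: "single R b \<in> carrier (Fr 0)" by (rule single_closed[OF b])
      have "e (single R b) \<in> carrier (quotient_module R m)" by (rule module_homD(1)[OF e s])
      then obtain a where a: "a \<in> carrier R" "e (single R b) = m +> a" using quotient_module_carrier[OF m] by auto
      have "e (x \<odot>\<^bsub>Fr 0\<^esub> single R b) = m +> (x \<otimes> a)"
        using module_homD(3)[OF e xc s] a quotient_module_smult[OF m xc a(1)] by simp
      also have "\<dots> = m" using quotient_module_eq_zero[OF m] xc a ideal_multr[OF m x a(1)] by simp
      finally have "x \<odot>\<^bsub>Fr 0\<^esub> single R b \<in> d 0 ` carrier (Fr 1)"
        unfolding exact_0 using quotient_module_zero[OF m] xc s by simp
      then show ?thesis by force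
    qed
    then obtain h where h: "h \<in> module_hom R (Fr 0) (Fr 1)"
      and eq: "\<And>b. b \<in> B 0 \<Longrightarrow> d 0 (h (single R b)) = x \<odot>\<^bsub>Fr 0\<^esub> single R b"
      using free_module_hom_exists[OF free_module, of "B 0" "B 1" "\<lambda>b y. d 0 y = x \<odot>\<^bsub>Fr 0\<^esub> single R b"] by blast
    have h': "h \<in> module_hom R (Fr 0) (Fr (Suc 0))" using h by simp
    have id: "(\<lambda>f. f) \<in> module_hom R (Fr 0) (Fr 0)" by (rule module_homI) auto
    have "d 0 (h f) = x \<odot>\<^bsub>Fr 0\<^esub> f" if "f \<in> carrier (Fr 0)" for f
      by (rule module_hom_eq[OF module_hom_comp[OF h' d] module_hom_scale[OF id free_module free_module xc] free_module eq that])
    then show ?case using h' d_closed by blast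
  next
    case (Suc n)
    then obtain h where h: "h \<in> module_hom R (Fr n) (Fr (Suc n))"
      "\<And>g. g \<in> carrier (Fr (Suc n)) \<Longrightarrow> d n (h (d n g)) = x \<odot>\<^bsub>Fr n\<^esub> d n g" by blast
    obtain h' where h': "h' \<in> module_hom R (Fr (Suc n)) (Fr (Suc (Suc n)))"
      "\<And>f. f \<in> carrier (Fr (Suc n)) \<Longrightarrow> d (Suc n) (h' f) \<oplus>\<^bsub>Fr (Suc n)\<^esub> h (d n f) = x \<odot>\<^bsub>Fr (Suc n)\<^esub> f"
      using homotopy_step[OF xc h] by blast
    interpret F1: module R "Fr (Suc n)" by (rule free_module)
    have "d (Suc n) (h' (d (Suc n) g)) = x \<odot>\<^bsub>Fr (Suc n)\<^esub> d (Suc n) g" if g: "g \<in> carrier (Fr (Suc (Suc n)))" for g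
    proof -
      have "h (d n (d (Suc n) g)) = \<zero>\<^bsub>Fr (Suc n)\<^esub>"
        using d_d[OF g] module_hom_zero[OF h(1) free_module free_module] by simp
      then show ?thesis
        using h'(2)[OF d_closed[OF g]] module_homD(1)[OF d module_homD(1)[OF h'(1) d_closed[OF g]]] by simp
    qed
    then show ?case using h'(1) by blast
  qed
  then show ?thesis using that by blast
qed

text \<open>The part Ext^n(R/m, R/I) -> Ext^n(R/m, R/(I + xR)) -> Ext^(n+1)(R/m, R/I) of the long
  exact sequence for multiplication by x on R/I, chased on cochains.\<close>

lemma vanishes_adjoin:
  assumes I: "ideal I R" and x: "x \<in> carrier R"
    and reg: "\<And>a. a \<in> carrier R \<Longrightarrow> x \<otimes> a \<in> I \<Longrightarrow> a \<in> I"
    and van: "vanishes n I" "vanishes (Suc n) I"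
  shows "vanishes n (adjoin R I x)"
  unfolding vanishes_def
proof (intro ballI impI)
  fix \<phi> assume \<phi>: "\<phi> \<in> lin (B n)" and J: "\<forall>f\<in>carrier (Fr (Suc n)). \<phi> (d n f) \<in> adjoin R I x"
  \<comment> \<open>\<theta> represents the image of \<phi> under the connecting map: \<phi> d is x
    \<theta> modulo I. Regularity of x makes \<theta> a cocycle, and the vanishing in degree n + 1
    then makes it a coboundary.\<close>
  obtain \<theta> where \<theta>: "\<theta> \<in> lin (B (Suc n))" "\<And>f. f \<in> carrier (Fr (Suc n)) \<Longrightarrow> \<phi> (d n f) \<ominus> x \<otimes> \<theta> f \<in> I"
    using lin_adjoin[OF lin_d[OF \<phi>] I x] J by blast
  have "coboundary (Suc n) \<theta> I"
  proof (rule vanishesD[OF van(2) \<theta>(1)])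
    fix f assume f: "f \<in> carrier (Fr (Suc (Suc n)))"
    have c: "\<theta> (d (Suc n) f) \<in> carrier R" using linD(1)[OF \<theta>(1) d_closed[OF f]] .
    have "\<zero> \<ominus> x \<otimes> \<theta> (d (Suc n) f) \<in> I"
      using \<theta>(2)[OF d_closed[OF f]] d_d[OF f] linD(4)[OF \<phi>] by simp
    then have "\<ominus> (x \<otimes> \<theta> (d (Suc n) f)) \<in> I" using c x by (simp add: minus_eq)
    from ideal_uminus[OF I this] have "x \<otimes> \<theta> (d (Suc n) f) \<in> I" using c x by simp
    then show "\<theta> (d (Suc n) f) \<in> I" by (rule reg[OF c])
  qed
  then obtain \<psi> where \<psi>: "\<psi> \<in> lin (B n)" "\<And>f. f \<in> carrier (Fr (Suc n)) \<Longrightarrow> \<theta> f \<ominus> \<psi> (d n f) \<in> I"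
    by (auto simp: coboundary_Suc)
  \<comment> \<open>As x \<theta> is x \<psi> d modulo I, this correction of \<phi> is a cocycle
    modulo I and not just modulo I + xR.\<close>
  have D: "(\<lambda>f. \<phi> f \<ominus> x \<otimes> \<psi> f) \<in> lin (B n)" by (rule lin_diff[OF \<phi> lin_scale[OF \<psi>(1) x]])
  have "coboundary n (\<lambda>f. \<phi> f \<ominus> x \<otimes> \<psi> f) I"
  proof (rule vanishesD[OF van(1) D])
    fix f assume f: "f \<in> carrier (Fr (Suc n))"
    have c: "\<phi> (d n f) \<in> carrier R" "\<psi> (d n f) \<in> carrier R" "\<theta> f \<in> carrier R"
      using linD(1)[OF \<phi> d_closed[OF f]] linD(1)[OF \<psi>(1) d_closed[OF f]] linD(1)[OF \<theta>(1) f] .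
    have "\<phi> (d n f) \<ominus> x \<otimes> \<psi> (d n f) = (\<phi> (d n f) \<ominus> x \<otimes> \<theta> f) \<oplus> x \<otimes> (\<theta> f \<ominus> \<psi> (d n f))"
      using c x by algebra
    then show "\<phi> (d n f) \<ominus> x \<otimes> \<psi> (d n f) \<in> I"
      using ideal_add[OF I \<theta>(2)[OF f] ideal_mult[OF I \<psi>(2)[OF f] x]] by simp
  qed
  then show "coboundary n \<phi> (adjoin R I x)" by (rule coboundary_adjoin[OF _ \<phi> \<psi>(1) I x])
qed

text \<open>In the long exact sequence, multiplication by x on Ext^(n+1)(R/m, R/I) is injective
  because Ext^n(R/m, R/(I + xR)) = 0, while the homotopy shows that it is zero.\<close>

lemma vanishes_Suc:
  assumes I: "ideal I R" and x: "x \<in> m"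
    and reg: "\<And>a. a \<in> carrier R \<Longrightarrow> x \<otimes> a \<in> I \<Longrightarrow> a \<in> I"
    and van: "vanishes n (adjoin R I x)"
  shows "vanishes (Suc n) I"
  unfolding vanishes_def
proof (intro ballI impI)
  have xc: "x \<in> carrier R" using ideal_carr[OF m x] .
  fix \<phi> assume \<phi>: "\<phi> \<in> lin (B (Suc n))" and c: "\<forall>f\<in>carrier (Fr (Suc (Suc n))). \<phi> (d (Suc n) f) \<in> I"
  obtain h where h: "h \<in> module_hom R (Fr n) (Fr (Suc n))"
    "\<And>g. g \<in> carrier (Fr (Suc n)) \<Longrightarrow> d n (h (d n g)) = x \<odot>\<^bsub>Fr n\<^esub> d n g" using homotopy[OF x] by blast
  obtain h' where h': "h' \<in> module_hom R (Fr (Suc n)) (Fr (Suc (Suc n)))"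
    "\<And>f. f \<in> carrier (Fr (Suc n)) \<Longrightarrow> d (Suc n) (h' f) \<oplus>\<^bsub>Fr (Suc n)\<^esub> h (d n f) = x \<odot>\<^bsub>Fr (Suc n)\<^esub> f"
    using homotopy_step[OF xc h] by blast
  \<comment> \<open>By the homotopy, x \<phi> differs from the coboundary of \<phi> h by \<phi> d
    h', which has values in I.\<close>
  let ?\<psi> = "\<lambda>f. \<phi> (h f)"
  have \<psi>: "?\<psi> \<in> lin (B n)" by (rule module_hom_comp[OF h(1) \<phi>])
  have eq: "x \<otimes> \<phi> f = \<phi> (d (Suc n) (h' f)) \<oplus> ?\<psi> (d n f)" if f: "f \<in> carrier (Fr (Suc n))" for f
  proof -
    have h'f: "h' f \<in> carrier (Fr (Suc (Suc n)))" by (rule module_homD(1)[OF h'(1) f])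
    have "x \<otimes> \<phi> f = \<phi> (x \<odot>\<^bsub>Fr (Suc n)\<^esub> f)" using linD(3)[OF \<phi> xc f] by simp
    also have "\<dots> = \<phi> (d (Suc n) (h' f)) \<oplus> ?\<psi> (d n f)"
      using h'(2)[OF f, symmetric] linD(2)[OF \<phi> d_closed[OF h'f] module_homD(1)[OF h(1) d_closed[OF f]]] by simp
    finally show ?thesis .
  qed
  have \<phi>c: "\<phi> f \<in> carrier R" if "f \<in> carrier (Fr (Suc n))" for f using linD(1)[OF \<phi> that] .
  have i: "\<phi> (d (Suc n) (h' f)) \<in> I" if "f \<in> carrier (Fr (Suc n))" for f
    using c module_homD(1)[OF h'(1) that] by blast
  have \<psi>c: "?\<psi> (d n f) \<in> carrier R" if "f \<in> carrier (Fr (Suc n))" for f using linD(1)[OF \<psi> d_closed[OF that]] .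
  \<comment> \<open>\<phi> h is a cocycle modulo I + xR, hence a coboundary there. After correction
    by an exact coboundary it is x \<theta> modulo I, and cancelling x in x \<phi> = x \<theta> d
    shows that \<phi> is a coboundary.\<close>
  have "coboundary n ?\<psi> (adjoin R I x)"
  proof (rule vanishesD[OF van \<psi>])
    fix f assume f: "f \<in> carrier (Fr (Suc n))"
    have "?\<psi> (d n f) = \<ominus> \<phi> (d (Suc n) (h' f)) \<oplus> x \<otimes> \<phi> f"
      unfolding eq[OF f] using ideal_carr[OF I i[OF f]] \<psi>c[OF f] by (simp add: a_assoc[symmetric] l_neg)
    then show "?\<psi> (d n f) \<in> adjoin R I x" using adjoinI[OF ideal_uminus[OF I i[OF f]] \<phi>c[OF f], of x] by simp
  qed
  then obtain \<psi>' where \<psi>': "\<psi>' \<in> lin (B n)" "\<And>f. f \<in> carrier (Fr n) \<Longrightarrow> \<psi>' f \<in> adjoin R I x"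
    "\<And>f. f \<in> carrier (Fr (Suc n)) \<Longrightarrow> \<psi>' (d n f) = ?\<psi> (d n f)"
    using coboundary_representative[OF _ \<psi>] by blast
  obtain \<theta> where \<theta>: "\<theta> \<in> lin (B n)" "\<And>f. f \<in> carrier (Fr n) \<Longrightarrow> \<psi>' f \<ominus> x \<otimes> \<theta> f \<in> I"
    using lin_adjoin[OF \<psi>'(1) I xc \<psi>'(2)] by blast
  have "\<phi> f \<ominus> \<theta> (d n f) \<in> I" if f: "f \<in> carrier (Fr (Suc n))" for f
  proof (rule reg)
    have tc: "\<theta> (d n f) \<in> carrier R" using linD(1)[OF \<theta>(1) d_closed[OF f]] .
    show "\<phi> f \<ominus> \<theta> (d n f) \<in> carrier R" using \<phi>c[OF f] tc by simp
    have "x \<otimes> (\<phi> f \<ominus> \<theta> (d n f)) = x \<otimes> \<phi> f \<ominus> x \<otimes> \<theta> (d n f)" using xc \<phi>c[OF f] tc by algebra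
    also have "\<dots> = \<phi> (d (Suc n) (h' f)) \<oplus> (?\<psi> (d n f) \<ominus> x \<otimes> \<theta> (d n f))"
      unfolding eq[OF f] using xc tc \<psi>c[OF f] ideal_carr[OF I i[OF f]] by algebra
    also have "\<dots> \<in> I" using ideal_add[OF I i[OF f] \<theta>(2)[OF d_closed[OF f]]] \<psi>'(3)[OF f] by simp
    finally show "x \<otimes> (\<phi> f \<ominus> \<theta> (d n f)) \<in> I" .
  qed
  then show "coboundary (Suc n) \<phi> I" using \<theta>(1) by (auto simp: coboundary_Suc)
qed

text \<open>Ext^0(R/m, R/I) = Hom(R/m, R/I) is the socle of R/I, the set of classes killed by
  m.\<close>

lemma vanishes_0_iff:
  assumes I: "ideal I R"
  shows "vanishes 0 I \<longleftrightarrow> (\<forall>y\<in>carrier R. (\<forall>z\<in>m. z \<otimes> y \<in> I) \<longrightarrow> y \<in> I)"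
proof
  assume soc: "\<forall>y\<in>carrier R. (\<forall>z\<in>m. z \<otimes> y \<in> I) \<longrightarrow> y \<in> I"
  show "vanishes 0 I"
    unfolding vanishes_def coboundary_0
  proof (intro ballI impI)
    interpret F0: module R "Fr 0" by (rule free_module)
    fix \<phi> f assume \<phi>: "\<phi> \<in> lin (B 0)" and c: "\<forall>f\<in>carrier (Fr (Suc 0)). \<phi> (d 0 f) \<in> I" and f: "f \<in> carrier (Fr 0)"
    have "z \<otimes> \<phi> f \<in> I" if z: "z \<in> m" for z
    proof -
      have zc: "z \<in> carrier R" using ideal_carr[OF m z] .
      obtain a where a: "a \<in> carrier R" "e f = m +> a"
        using module_homD(1)[OF e f] quotient_module_carrier[OF m] by auto
      have "e (z \<odot>\<^bsub>Fr 0\<^esub> f) = m +> (z \<otimes> a)"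
        using module_homD(3)[OF e zc f] a quotient_module_smult[OF m zc a(1)] by simp
      also have "\<dots> = m" using quotient_module_eq_zero[OF m] zc a ideal_multr[OF m z a(1)] by simp
      finally have "z \<odot>\<^bsub>Fr 0\<^esub> f \<in> d 0 ` carrier (Fr 1)"
        unfolding exact_0 using quotient_module_zero[OF m] zc f by simp
      then have "\<phi> (z \<odot>\<^bsub>Fr 0\<^esub> f) \<in> I" using c by auto
      then show ?thesis using linD(3)[OF \<phi> zc f] by simp
    qed
    then show "\<phi> f \<in> I" using soc linD(1)[OF \<phi> f] by blast
  qed
next
  assume van: "vanishes 0 I"
  show "\<forall>y\<in>carrier R. (\<forall>z\<in>m. z \<otimes> y \<in> I) \<longrightarrow> y \<in> I"
  proof (intro ballI impI)
    fix y assume y: "y \<in> carrier R" and my: "\<forall>z\<in>m. z \<otimes> y \<in> I"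
    \<comment> \<open>\<rho> lifts the augmentation e to R. It maps boundaries into m, so y \<rho>
      is a cocycle modulo I as soon as m y lies in I.\<close>
    have "\<exists>r\<in>carrier (self_module R). e (single R b) = m +> r" if b: "b \<in> B 0" for b
      using module_homD(1)[OF e single_closed[OF b]] quotient_module_carrier[OF m] by auto
    then obtain \<rho> where \<rho>: "\<rho> \<in> lin (B 0)" "\<And>b. b \<in> B 0 \<Longrightarrow> e (single R b) = m +> \<rho> (single R b)"
      using free_module_hom_exists[OF self_module, of "B 0" "\<lambda>b r. e (single R b) = m +> r"] by blast
    have "(\<lambda>f. m +> \<rho> f) \<in> module_hom R (Fr 0) (quotient_module R m)"
    proof (rule module_homI)
      fix f assume f: "f \<in> carrier (Fr 0)"
      show "m +> \<rho> f \<in> carrier (quotient_module R m)" using linD(1)[OF \<rho>(1) f] quotient_module_carrier[OF m] by auto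
      show "m +> \<rho> (f \<oplus>\<^bsub>Fr 0\<^esub> g) = (m +> \<rho> f) \<oplus>\<^bsub>quotient_module R m\<^esub> (m +> \<rho> g)" if g: "g \<in> carrier (Fr 0)" for g
        using linD(1)[OF \<rho>(1) f] linD(1)[OF \<rho>(1) g] linD(2)[OF \<rho>(1) f g] quotient_module_add[OF m] by simp
      show "m +> \<rho> (r \<odot>\<^bsub>Fr 0\<^esub> f) = r \<odot>\<^bsub>quotient_module R m\<^esub> (m +> \<rho> f)" if r: "r \<in> carrier R" for r
        using linD(1)[OF \<rho>(1) f] linD(3)[OF \<rho>(1) r f] quotient_module_smult[OF m r] by simp
    qed
    then have e\<rho>: "e f = m +> \<rho> f" if "f \<in> carrier (Fr 0)" for f
      using module_hom_eq[OF e _ quotient_module[OF m] \<rho>(2) that] by blast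
    have \<phi>: "(\<lambda>f. y \<otimes> \<rho> f) \<in> lin (B 0)" by (rule lin_scale[OF \<rho>(1) y])
    have "coboundary 0 (\<lambda>f. y \<otimes> \<rho> f) I"
    proof (rule vanishesD[OF van \<phi>])
      fix g assume g: "g \<in> carrier (Fr (Suc 0))"
      have dg: "d 0 g \<in> carrier (Fr 0)" by (rule d_closed[OF g])
      have "e (d 0 g) = m" using exact_0 g quotient_module_zero[OF m] by auto
      then have "\<rho> (d 0 g) \<in> m" using e\<rho>[OF dg] quotient_module_eq_zero[OF m linD(1)[OF \<rho>(1) dg]] by simp
      then show "y \<otimes> \<rho> (d 0 g) \<in> I" using my m_comm[OF y linD(1)[OF \<rho>(1) dg]] by auto
    qed
    then have \<rho>I: "y \<otimes> \<rho> f \<in> I" if "f \<in> carrier (Fr 0)" for f using that by (simp add: coboundary_0)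
    \<comment> \<open>For f over the class of 1, the value \<rho> f is congruent to 1 modulo m. So
      both y \<rho> f and (\<rho> f - 1) y lie in I, and y is their difference.\<close>
    have "m +> \<one> \<in> carrier (quotient_module R m)" using quotient_module_carrier[OF m] by auto
    then obtain f where f: "f \<in> carrier (Fr 0)" "e f = m +> \<one>" using e_surj by (metis imageE)
    have c: "\<rho> f \<in> carrier R" by (rule linD(1)[OF \<rho>(1) f(1)])
    have "m +> \<rho> f = m +> \<one>" using e\<rho>[OF f(1)] f(2) by simp
    then have "\<rho> f \<ominus> \<one> \<in> m" using quotient_eq_iff_same_a_r_cos[OF m c one_closed] by simp
    then have "(\<rho> f \<ominus> \<one>) \<otimes> y \<in> I" using my by auto
    from ideal_minus[OF I \<rho>I[OF f(1)] this] have "y \<otimes> \<rho> f \<ominus> (\<rho> f \<ominus> \<one>) \<otimes> y \<in> I" .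
    moreover have "y \<otimes> \<rho> f \<ominus> (\<rho> f \<ominus> \<one>) \<otimes> y = y" using c y by algebra
    ultimately show "y \<in> I" by simp
  qed
qed

section \<open>From the cohomology groups in \<open>Ext\<close> to the vanishing of cochains\<close>

lemma coboundaries_iff:
  assumes "\<phi> \<in> carrier (hom_group R (Fr n) (self_module R))"
  shows "\<phi> \<in> coboundaries R B d (self_module R) n \<longleftrightarrow> coboundary n \<phi> {\<zero>}"
proof -
  have \<phi>: "\<phi> \<in> lin (B n)" "\<phi> \<in> extensional (carrier (Fr n))" using assms by (auto simp: hom_group_def)
  show ?thesis
  proof (cases n)
    case 0
    show ?thesis unfolding 0 coboundary_0 using \<phi>(2) unfolding 0
      by (auto simp: hom_group_def extensional_def fun_eq_iff)
  next
    case (Suc k)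
    show ?thesis
    proof
      assume "\<phi> \<in> coboundaries R B d (self_module R) n"
      then obtain \<psi> where \<psi>: "\<psi> \<in> lin (B k)" "\<phi> = compose (carrier (Fr (Suc k))) \<psi> (d k)"
        unfolding Suc by (auto simp: hom_group_def)
      then show "coboundary n \<phi> {\<zero>}"
        unfolding Suc coboundary_Suc using linD(1)[OF lin_d[OF \<psi>(1)]]
        by (intro bexI[of _ \<psi>]) (auto simp: compose_def minus_eq r_neg)
    next
      assume "coboundary n \<phi> {\<zero>}"
      then obtain \<psi> where \<psi>: "\<psi> \<in> lin (B k)" "\<And>f. f \<in> carrier (Fr (Suc k)) \<Longrightarrow> \<phi> f \<ominus> \<psi> (d k f) = \<zero>"
        unfolding Suc coboundary_Suc by auto
      let ?\<psi> = "restrict \<psi> (carrier (Fr k))"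
      interpret Fk: module R "Fr k" by (rule free_module)
      have "?\<psi> \<in> lin (B k)" using module_homD[OF \<psi>(1)] by (intro module_homI) auto
      then have "?\<psi> \<in> carrier (hom_group R (Fr k) (self_module R))" by (simp add: hom_group_def)
      moreover have "\<phi> = compose (carrier (Fr (Suc k))) ?\<psi> (d k)"
      proof
        fix f
        show "\<phi> f = compose (carrier (Fr (Suc k))) ?\<psi> (d k) f"
        proof (cases "f \<in> carrier (Fr (Suc k))")
          case True
          have "\<phi> f = \<psi> (d k f)"
            using \<psi>(2)[OF True] linD(1)[OF \<phi>(1)] True linD(1)[OF lin_d[OF \<psi>(1)] True] unfolding Suc
            by (simp add: r_right_minus_eq)
          then show ?thesis using True d_closed[OF True] by (simp add: compose_def)
        next
          case False
          then show ?thesis using \<phi>(2) unfolding Suc by (simp add: compose_def extensional_def)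
        qed
      qed
      ultimately show "\<phi> \<in> coboundaries R B d (self_module R) n" unfolding Suc by auto
    qed
  qed
qed

text \<open>Linear combinations in the form needed below: r = \<one> and r = \<ominus> \<one> give
  sums and differences, and r = \<zero> replaces a cochain by one that agrees with it on the free
  module.\<close>

lemma coboundary_zero_lin:
  assumes "coboundary n \<phi> {\<zero>}" "coboundary n \<psi> {\<zero>}" "\<phi> \<in> lin (B n)" "\<psi> \<in> lin (B n)" "r \<in> carrier R"
    and eq: "\<And>f. f \<in> carrier (Fr n) \<Longrightarrow> \<chi> f = \<phi> f \<oplus> r \<otimes> \<psi> f"
  shows "coboundary n \<chi> {\<zero>}"
proof (cases n)
  case 0
  then show ?thesis using assms by (auto simp: coboundary_0)
next
  case (Suc k)
  obtain \<alpha> where \<alpha>: "\<alpha> \<in> lin (B k)" "\<And>f. f \<in> carrier (Fr (Suc k)) \<Longrightarrow> \<phi> f \<ominus> \<alpha> (d k f) = \<zero>"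
    using assms(1) unfolding Suc coboundary_Suc by auto
  obtain \<beta> where \<beta>: "\<beta> \<in> lin (B k)" "\<And>f. f \<in> carrier (Fr (Suc k)) \<Longrightarrow> \<psi> f \<ominus> \<beta> (d k f) = \<zero>"
    using assms(2) unfolding Suc coboundary_Suc by auto
  have "(\<lambda>f. \<alpha> f \<oplus> r \<otimes> \<beta> f) \<in> lin (B k)" by (rule lin_add[OF \<alpha>(1) lin_scale[OF \<beta>(1) assms(5)]])
  moreover have "\<chi> f \<ominus> (\<alpha> (d k f) \<oplus> r \<otimes> \<beta> (d k f)) = \<zero>" if f: "f \<in> carrier (Fr (Suc k))" for f
  proof -
    have c: "\<phi> f \<in> carrier R" "\<psi> f \<in> carrier R" "\<alpha> (d k f) \<in> carrier R" "\<beta> (d k f) \<in> carrier R"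
      using linD(1)[OF assms(3)] linD(1)[OF assms(4)] linD(1)[OF \<alpha>(1) d_closed[OF f]] linD(1)[OF \<beta>(1) d_closed[OF f]] f
      unfolding Suc by auto
    have "\<phi> f = \<alpha> (d k f)" "\<psi> f = \<beta> (d k f)" using \<alpha>(2)[OF f] \<beta>(2)[OF f] c by (simp_all add: r_right_minus_eq)
    then show ?thesis using eq f c assms(5) unfolding Suc by (simp add: minus_eq r_neg)
  qed
  ultimately show ?thesis unfolding Suc coboundary_Suc by (intro bexI[of _ "\<lambda>f. \<alpha> f \<oplus> r \<otimes> \<beta> f"]) auto
qed

text \<open>The factor structure is read off coset by coset: the coset of a cocycle is the neutral
  one iff the cocycle is a coboundary. Extensional functions may be exchanged for arbitrary ones,
  since \<open>coboundary\<close> sees only values on the free module.\<close>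

lemma hom_cohomology_trivial_iff:
  "carrier (hom_cohomology R B d (self_module R) n) = {\<one>\<^bsub>hom_cohomology R B d (self_module R) n\<^esub>} \<longleftrightarrow> vanishes n {\<zero>}"
proof -
  let ?G = "hom_group R (Fr n) (self_module R)"
  let ?Z = "cocycles R B d (self_module R) n"
  let ?H = "coboundaries R B d (self_module R) n"
  let ?GZ = "?G\<lparr>carrier := ?Z\<rparr>"
  have Glin: "\<phi> \<in> lin (B n)" if "\<phi> \<in> carrier ?G" for \<phi> using that by (auto simp: hom_group_def)
  interpret F: module R "Fr n" by (rule free_module)
  have GI: "restrict \<phi> (carrier (Fr n)) \<in> carrier ?G" if "\<phi> \<in> lin (B n)" for \<phi>
    using module_homD[OF that] by (auto simp: hom_group_def intro!: module_homI)
  have Z: "\<phi> \<in> ?Z \<longleftrightarrow> \<phi> \<in> carrier ?G \<and> (\<forall>f\<in>carrier (Fr (Suc n)). \<phi> (d n f) = \<zero>)" for \<phi>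
    by (auto simp: cocycles_def hom_group_def compose_def restrict_def fun_eq_iff)
  have mult: "\<phi> \<otimes>\<^bsub>?GZ\<^esub> \<psi> = (\<lambda>f\<in>carrier (Fr n). \<phi> f \<oplus> \<psi> f)" for \<phi> \<psi>
    by (simp add: hom_group_def)
  have HG: "?H \<subseteq> carrier ?G"
  proof (cases n)
    case 0
    have "(\<lambda>f. \<zero>) \<in> lin (B 0)" by (rule module_homI) auto
    then show ?thesis using GI unfolding 0 by (auto simp: hom_group_def restrict_def)
  next
    case (Suc k)
    have "compose (carrier (Fr (Suc k))) \<psi> (d k) \<in> carrier ?G" if "\<psi> \<in> lin (B k)" for \<psi>
      using GI[of "\<lambda>f. \<psi> (d k f)"] lin_d[OF that] unfolding Suc by (simp add: compose_def)
    then show ?thesis unfolding Suc by (auto simp: hom_group_def)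
  qed
  have H: "\<phi> \<in> ?H \<longleftrightarrow> \<phi> \<in> carrier ?G \<and> coboundary n \<phi> {\<zero>}" for \<phi>
    using coboundaries_iff HG by blast
  have zero: "coboundary n \<phi> {\<zero>}" if "\<And>f. f \<in> carrier (Fr n) \<Longrightarrow> \<phi> f = \<zero>" for \<phi>
  proof (cases n)
    case 0
    then show ?thesis using that by (simp add: coboundary_0)
  next
    case (Suc k)
    have "(\<lambda>f. \<zero>) \<in> lin (B k)" by (rule module_homI) auto
    then show ?thesis unfolding Suc coboundary_Suc using that unfolding Suc
      by (intro bexI[of _ "\<lambda>f. \<zero>"]) (auto simp: minus_eq)
  qed
  let ?z = "restrict (\<lambda>_. \<zero>) (carrier (Fr n))"
  have zG: "?z \<in> carrier ?G" by (rule GI) (rule module_homI, auto)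
  have zH: "?z \<in> ?H" unfolding H using zG zero by simp
  have zZ: "?z \<in> ?Z" unfolding Z using zG d_closed by auto
  have coset: "?H #>\<^bsub>?GZ\<^esub> \<phi> = ?H \<longleftrightarrow> \<phi> \<in> ?H" if \<phi>: "\<phi> \<in> carrier ?G" for \<phi>
  proof
    assume eq: "?H #>\<^bsub>?GZ\<^esub> \<phi> = ?H"
    have "?z \<otimes>\<^bsub>?GZ\<^esub> \<phi> \<in> ?H #>\<^bsub>?GZ\<^esub> \<phi>" using zH by (auto simp: r_coset_def)
    moreover have "?z \<otimes>\<^bsub>?GZ\<^esub> \<phi> = \<phi>"
      unfolding mult using \<phi> linD(1)[OF Glin[OF \<phi>]] by (auto simp: hom_group_def extensional_def fun_eq_iff)
    ultimately show "\<phi> \<in> ?H" using eq by simp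
  next
    assume \<phi>H: "\<phi> \<in> ?H"
    note \<phi>l = Glin[OF \<phi>]
    show "?H #>\<^bsub>?GZ\<^esub> \<phi> = ?H"
    proof (intro equalityI subsetI)
      fix \<psi> assume "\<psi> \<in> ?H #>\<^bsub>?GZ\<^esub> \<phi>"
      then obtain \<chi> where \<chi>: "\<chi> \<in> ?H" "\<psi> = (\<lambda>f\<in>carrier (Fr n). \<chi> f \<oplus> \<phi> f)" 
        unfolding r_coset_def mult by blast
      then have \<chi>l: "\<chi> \<in> lin (B n)" using Glin HG by blast
      have "coboundary n \<psi> {\<zero>}"
        by (rule coboundary_zero_lin[of n \<chi> \<phi> \<one>]) (use \<chi> \<phi>H H \<chi>l \<phi>l linD(1)[OF \<phi>l] in auto)
      then show "\<psi> \<in> ?H" unfolding H using \<chi>(2) GI[OF lin_add[OF \<chi>l \<phi>l]] by simp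
    next
      fix \<psi> assume \<psi>: "\<psi> \<in> ?H"
      then have \<psi>l: "\<psi> \<in> lin (B n)" using Glin HG by blast
      let ?\<chi> = "restrict (\<lambda>f. \<psi> f \<ominus> \<phi> f) (carrier (Fr n))"
      have "coboundary n ?\<chi> {\<zero>}"
        by (rule coboundary_zero_lin[of n \<psi> \<phi> "\<ominus> \<one>"])
          (use \<psi> \<phi>H H \<psi>l \<phi>l linD(1)[OF \<phi>l] in \<open>auto simp: minus_eq l_minus\<close>)
      then have "?\<chi> \<in> ?H" unfolding H using GI[OF lin_diff[OF \<psi>l \<phi>l]] by simp
      moreover have "\<psi> = ?\<chi> \<otimes>\<^bsub>?GZ\<^esub> \<phi>"
        unfolding mult using \<psi> HG linD(1)[OF \<psi>l] linD(1)[OF \<phi>l]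
        by (auto simp: hom_group_def extensional_def fun_eq_iff minus_eq a_assoc l_neg)
      ultimately show "\<psi> \<in> ?H #>\<^bsub>?GZ\<^esub> \<phi>" by (auto simp: r_coset_def)
    qed
  qed
  have "carrier (hom_cohomology R B d (self_module R) n) = (\<lambda>\<phi>. ?H #>\<^bsub>?GZ\<^esub> \<phi>) ` ?Z"
    "\<one>\<^bsub>hom_cohomology R B d (self_module R) n\<^esub> = ?H"
    by (auto simp: hom_cohomology_def FactGroup_def RCOSETS_def)
  then have "carrier (hom_cohomology R B d (self_module R) n) = {\<one>\<^bsub>hom_cohomology R B d (self_module R) n\<^esub>} \<longleftrightarrow>
      (\<forall>\<phi>\<in>?Z. ?H #>\<^bsub>?GZ\<^esub> \<phi> = ?H)" using zZ by auto
  also have "\<dots> \<longleftrightarrow> (\<forall>\<phi>\<in>?Z. coboundary n \<phi> {\<zero>})" using coset H Z by blast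
  also have "\<dots> \<longleftrightarrow> vanishes n {\<zero>}"
  proof
    assume a: "\<forall>\<phi>\<in>?Z. coboundary n \<phi> {\<zero>}"
    show "vanishes n {\<zero>}"
      unfolding vanishes_def
    proof (intro ballI impI)
      fix \<phi> assume \<phi>: "\<phi> \<in> lin (B n)" "\<forall>f\<in>carrier (Fr (Suc n)). \<phi> (d n f) \<in> {\<zero>}"
      let ?\<phi> = "restrict \<phi> (carrier (Fr n))"
      have "?\<phi> \<in> ?Z" unfolding Z using GI[OF \<phi>(1)] \<phi>(2) d_closed by auto
      then have c: "coboundary n ?\<phi> {\<zero>}" using a by blast
      show "coboundary n \<phi> {\<zero>}"
        by (rule coboundary_zero_lin[OF c c, of \<zero>])
          (use GI[OF \<phi>(1)] Glin linD(1)[OF \<phi>(1)] in auto)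
    qed
  next
    assume "vanishes n {\<zero>}"
    then show "\<forall>\<phi>\<in>?Z. coboundary n \<phi> {\<zero>}" using Z Glin by (auto simp: vanishes_def)
  qed
  finally show ?thesis .
qed

end

section \<open>Regular elements and depth in local rings\<close>

locale local_depth = residue_resolution + noetherian_cring +
  assumes m_prime: "primeideal m R" and primes_subset: "primeideal Q R \<Longrightarrow> Q \<subseteq> m"
begin

lemma vanishing_adjoin:
  assumes "ideal I R" "x \<in> carrier R" "\<And>a. a \<in> carrier R \<Longrightarrow> x \<otimes> a \<in> I \<Longrightarrow> a \<in> I"
    and "\<forall>j<Suc t. vanishes j I"
  shows "\<forall>j<t. vanishes j (adjoin R I x)"
  using vanishes_adjoin[OF assms(1-3)] assms(4) by simp

lemma vanishing_Suc:
  assumes I: "ideal I R" and x: "x \<in> m" and reg: "\<And>a. a \<in> carrier R \<Longrightarrow> x \<otimes> a \<in> I \<Longrightarrow> a \<in> I"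
    and van: "\<forall>j<t. vanishes j (adjoin R I x)"
  shows "\<forall>j<Suc t. vanishes j I"
proof (intro allI impI)
  fix j assume j: "j < Suc t"
  show "vanishes j I"
  proof (cases j)
    case 0
    then show ?thesis using vanishes_0_iff[OF I] reg x by blast
  next
    case (Suc i)
    then show ?thesis using vanishes_Suc[OF I x reg] van j by simp
  qed
qed

text \<open>Ischebeck's theorem for cyclic modules. For an \<open>R/I\<close>-regular \<open>x\<close>, Nakayama's lemma yields an
  associated prime of \<open>I + xR\<close> that contains \<open>Q\<close> and \<open>x\<close>.\<close>

lemma ischebeck:
  assumes "ideal I R" "Q \<in> ass_primes R I" "\<forall>j<t. vanishes j I" "has_chain R k Q"
  shows "has_chain R (k + t) m"
  using assms
proof (induction t arbitrary: I Q k)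
  case 0
  then show ?case using has_chain_mono[OF 0(4) primes_subset m_prime] has_chain_prime[OF 0(4)] by simp
next
  case (Suc t)
  note I = Suc.prems(1)
  \<comment> \<open>Ext^0 = 0 says that m kills no nonzero class of R/I; so m lies in no associated
    prime of I, and prime avoidance finds x.\<close>
  have soc: "\<And>y. y \<in> carrier R \<Longrightarrow> (\<And>z. z \<in> m \<Longrightarrow> z \<otimes> y \<in> I) \<Longrightarrow> y \<in> I"
    using vanishes_0_iff[OF I] Suc.prems(3) by blast
  have notm: "\<not> m \<subseteq> K" if K: "K \<in> ass_primes R I" for K
  proof
    assume mK: "m \<subseteq> K"
    obtain y where y: "y \<in> carrier R" "y \<notin> I" "K = colon R I y" using ass_primesD[OF I K] by metis
    then show False using soc[OF y(1)] mK by (auto simp: colon_def)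
  qed
  have "\<And>K. K \<in> ass_primes R I \<Longrightarrow> primeideal K R" by (auto simp: ass_primes_def)
  then obtain x where x: "x \<in> m" "\<And>K. K \<in> ass_primes R I \<Longrightarrow> x \<notin> K"
    using prime_avoidance[OF finite_ass_primes[OF I] _ m notm] by metis
  have xc: "x \<in> carrier R" using ideal_carr[OF m x(1)] .
  note reg = regular_mod_iff[OF I xc x(2)]
  note J = adjoin_ideal[OF I xc]
  have van: "\<forall>j<t. vanishes j (adjoin R I x)" by (rule vanishing_adjoin[OF I xc reg Suc.prems(3)])
  obtain y where y: "primeideal Q R" "y \<in> carrier R" "y \<notin> I" "Q = colon R I y"
    using ass_primesD[OF I Suc.prems(2)] by metis
  note Qi = prime_ideal[OF y(1)]
  \<comment> \<open>L/I is the annihilator of Q in R/I and contains the nonzero class of y. If L lay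
    in I + xR, regularity of x would put it into I + xL, and Nakayama would push it into I at
    m.\<close>
  define L where "L = {z \<in> carrier R. \<forall>q\<in>Q. q \<otimes> z \<in> I}"
  have "\<not> L \<subseteq> adjoin R I x"
  proof
    assume sub: "L \<subseteq> adjoin R I x"
    have "L \<subseteq> saturation R m I"
    proof (rule nakayama[OF m_prime _ I x(1)])
      show "L \<subseteq> carrier R" by (auto simp: L_def)
      fix z assume z: "z \<in> L"
      then obtain i r where ir: "i \<in> I" "r \<in> carrier R" "z = i \<oplus> x \<otimes> r" using sub by (auto simp: adjoin_def)
      have ic: "i \<in> carrier R" using ideal_carr[OF I ir(1)] .
      have "q \<otimes> r \<in> I" if q: "q \<in> Q" for q
      proof -
        have qc: "q \<in> carrier R" using ideal_carr[OF Qi q] .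
        have "q \<otimes> z \<in> I" using z q by (auto simp: L_def)
        moreover have "q \<otimes> z = q \<otimes> i \<oplus> x \<otimes> (q \<otimes> r)" unfolding ir(3) using qc ic ir(2) xc by algebra
        ultimately have "x \<otimes> (q \<otimes> r) \<in> I"
          using ideal_add_cancel[OF I ideal_mult[OF I ir(1) qc], of "x \<otimes> (q \<otimes> r)"] qc ir(2) xc by simp
        then show ?thesis using reg[of "q \<otimes> r"] qc ir(2) by simp
      qed
      then have "r \<in> L" using ir(2) by (auto simp: L_def)
      moreover have "\<one> \<otimes> z = i \<oplus> x \<otimes> r" using ir ic xc by simp
      ultimately show "\<exists>s n w. s \<in> carrier R \<and> s \<notin> m \<and> n \<in> I \<and> w \<in> L \<and> s \<otimes> z = n \<oplus> x \<otimes> w"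
        using ir(1) prime_not_one[OF m_prime] by blast
    qed
    moreover have "y \<in> L" using y by (auto simp: L_def colon_def)
    ultimately have "y \<in> saturation R m I" by blast
    then obtain s where "s \<in> carrier R" "s \<notin> m" "s \<otimes> y \<in> I" by (auto simp: saturation_iff)
    then have "s \<in> Q" "s \<notin> m" using y(4) by (auto simp: colon_def)
    then show False using primes_subset[OF y(1)] by auto
  qed
  then obtain z where z: "z \<in> L" "z \<notin> adjoin R I x" by auto
  have zc: "z \<in> carrier R" using z by (simp add: L_def)
  obtain K where K: "K \<in> ass_primes R (adjoin R I x)" "colon R (adjoin R I x) z \<subseteq> K"
    using in_ass_prime[OF J zc z(2)] by blast
  have Kp: "primeideal K R" using K(1) by (simp add: ass_primes_def)
  have "Q \<subseteq> K"
    using K(2) z(1) adjoin_subset[OF I xc] ideal_carr[OF Qi] unfolding L_def colon_def by blast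
  moreover have "x \<in> K"
    using K(2) ideal_multr[OF J adjoin_mem[OF I xc] zc] xc by (auto simp: colon_def)
  \<comment> \<open>So the step from Q to K is strict: the chain grows by one prime while t drops by
    one.\<close>
  moreover have "x \<notin> Q" by (rule x(2)[OF Suc.prems(2)])
  ultimately have "Q \<subset> K" by blast
  then have "has_chain R (Suc k) K" using Suc.prems(4) Kp has_chain_Suc[of R k K] by blast
  from Suc.IH[OF J K(1) van this] show ?case by simp
qed

text \<open>Depth is at most dimension: in a nonzero ring the zero ideal has an associated prime,
  and Ischebeck's theorem starts there with a chain of length 0.\<close>

lemma vanishing_le_dim:
  assumes "\<forall>j<t. vanishes j {\<zero>}"
  shows "has_chain R t m"
proof -
  have "\<one> \<noteq> \<zero>" using prime_not_one[OF m_prime] ideal_zero[OF m] by auto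
  then obtain Q where Q: "Q \<in> ass_primes R {\<zero>}" using in_ass_prime[OF zeroideal one_closed] by blast
  then have "has_chain R 0 Q" by (simp add: has_chain_0 ass_primes_def)
  from ischebeck[OF zeroideal Q assms this] show ?thesis by simp
qed

text \<open>Generators of \<open>I\<close> are replaced one by one by a regular sequence: \<open>N\<close> is generated by the
  regular sequence found so far and \<open>F\<close> consists of the remaining old generators of \<open>I\<close>.\<close>

lemma vanishing_le_card_generators:
  assumes I: "ideal I R" and high: "\<And>Q. primeideal Q R \<Longrightarrow> I \<subseteq> Q \<Longrightarrow> has_chain R k Q"
    and dim: "\<not> has_chain R (Suc D) m"
    and y: "y \<in> carrier R" "y \<notin> I" "\<And>z. z \<in> m \<Longrightarrow> z \<otimes> y \<in> I"
    and F: "finite F" "F \<subseteq> carrier R" and N: "ideal N R"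
    and gen: "\<And>K. ideal K R \<Longrightarrow> I \<subseteq> K \<longleftrightarrow> N \<subseteq> K \<and> F \<subseteq> K"
    and van: "\<forall>j<t. vanishes j N" and count: "D + card F \<le> t + k"
  shows "t \<le> card F"
  using F N gen van count
proof (induction F arbitrary: N t rule: finite_induct)
  case empty
  \<comment> \<open>All generators are used up, so N = I; the class of y is killed by m, so Ext^0 is
    nonzero and t must be 0.\<close>
  have "I \<subseteq> N" using empty(3)[OF empty(2)] by simp
  moreover have "N \<subseteq> I" using empty(3)[OF I] by simp
  ultimately have "N = I" by auto
  moreover have "\<not> vanishes 0 I" unfolding vanishes_0_iff[OF I] using y by auto
  ultimately show ?case using empty(4) by auto
next
  case (insert a F)
  note N = insert.prems(2)
  have ac: "a \<in> carrier R" and Fc: "F \<subseteq> carrier R" using insert.prems(1) by auto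
  have Fi: "ideal (Idl F) R" by (rule genideal_ideal[OF Fc])
  show ?case
  proof (cases t)
    case (Suc u)
    \<comment> \<open>An associated prime of N over I has a chain of length k below it, so
      Ischebeck's theorem would give one of length k + t ending in m. As a is still to be counted
      among the generators, \<open>count\<close> makes k + t exceed D.\<close>
    have bad: "\<not> (a \<in> Q \<and> Idl F \<subseteq> Q)" if Q: "Q \<in> ass_primes R N" for Q
    proof
      assume aQ: "a \<in> Q \<and> Idl F \<subseteq> Q"
      have w: "primeideal Q R" "N \<subseteq> Q" using ass_primesD[OF N Q] by metis+
      have "I \<subseteq> Q" using insert.prems(3)[OF prime_ideal[OF w(1)]] w(2) aQ genideal_self[OF Fc] by auto
      then have "has_chain R (k + t) m" using ischebeck[OF N Q insert.prems(4) high[OF w(1)]] by simp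
      moreover have "Suc D \<le> k + t" using insert.prems(5) insert.hyps by simp
      ultimately show False using dim has_chain_less by blast
    qed
    have "\<And>Q. Q \<in> ass_primes R N \<Longrightarrow> primeideal Q R" by (auto simp: ass_primes_def)
    then obtain j where j: "j \<in> Idl F" "\<And>Q. Q \<in> ass_primes R N \<Longrightarrow> a \<oplus> j \<notin> Q"
      using coset_prime_avoidance[OF finite_ass_primes[OF N] _ Fi ac bad] by metis
    have jc: "j \<in> carrier R" using ideal_carr[OF Fi j(1)] .
    have bc: "a \<oplus> j \<in> carrier R" using ac jc by simp
    \<comment> \<open>As j is a combination of F, exchanging a for a + j keeps the generated ideal.
      The count is preserved, because t and the number of remaining generators both drop by
      one.\<close>
    have "u \<le> card F"
    proof (rule insert.IH[OF Fc adjoin_ideal[OF N bc]])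
      fix K assume K: "ideal K R"
      have "a \<in> K \<longleftrightarrow> a \<oplus> j \<in> K" if "F \<subseteq> K"
      proof -
        have jK: "j \<in> K" using genideal_minimal[OF K that] j(1) by auto
        show ?thesis using ideal_add[OF K _ jK] ideal_add_cancel[OF K jK ac] by auto
      qed
      then show "I \<subseteq> K \<longleftrightarrow> adjoin R N (a \<oplus> j) \<subseteq> K \<and> F \<subseteq> K"
        using insert.prems(3)[OF K] adjoin_subset_iff[OF N bc K] by auto
    next
      show "\<forall>i<u. vanishes i (adjoin R N (a \<oplus> j))"
        by (rule vanishing_adjoin[OF N bc regular_mod_iff[OF N bc j(2)]]) (use insert.prems(4) Suc in simp_all)
      show "D + card F \<le> u + k" using insert.prems(5) insert.hyps Suc by simp
    qed
    then show ?thesis using Suc insert.hyps by simp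
  qed simp
qed

end

text \<open>The resolution chosen inside \<open>Ext\<close> depends neither on the degree nor on the
  second module, so a single choice serves all degrees; it is a genuine resolution because one
  exists.\<close>

lemma (in cring) depth_ge:
  assumes "max_ideal R = m" "ideal m R"
  obtains B :: "nat \<Rightarrow> ('a, 'a set) symbol set" and d e where "residue_resolution R m B d e"
    "\<And>t. enat t \<le> depth R \<longleftrightarrow> (\<forall>j<t. residue_resolution.vanishes R B d j {\<zero>})"
proof -
  let ?T = "SOME (B :: nat \<Rightarrow> ('a, 'a set) symbol set, d, e). free_resolution R (quotient_module R m) B d e"
  obtain B d e where T: "?T = (B, d, e)" by (metis prod_cases3)
  obtain B0 :: "nat \<Rightarrow> ('a, 'a set) symbol set" and d0 e0
    where "free_resolution R (quotient_module R m) B0 d0 e0"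
    using free_resolution_exists[OF quotient_module[OF assms(2)]] by blast
  then have "\<exists>x :: (nat \<Rightarrow> ('a, 'a set) symbol set) \<times> _ \<times> _. case x of (B, d, e) \<Rightarrow> free_resolution R (quotient_module R m) B d e"
    by (intro exI[of _ "(B0, d0, e0)"]) simp
  then have "case ?T of (B, d, e) \<Rightarrow> free_resolution R (quotient_module R m) B d e" by (rule someI_ex)
  then have "free_resolution R (quotient_module R m) B d e" using T by simp
  then have rr: "residue_resolution R m B d e"
    using assms(2) is_cring by (simp add: residue_resolution_def residue_resolution_axioms_def)
  interpret residue_resolution R m B d e by (rule rr)
  have Ext: "Ext R n (quotient_module R m) N = hom_cohomology R B d N n" for n and N :: "('a, 'a) module"
    unfolding Ext_def T by simp
  have "enat t \<le> depth R \<longleftrightarrow> (\<forall>j<t. vanishes j {\<zero>})" for t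
  proof -
    have "enat t \<le> depth R \<longleftrightarrow> (\<forall>i. \<not> vanishes i {\<zero>} \<longrightarrow> t \<le> i)"
      unfolding depth_def assms(1) Ext hom_cohomology_trivial_iff le_Inf_iff by auto
    then show ?thesis by (meson not_le)
  qed
  with rr show ?thesis by (rule that)
qed

section \<open>Unmixedness and the Cohen--Macaulay property\<close>

lemma prime_height_eq_iff:
  assumes "primeideal P R"
  shows "prime_height R P = enat n \<longleftrightarrow> has_chain R n P \<and> \<not> has_chain R (Suc n) P"
proof -
  have "prime_height R P = enat n \<longleftrightarrow> enat n \<le> prime_height R P \<and> \<not> enat (Suc n) \<le> prime_height R P"
    by (cases "prime_height R P") auto
  then show ?thesis using prime_height_ge[OF assms] by simp
qed

section \<open>Heights of ideals with few generators\<close>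

context noetherian_cring
begin

text \<open>A prime is minimal over itself, so Krull's theorem bounds its height by the number of
  its generators.\<close>

lemma prime_height_finite:
  assumes P: "primeideal P R"
  obtains n where "prime_height R P = enat n"
proof -
  obtain F where F: "F \<subseteq> carrier R" "finite F" "P = Idl F" using finetely_gen[OF prime_ideal[OF P]] by blast
  have "minimal_prime R (Idl F) P" using F P by (auto simp: minimal_prime_def)
  then have "\<not> has_chain R (Suc (card F)) P" using krull_height[OF F(2,1), of P "Suc (card F)"] by auto
  then have "\<not> enat (Suc (card F)) \<le> prime_height R P" using prime_height_ge[OF P] by blast
  then show ?thesis using that by (cases "prime_height R P") auto
qed

text \<open>Among the primes over F, one of least height is minimal over \<open>Idl F\<close>, since
  a prime strictly inside it would have smaller height. Krull's theorem applies to it.\<close>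

lemma ideal_height_le_card:
  assumes F: "finite F" and P: "primeideal P R" "F \<subseteq> P"
  shows "ideal_height R (Idl F) \<le> enat (card F)"
proof -
  have Fc: "F \<subseteq> carrier R" using P ideal_carr[OF prime_ideal[OF P(1)]] by auto
  define S where "S n \<longleftrightarrow> (\<exists>Q. primeideal Q R \<and> F \<subseteq> Q \<and> prime_height R Q = enat n)" for n
  have "\<exists>n. S n" using P prime_height_finite[OF P(1)] by (metis S_def)
  then have "S (LEAST n. S n)" by (rule LeastI_ex)
  then obtain Q where Q: "primeideal Q R" "F \<subseteq> Q" "prime_height R Q = enat (LEAST n. S n)" by (auto simp: S_def)
  note Qn = Q(3)[unfolded prime_height_eq_iff[OF Q(1)]]
  have IQ: "Idl F \<subseteq> Q" by (rule genideal_minimal[OF prime_ideal[OF Q(1)] Q(2)])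
  have "minimal_prime R (Idl F) Q"
    unfolding minimal_prime_def
  proof (intro conjI allI impI Q(1) IQ)
    fix K assume K: "primeideal K R \<and> Idl F \<subseteq> K \<and> K \<subseteq> Q"
    show "K = Q"
    proof (rule ccontr)
      assume "K \<noteq> Q"
      then have KQ: "K \<subset> Q" using K by auto
      obtain l where l: "prime_height R K = enat l" using prime_height_finite K by metis
      have "S l" using K l genideal_self[OF Fc] by (auto simp: S_def)
      then have "(LEAST n. S n) \<le> l" by (rule Least_le)
      moreover have "has_chain R l K" using l K prime_height_eq_iff by blast
      ultimately have "has_chain R (LEAST n. S n) K" using has_chain_less by blast
      then have "has_chain R (Suc (LEAST n. S n)) Q" using KQ Q(1) has_chain_Suc[of R _ Q] by blast
      then show False using Qn by blast
    qed
  qed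
  then have "(LEAST n. S n) \<le> card F" using krull_height[OF F Fc] Qn by blast
  then have "prime_height R Q \<le> enat (card F)" using Q(3) by simp
  then show ?thesis using ideal_height_le[OF Q(1) IQ] by (rule order_trans[rotated])
qed

text \<open>Powers of x can be cancelled modulo I, so s x^l in I with s outside P would put s into I
  and hence into P. Thus x is not nilpotent modulo I at P, and P strictly contains a prime over I
  that misses x; chains gain one step.\<close>

lemma height_adjoin_regular:
  assumes I: "ideal I R" and x: "x \<in> carrier R" and reg: "\<And>a. a \<in> carrier R \<Longrightarrow> x \<otimes> a \<in> I \<Longrightarrow> a \<in> I"
    and n: "enat n \<le> ideal_height R I"
  shows "enat (Suc n) \<le> ideal_height R (adjoin R I x)"
  unfolding ideal_height_ge
proof (intro allI impI)
  fix P assume "primeideal P R \<and> adjoin R I x \<subseteq> P"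
  then have P: "primeideal P R" and IP: "I \<subseteq> P" and xP: "x \<in> P"
    using adjoin_subset_iff[OF I x prime_ideal] by auto
  have pow: "a \<in> I" if "a \<in> carrier R" "a \<otimes> x [^] (l::nat) \<in> I" for a l
    using that
  proof (induction l)
    case (Suc l)
    then have "x \<otimes> (a \<otimes> x [^] l) \<in> I" using x by (simp add: m_ac)
    then show ?case using reg[of "a \<otimes> x [^] l"] Suc x by simp
  qed simp
  obtain Q where Q: "primeideal Q R" "I \<subseteq> Q" "Q \<subseteq> P" "x \<notin> Q"
    by (rule prime_avoiding_powers[OF I P x]) (use pow IP in blast)+
  have "has_chain R n Q" using n Q unfolding ideal_height_ge by blast
  moreover have "Q \<subset> P" using Q xP by auto
  ultimately show "has_chain R (Suc n) P" using P has_chain_Suc[of R n P] by blast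
qed

end

locale noetherian_localization = prime_localization + noetherian_cring R
begin

lemma local_depth:
  assumes "residue_resolution A (ext P) B d e"
  shows "local_depth A (ext P) B d e"
proof -
  have e: "primeideal (ext P) A" using ext_prime[OF P] by simp
  have "Q \<subseteq> ext P" if Q: "primeideal Q A" for Q
    using proper_subset_ext_P[OF prime_ideal[OF Q]] prime_not_one[OF Q] A.one_closed by metis
  then show ?thesis
    using assms e noetherian[OF noetherian_ring_axioms]
    by (simp add: local_depth_def local_depth_axioms_def)
qed

lemma has_chain_max: "has_chain A n (ext P) \<longleftrightarrow> has_chain R n P"
  using has_chain_ext[of n P] has_chain_con[of n "ext P"] con_ext[OF prime_ideal[OF P]] saturation_prime[OF P] by auto

lemma height_associated_prime:
  assumes cm: "cohen_macaulay_local A" and F: "finite F" "F \<subseteq> carrier R"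
    and ht: "enat (card F) \<le> ideal_height R (Idl F)" and ass: "P \<in> ass_primes R (Idl F)"
  shows "prime_height R P = enat (card F)"
proof -
  let ?I = "Idl F"
  have I: "ideal ?I R" by (rule R.genideal_ideal[OF F(2)])
  obtain D where D: "prime_height R P = enat D" using prime_height_finite[OF P] .
  have Dc: "has_chain R D P" "\<not> has_chain R (Suc D) P" using D prime_height_eq_iff[OF P] by auto
  have mi: "ideal (ext P) A" by (rule ext_ideal[OF prime_ideal[OF P]])
  obtain B :: "nat \<Rightarrow> ('c, 'c set) symbol set" and d e where res: "residue_resolution A (ext P) B d e"
    and depth: "\<And>t. enat t \<le> depth A \<longleftrightarrow> (\<forall>j<t. residue_resolution.vanishes A B d j {\<zero>\<^bsub>A\<^esub>})"
    using A.depth_ge[OF max_ideal_eq mi] by metis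
  interpret L: local_depth A "ext P" B d e by (rule local_depth[OF res])
  \<comment> \<open>P is the annihilator of the class of y; so the image of y in A lies outside
    \<open>ext ?I\<close> but is killed by the maximal ideal modulo \<open>ext ?I\<close>.\<close>
  obtain y where y: "y \<in> carrier R" "y \<notin> ?I" "P = colon R ?I y" "?I \<subseteq> P" using R.ass_primesD[OF I ass] by metis
  \<comment> \<open>Used with t = D, the depth of A, and with k = \<open>card F\<close>; \<phi> may
    identify generators, which only lowers the left side of the count.\<close>
  have "D \<le> card (\<phi> ` F)"
  proof (rule L.vanishing_le_card_generators[OF ext_ideal[OF I], where k = "card F" and D = D and y = "\<phi> y" and N = "{\<zero>\<^bsub>A\<^esub>}"])
    fix Q assume Q: "primeideal Q A" "ext ?I \<subseteq> Q"
    have "?I \<subseteq> con Q" using Q(2) image_in_ext[OF I] ideal_carr[OF I] by (auto simp: con_def)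
    then have "has_chain R (card F) (con Q)" using ht con_prime(1)[OF Q(1)] unfolding ideal_height_ge by blast
    then have "has_chain A (card F) (ext (con Q))" by (rule has_chain_ext[OF _ con_prime(2)[OF Q(1)]])
    then show "has_chain A (card F) Q" using ext_con[OF prime_ideal[OF Q(1)]] by simp
  next
    show "\<not> has_chain A (Suc D) (ext P)" using Dc has_chain_max by simp
    show "\<phi> y \<in> carrier A" using y by simp
    show "\<phi> y \<notin> ext ?I"
    proof
      assume "\<phi> y \<in> ext ?I"
      then have "y \<in> con (ext ?I)" using y by (simp add: con_def)
      then obtain s where "s \<in> carrier R" "s \<notin> P" "s \<otimes> y \<in> ?I" unfolding con_ext[OF I] R.saturation_iff by blast
      then show False using y(3) by (auto simp: colon_def)
    qed
    fix z assume "z \<in> ext P"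
    then obtain a s where a: "z \<in> carrier A" "a \<in> P" "s \<in> carrier R" "s \<notin> P" "z \<otimes>\<^bsub>A\<^esub> \<phi> s = \<phi> a" by (rule extE)
    have ac: "a \<in> carrier R" "a \<otimes> y \<in> ?I" using a(2) y(3) by (auto simp: colon_def)
    have c: "\<phi> s \<in> carrier A" "\<phi> y \<in> carrier A" using a y by auto
    have "(z \<otimes>\<^bsub>A\<^esub> \<phi> y) \<otimes>\<^bsub>A\<^esub> \<phi> s = (z \<otimes>\<^bsub>A\<^esub> \<phi> s) \<otimes>\<^bsub>A\<^esub> \<phi> y" using a(1) c by algebra
    also have "\<dots> = \<phi> (a \<otimes> y)" unfolding a(5) using ac y by simp
    finally show "z \<otimes>\<^bsub>A\<^esub> \<phi> y \<in> ext ?I" using a c ac by (intro extI[of _ "a \<otimes> y"]) auto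
  next
    show "finite (\<phi> ` F)" "\<phi> ` F \<subseteq> carrier A" using F by auto
    show "ideal {\<zero>\<^bsub>A\<^esub>} A" by (rule A.zeroideal)
    show "ext ?I \<subseteq> K \<longleftrightarrow> {\<zero>\<^bsub>A\<^esub>} \<subseteq> K \<and> \<phi> ` F \<subseteq> K" if K: "ideal K A" for K
      using ext_Idl[OF F(2) K] ideal_zero[OF K] by auto
    have "depth A = enat D" using cm krull_dim_eq D by (simp add: cohen_macaulay_local_def)
    then show "\<forall>j<D. L.vanishes j {\<zero>\<^bsub>A\<^esub>}" using depth[of D] by simp
    show "D + card (\<phi> ` F) \<le> D + card F" using card_image_le[OF F(1)] by simp
  qed
  then have "D \<le> card F" using card_image_le[OF F(1)] order_trans by blast
  moreover have "card F \<le> D"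
    using order_trans[OF ht ideal_height_le[OF P y(4)]] D by simp
  ultimately show ?thesis using D by simp
qed

lemma cohen_macaulay_localI:
  assumes unmixed: "\<And>k r. (\<forall>i\<in>{1..k}. r i \<in> carrier R) \<Longrightarrow> ideal_height R (Idl (r ` {1..k})) = enat k \<Longrightarrow>
      (\<forall>Q\<in>ass_primes R (Idl (r ` {1..k})). prime_height R Q = enat k)"
  shows "cohen_macaulay_local A"
proof -
  obtain n where n: "prime_height R P = enat n" using prime_height_finite[OF P] .
  have nc: "has_chain R n P" "\<not> has_chain R (Suc n) P" using n prime_height_eq_iff[OF P] by auto
  note Pi = prime_ideal[OF P]
  have mi: "ideal (ext P) A" by (rule ext_ideal[OF Pi])
  obtain B :: "nat \<Rightarrow> ('c, 'c set) symbol set" and d e where res: "residue_resolution A (ext P) B d e"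
    and depth: "\<And>t. enat t \<le> depth A \<longleftrightarrow> (\<forall>j<t. residue_resolution.vanishes A B d j {\<zero>\<^bsub>A\<^esub>})"
    using A.depth_ge[OF max_ideal_eq mi] by metis
  interpret L: local_depth A "ext P" B d e by (rule local_depth[OF res])
  \<comment> \<open>The last clause carries the gain in depth: each element shifts the vanishing
    range up by one degree. For i = n, the vacuous case t = 0 gives depth at least n.\<close>
  have "\<exists>r. (\<forall>j\<in>{1..i}. r j \<in> P) \<and> ideal_height R (Idl (r ` {1..i})) = enat i \<and>
      (\<forall>t. (\<forall>j<t. L.vanishes j (ext (Idl (r ` {1..i})))) \<longrightarrow> (\<forall>j<t + i. L.vanishes j {\<zero>\<^bsub>A\<^esub>}))"
    if "i \<le> n" for i
    using that
  proof (induction i)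
    case 0
    have "Idl {} = {\<zero>}" 
      using R.genideal_minimal[OF R.zeroideal, of "{}"] ideal_zero[OF R.genideal_ideal[of "{}"]] by auto
    moreover have "ideal_height R (Idl {}) = 0"
      using ideal_height_le_card[of "{}" P] P by (simp add: zero_enat_def[symmetric])
    ultimately show ?case using ext_zero by (simp add: zero_enat_def[symmetric])
  next
    case (Suc i)
    then obtain r where r: "\<And>j. j \<in> {1..i} \<Longrightarrow> r j \<in> P" and ht: "ideal_height R (Idl (r ` {1..i})) = enat i"
      and van: "\<And>t. (\<forall>j<t. L.vanishes j (ext (Idl (r ` {1..i})))) \<Longrightarrow> (\<forall>j<t + i. L.vanishes j {\<zero>\<^bsub>A\<^esub>})"
      using Suc_leD by blast
    let ?I = "Idl (r ` {1..i})"
    have rc: "r ` {1..i} \<subseteq> carrier R" using r ideal_carr[OF Pi] by blast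
    have I: "ideal ?I R" by (rule R.genideal_ideal[OF rc])
    have "\<not> P \<subseteq> Q" if Q: "Q \<in> ass_primes R ?I" for Q
    proof
      assume PQ: "P \<subseteq> Q"
      have Qp: "primeideal Q R" using Q by (simp add: ass_primes_def)
      have "prime_height R Q = enat i" using unmixed[OF _ ht] rc Q by blast
      then have "\<not> has_chain R (Suc i) Q" using prime_height_eq_iff[OF Qp] by simp
      moreover have "has_chain R n Q" using has_chain_mono[OF nc(1) PQ Qp] .
      ultimately show False using Suc.prems has_chain_less by blast
    qed
    moreover have "\<And>Q. Q \<in> ass_primes R ?I \<Longrightarrow> primeideal Q R" by (auto simp: ass_primes_def)
    ultimately obtain x where x: "x \<in> P" "\<And>Q. Q \<in> ass_primes R ?I \<Longrightarrow> x \<notin> Q"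
      using R.prime_avoidance[OF finite_ass_primes[OF I] _ Pi] by metis
    have xc: "x \<in> carrier R" using ideal_carr[OF Pi x(1)] .
    note reg = regular_mod_iff[OF I xc x(2)]
    let ?r = "r(Suc i := x)"
    have im: "?r ` {1..Suc i} = insert x (r ` {1..i})"
      by (auto simp: image_iff atLeastAtMostSuc_conv)
    have Idl: "Idl (?r ` {1..Suc i}) = adjoin R ?I x" unfolding im by (rule R.Idl_insert[OF rc xc])
    \<comment> \<open>Krull bounds the height by i + 1, and regularity of x gives the opposite
      bound. Equality is needed in the next round, since the hypothesis concerns only ideals whose
      height equals the number of generators.\<close>
    have "ideal_height R (adjoin R ?I x) \<le> enat (card (?r ` {1..Suc i}))"
      unfolding Idl[symmetric] by (rule ideal_height_le_card[OF _ P]) (use im x(1) r in auto)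
    also have "\<dots> \<le> enat (Suc i)" using card_image_le[of "{1..Suc i}" ?r] by simp
    finally have "ideal_height R (adjoin R ?I x) = enat (Suc i)"
      using height_adjoin_regular[OF I xc reg, of i] ht by (simp add: order_antisym)
    moreover have "\<forall>j\<in>{1..Suc i}. ?r j \<in> P" using r x(1) by auto
    moreover have "\<forall>j<t + Suc i. L.vanishes j {\<zero>\<^bsub>A\<^esub>}" if t: "\<forall>j<t. L.vanishes j (ext (adjoin R ?I x))" for t
    proof -
      have "\<forall>j<Suc t. L.vanishes j (ext ?I)"
        by (rule L.vanishing_Suc[OF ext_ideal[OF I] image_in_ext[OF Pi x(1)]])
          (use ext_regular[OF I xc reg] t ext_adjoin[OF I xc] in auto)
      then show ?thesis using van[of "Suc t"] by simp
    qed
    ultimately show ?case unfolding Idl[symmetric] by blast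
  qed
  from this[of n] have "\<forall>j<n. L.vanishes j {\<zero>\<^bsub>A\<^esub>}" by (metis add_0 le_refl not_less_zero)
  then have "enat n \<le> depth A" using depth by simp
  \<comment> \<open>A longer vanishing range would produce a chain of length n + 1 ending in the
    maximal ideal.\<close>
  moreover have "\<not> enat (Suc n) \<le> depth A"
    using L.vanishing_le_dim[of "Suc n"] depth[of "Suc n"] has_chain_max nc by auto
  ultimately have "depth A = enat n" by (cases "depth A") auto
  then show ?thesis using local_ring krull_dim_eq n by (simp add: cohen_macaulay_local_def)
qed

end

theorem theorem1p9:
  fixes R :: "('a, 'r) ring_scheme"
  assumes "cring R" and "noetherian_ring R"
  shows "cohen_macaulay R \<longleftrightarrow>
    (\<forall>(k::nat) (r :: nat \<Rightarrow> 'a).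
      (\<forall>i\<in>{1..k}. r i \<in> carrier R) \<and> ideal_height R (Idl\<^bsub>R\<^esub> (r ` {1..k})) = enat k \<longrightarrow>
      unmixed R (Idl\<^bsub>R\<^esub> (r ` {1..k})))"
proof -
  interpret noetherian_cring R using assms by (simp add: noetherian_cring_def)
  have loc: "noetherian_localization R (localization_at_prime R P) (\<lambda>a. fraction R (carrier R - P) a \<one>\<^bsub>R\<^esub>) P"
    if P: "primeideal P R" for P
    using loc_prime_localization[OF P] noetherian_cring_axioms by (simp add: noetherian_localization_def)
  have idl: "ideal (Idl\<^bsub>R\<^esub> (r ` {1..k})) R" if "\<forall>i\<in>{1..k}. r i \<in> carrier R" for k and r :: "nat \<Rightarrow> 'a"
    using that by (intro genideal_ideal) auto
  have unmixed_iff: "unmixed R I \<longleftrightarrow> (\<forall>P\<in>ass_primes R I. prime_height R P = ideal_height R I)" if "ideal I R" for I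
    using that associated_primes_quotient[OF that] by (simp add: unmixed_def)
  show ?thesis
  proof
    assume cm: "cohen_macaulay R"
    show "\<forall>k r. (\<forall>i\<in>{1..k}. r i \<in> carrier R) \<and> ideal_height R (Idl\<^bsub>R\<^esub> (r ` {1..k})) = enat k \<longrightarrow>
        unmixed R (Idl\<^bsub>R\<^esub> (r ` {1..k}))"
    proof (intro allI impI)
      fix k :: nat and r :: "nat \<Rightarrow> 'a"
      let ?F = "r ` {1..k}"
      assume "(\<forall>i\<in>{1..k}. r i \<in> carrier R) \<and> ideal_height R (Idl\<^bsub>R\<^esub> ?F) = enat k"
      then have r: "\<forall>i\<in>{1..k}. r i \<in> carrier R" and ht: "ideal_height R (Idl\<^bsub>R\<^esub> ?F) = enat k" by auto
      have Fc: "?F \<subseteq> carrier R" using r by auto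
      have "prime_height R P = enat k" if ass: "P \<in> ass_primes R (Idl\<^bsub>R\<^esub> ?F)" for P
      proof -
        have P: "primeideal P R" using ass by (simp add: ass_primes_def)
        have "Idl\<^bsub>R\<^esub> ?F \<subseteq> P" using ass_primesD[OF idl[OF r] ass] by metis
        then have "?F \<subseteq> P" using genideal_self[OF Fc] by auto
        \<comment> \<open>The family r may repeat values, while
          \<open>height_associated_prime\<close> counts distinct generators. Krull's theorem
          excludes repetitions here, because the ideal lies in P and has height k.\<close>
        then have "k \<le> card ?F" using ideal_height_le_card[OF _ P, of ?F] ht by simp
        then have card: "card ?F = k" using card_image_le[of "{1..k}" r] by simp
        have "cohen_macaulay_local (localization_at_prime R P)" using cm P by (simp add: cohen_macaulay_def)
        from noetherian_localization.height_associated_prime[OF loc[OF P] this _ Fc _ ass]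
        show ?thesis using card ht by simp
      qed
      then show "unmixed R (Idl\<^bsub>R\<^esub> ?F)" using unmixed_iff[OF idl[OF r]] ht by simp
    qed
  next
    assume un: "\<forall>k r. (\<forall>i\<in>{1..k}. r i \<in> carrier R) \<and> ideal_height R (Idl\<^bsub>R\<^esub> (r ` {1..k})) = enat k \<longrightarrow>
        unmixed R (Idl\<^bsub>R\<^esub> (r ` {1..k}))"
    show "cohen_macaulay R"
      unfolding cohen_macaulay_def
    proof (intro allI impI)
      fix P assume P: "primeideal P R"
      show "cohen_macaulay_local (localization_at_prime R P)"
      proof (rule noetherian_localization.cohen_macaulay_localI[OF loc[OF P]])
        fix k and r :: "nat \<Rightarrow> 'a"
        assume r: "\<forall>i\<in>{1..k}. r i \<in> carrier R" and ht: "ideal_height R (Idl\<^bsub>R\<^esub> (r ` {1..k})) = enat k"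
        then have "unmixed R (Idl\<^bsub>R\<^esub> (r ` {1..k}))" using un by blast
        then show "\<forall>Q\<in>ass_primes R (Idl\<^bsub>R\<^esub> (r ` {1..k})). prime_height R Q = enat k"
          using unmixed_iff[OF idl[OF r]] ht by simp
      qed
    qed
  qed
qed

end
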